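(* Let $f$ be a continuous nonnegative function on $(0,\infty)$. Then the following conditions are equivalent: (a1) $f$ is operator monotone decreasing; (a2) $f(A\,\triangledown\,B)\le f(A)\,\sigma\,f(B)$ for all $A,B\in B(\mathcal{H})^{++}$ and for all symmetric operator means $\sigma$; (a3) $f$ is operator log-convex, i.e., $f(A\,\triangledown\,B)\le f(A)\,\#\,f(B)$ for all $A,B\in B(\mathcal{H})^{++}$; (a4) $f(A\,\triangledown\,B)\le f(A)\,\sigma\,f(B)$ for all $A,B\in B(\mathcal{H})^{++}$ and for some symmetric operator mean $\sigma\ne\triangledown$.
   Context: $\mathcal{H}$ is an infinite-dimensional separable Hilbert space, $B(\mathcal{H})^+$ is the set of positive (i.e. positive semidefinite) bounded operators on $\mathcal{H}$, $B(\mathcal{H})^{++}$ is the set of invertible elements of $B(\mathcal{H})^+$, and $I$ is the identity operator. $f(A)$ is defined by continuous functional calculus. A continuous real function $f$ on $(0,\infty)$ is operator monotone if $A\ge B$ implies $f(A)\ge f(B)$ for $A,B\in B(\mathcal{H})^{++}$, and operator monotone decreasing if $-f$ is operator monotone. Operator means (Kubo–Ando): to each nonnegative (continuous) operator monotone function $h$ on $[0,\infty)$ with $h(1)=1$ corresponds the operator mean $\sigma=\sigma_h$ given by $A\,\sigma\,B:=A^{1/2}h(A^{-1/2}BA^{-1/2})A^{1/2}$ for $A,B\in B(\mathcal{H})^{++}$, extended to $A,B\in B(\mathcal{H})^+$ by $A\,\sigma\,B:=\lim_{\varepsilon\searrow0}(A+\varepsilon I)\,\sigma\,(B+\varepsilon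 I)$ in the strong operator topology. An operator mean $\sigma$ is symmetric if $A\,\sigma\,B=B\,\sigma\,A$ for all $A,B\in B(\mathcal{H})^{++}$. The arithmetic mean is $A\,\triangledown\,B:=(A+B)/2$ (corresponding to $h(x)=(1+x)/2$), and the geometric mean is $A\,\#\,B:=A^{1/2}(A^{-1/2}BA^{-1/2})^{1/2}A^{1/2}$ for $A,B\in B(\mathcal{H})^{++}$ (corresponding to $h(x)=x^{1/2}$), extended to $A,B\in B(\mathcal{H})^+$ by $A\,\#\,B:=\lim_{\varepsilon\searrow0}(A+\varepsilon I)\,\#\,(B+\varepsilon I)$ in the strong operator topology. *)

theory Defs
  imports "HOL-Analysis.Analysis" "HOL-Computational_Algebra.Polynomial"
begin

section \<open>Complex Hilbert spaces\<close>

text \<open>The inner product is linear in the first and conjugate-linear in the second argument.\<close>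

class complex_hilbert_space = banach +
  fixes scaleC :: "complex \<Rightarrow> 'a \<Rightarrow> 'a"  (infixr \<open>*\<^sub>C\<close> 75)
    and cinner :: "'a \<Rightarrow> 'a \<Rightarrow> complex"
  assumes scaleC_add_right: "a *\<^sub>C (x + y) = a *\<^sub>C x + a *\<^sub>C y"
    and scaleC_add_left: "(a + b) *\<^sub>C x = a *\<^sub>C x + b *\<^sub>C x"
    and scaleC_scaleC: "a *\<^sub>C b *\<^sub>C x = (a * b) *\<^sub>C x"
    and scaleC_of_real: "complex_of_real r *\<^sub>C x = r *\<^sub>R x"
    and cinner_commute: "cinner x y = cnj (cinner y x)"
    and cinner_add_left: "cinner (x + y) z = cinner x z + cinner y z"
    and cinner_scaleC_left: "cinner (a *\<^sub>C x) y = a * cinner x y"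
    and cinner_self: "cinner x x = complex_of_real ((norm x)\<^sup>2)"

text \<open>This makes \<open>module.span scaleC\<close> the complex linear span.\<close>

lemma vector_space_scaleC: "vector_space (scaleC :: complex \<Rightarrow> 'h \<Rightarrow> 'h::complex_hilbert_space)"
proof
  fix x :: 'h
  show "1 *\<^sub>C x = x"
    using scaleC_of_real[of 1 x] by simp
qed (simp_all add: scaleC_add_right scaleC_add_left scaleC_scaleC)

section \<open>Bounded operators\<close>

text \<open>
  The library type \<open>'h \<Rightarrow>\<^sub>L 'h\<close> consists of the bounded real-linear maps; \<open>B(H)\<close> is the
  subset of those that are complex linear.
\<close>

definition bounded_operators :: "('h::complex_hilbert_space \<Rightarrow>\<^sub>L 'h) set" where
  "bounded_operators = {T. \<forall>c x. blinfun_apply T (c *\<^sub>C x) = c *\<^sub>C blinfun_apply T x}"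

definition positive_operators :: "('h::complex_hilbert_space \<Rightarrow>\<^sub>L 'h) set" where
  "positive_operators =
     {T \<in> bounded_operators. \<forall>x. cinner (blinfun_apply T x) x \<in> \<real>\<^sub>\<ge>\<^sub>0}"

definition positive_invertible_operators :: "('h::complex_hilbert_space \<Rightarrow>\<^sub>L 'h) set" where
  "positive_invertible_operators =
     {T \<in> positive_operators.
        \<exists>S \<in> bounded_operators. S o\<^sub>L T = id_blinfun \<and> T o\<^sub>L S = id_blinfun}"

definition loewner_le ::
    "('h::complex_hilbert_space \<Rightarrow>\<^sub>L 'h) \<Rightarrow> ('h \<Rightarrow>\<^sub>L 'h) \<Rightarrow> bool"  (infix \<open>\<le>\<^sub>L\<close> 50) where
  "A \<le>\<^sub>L B \<longleftrightarrow> B - A \<in> positive_operators"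

section \<open>Continuous functional calculus\<close>

definition op_spectrum :: "('h::complex_hilbert_space \<Rightarrow>\<^sub>L 'h) \<Rightarrow> complex set" where
  "op_spectrum A =
     {z. \<not> (\<exists>S \<in> bounded_operators. \<forall>x.
            blinfun_apply S (blinfun_apply A x - z *\<^sub>C x) = x \<and>
            blinfun_apply A (blinfun_apply S x) - z *\<^sub>C blinfun_apply S x = x)}"

definition op_poly ::
    "real poly \<Rightarrow> ('h::complex_hilbert_space \<Rightarrow>\<^sub>L 'h) \<Rightarrow> ('h \<Rightarrow>\<^sub>L 'h)" where
  "op_poly p A = (\<Sum>i\<le>degree p. coeff p i *\<^sub>R ((o\<^sub>L) A ^^ i) id_blinfun)"

text \<open>
  For self-adjoint \<open>A\<close> (whose spectrum is real) and real \<open>f\<close> continuous on the spectrum,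
  \<open>f(A)\<close> is the norm limit of \<open>p\<^sub>n(A)\<close> for polynomials \<open>p\<^sub>n\<close> tending to \<open>f\<close> uniformly on
  the spectrum of \<open>A\<close>.
\<close>

definition fun_calc ::
    "(real \<Rightarrow> real) \<Rightarrow> ('h::complex_hilbert_space \<Rightarrow>\<^sub>L 'h) \<Rightarrow> ('h \<Rightarrow>\<^sub>L 'h)" where
  "fun_calc f A =
     (THE T. \<forall>p :: nat \<Rightarrow> real poly.
        uniform_limit {t. complex_of_real t \<in> op_spectrum A} (\<lambda>n. poly (p n)) f sequentially
        \<longrightarrow> (\<lambda>n. op_poly (p n) A) \<longlonglongrightarrow> T)"

text \<open>
  Monotonicity with respect to operators from the set \<open>D\<close>: operator monotonicity on
  \<open>(0,\<infinity>)\<close> is \<open>D = positive_invertible_operators\<close>, and operator monotonicity on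
  \<open>[0,\<infinity>)\<close> is \<open>D = positive_operators\<close>.
\<close>

definition operator_monotone_on ::
    "('h::complex_hilbert_space \<Rightarrow>\<^sub>L 'h) set \<Rightarrow> (real \<Rightarrow> real) \<Rightarrow> bool" where
  "operator_monotone_on D f \<longleftrightarrow>
     (\<forall>A\<in>D. \<forall>B\<in>D. B \<le>\<^sub>L A \<longrightarrow> fun_calc f B \<le>\<^sub>L fun_calc f A)"

section \<open>Operator means\<close>

definition mean_formula ::
    "(real \<Rightarrow> real) \<Rightarrow> ('h::complex_hilbert_space \<Rightarrow>\<^sub>L 'h) \<Rightarrow> ('h \<Rightarrow>\<^sub>L 'h) \<Rightarrow> ('h \<Rightarrow>\<^sub>L 'h)" where
  "mean_formula h A B =
     (let R = fun_calc sqrt A; R' = fun_calc (\<lambda>t. 1 / sqrt t) A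
      in R o\<^sub>L fun_calc h (R' o\<^sub>L B o\<^sub>L R') o\<^sub>L R)"

definition mean_of ::
    "(real \<Rightarrow> real) \<Rightarrow> ('h::complex_hilbert_space \<Rightarrow>\<^sub>L 'h) \<Rightarrow> ('h \<Rightarrow>\<^sub>L 'h) \<Rightarrow> ('h \<Rightarrow>\<^sub>L 'h)" where
  "mean_of h A B =
     (if A \<in> positive_invertible_operators \<and> B \<in> positive_invertible_operators
      then mean_formula h A B
      else (THE L. limitin strong_operator_topology
              (\<lambda>\<epsilon>::real. mean_formula h (A + \<epsilon> *\<^sub>R id_blinfun) (B + \<epsilon> *\<^sub>R id_blinfun))
              L (at_right 0)))"

text \<open>
  An operator mean is a binary operation on the positive operators; the values of \<open>\<sigma>\<close>
  at other arguments are irrelevant.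
\<close>

definition operator_mean ::
    "(('h::complex_hilbert_space \<Rightarrow>\<^sub>L 'h) \<Rightarrow> ('h \<Rightarrow>\<^sub>L 'h) \<Rightarrow> ('h \<Rightarrow>\<^sub>L 'h)) \<Rightarrow> bool" where
  "operator_mean \<sigma> \<longleftrightarrow>
     (\<exists>h :: real \<Rightarrow> real.
        continuous_on {0..} h \<and> (\<forall>t\<ge>0. 0 \<le> h t) \<and> h 1 = 1 \<and>
        operator_monotone_on (positive_operators :: ('h \<Rightarrow>\<^sub>L 'h) set) h \<and>
        (\<forall>A\<in>positive_operators. \<forall>B\<in>positive_operators. \<sigma> A B = mean_of h A B))"

definition symmetric_operator_mean ::
    "(('h::complex_hilbert_space \<Rightarrow>\<^sub>L 'h) \<Rightarrow> ('h \<Rightarrow>\<^sub>L 'h) \<Rightarrow> ('h \<Rightarrow>\<^sub>L 'h)) \<Rightarrow> bool" where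
  "symmetric_operator_mean \<sigma> \<longleftrightarrow>
     operator_mean \<sigma> \<and>
     (\<forall>A\<in>positive_invertible_operators. \<forall>B\<in>positive_invertible_operators. \<sigma> A B = \<sigma> B A)"

definition arithmetic_mean ::
    "('h::complex_hilbert_space \<Rightarrow>\<^sub>L 'h) \<Rightarrow> ('h \<Rightarrow>\<^sub>L 'h) \<Rightarrow> ('h \<Rightarrow>\<^sub>L 'h)"  (infixl \<open>\<triangledown>\<close> 65) where
  "A \<triangledown> B = (1/2) *\<^sub>R (A + B)"

definition geometric_mean ::
    "('h::complex_hilbert_space \<Rightarrow>\<^sub>L 'h) \<Rightarrow> ('h \<Rightarrow>\<^sub>L 'h) \<Rightarrow> ('h \<Rightarrow>\<^sub>L 'h)" where
  "geometric_mean = mean_of sqrt"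

end

theory Submission
  imports Defs "HOL-Computational_Algebra.Fundamental_Theorem_Algebra" "HOL-Real_Asymp.Real_Asymp"
begin

text \<open>
  Let \<open>f\<close> be operator monotone decreasing. Then \<open>1 / (f + \<epsilon>)\<close> is operator monotone, and operator
  monotone functions are operator concave: since \<open>H\<close> is isomorphic to \<open>H \<oplus> H\<close>, one may rotate \<open>A \<oplus> B\<close>
  and compress to a diagonal block. Hence \<open>f(A \<triangledown> B)\<close> lies below the harmonic mean of \<open>f(A)\<close> and
  \<open>f(B)\<close>, which is the smallest symmetric operator mean.

  Conversely, let the inequality hold for the mean \<open>\<sigma>\<close> of \<open>h\<close>. As \<open>\<sigma>\<close> is below \<open>\<triangledown>\<close>, \<open>f\<close> is midpoint
  operator convex, and two-by-two matrices show that it is convex and \<open>O(x\<^sup>2)\<close>. If \<open>P\<close>, \<open>Q\<close> are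
  projections onto two lines at a small angle, then \<open>P \<sigma> Q = h(0) (P + Q)\<close>; the inequality for
  operators with eigenvalue \<open>x\<close> on these lines yields \<open>f(s x) \<le> (2 h(0) + o(1)) s f(x)\<close> as \<open>x\<close> tends
  to infinity with \<open>s < 1\<close> fixed, provided that \<open>f\<close> is unbounded. Since \<open>h(0) < 1/2\<close> for \<open>\<sigma> \<noteq> \<triangledown>\<close>,
  iterating with \<open>s\<close> close to \<open>1\<close> contradicts quadratic growth. So \<open>f\<close> is decreasing, and a midpoint
  operator convex function that is bounded at infinity is operator decreasing.
\<close>

section \<open>The real inner product and self-adjoint operators\<close>

text \<open>The means act on f(A) and f(B), which may be singular because f may vanish, and there a
  mean is only a strong limit. Hence all inequalities are between quadratic forms
  \<open>ip (T x) x\<close>, and a mean of singular operators is reached through its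
  regularizations, from above by \<open>mean_of_le_regularized\<close> and from below by
  \<open>le_mean_of\<close>. Operator concavity supplies every scalar fact about h: together with
  the symmetry h(t) = t h(1/t) it bounds h by the arithmetic function, for the adjoint of h it gives
  the harmonic lower bound, and it shows that h(0) \<ge> 1/2 would already force h(t) = (1 + t)/2.
  Convexity alone cannot bound f, since the square function is operator convex; the gap below 1/2 at
  0 has to do it. Up to lower order terms, f(s x) \<le> k s f(x) forces growth like a power of x
  with exponent 1 + log k / log s. For s, k < 1 this exceeds 2 exactly when s > k. Any k strictly
  between 2 h(0) and 1 is admissible, so it remains to take s between k and 1.\<close>

definition ip :: "'h::complex_hilbert_space \<Rightarrow> 'h \<Rightarrow> real" where
  "ip x y = Re (cinner x y)"

lemma ip_commute: "ip x y = ip y x"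
  unfolding ip_def by (subst cinner_commute) simp

lemma ip_add_left: "ip (x + y) z = ip x z + ip y z"
  by (simp add: ip_def cinner_add_left)

lemma ip_add_right: "ip z (x + y) = ip z x + ip z y"
  by (metis ip_commute ip_add_left)

lemma ip_scaleR_left: "ip (r *\<^sub>R x) y = r * ip x y"
proof -
  have "cinner (r *\<^sub>R x) y = of_real r * cinner x y"
    by (metis scaleC_of_real cinner_scaleC_left)
  then show ?thesis by (simp add: ip_def)
qed

lemma ip_scaleR_right: "ip x (r *\<^sub>R y) = r * ip x y"
  by (metis ip_commute ip_scaleR_left)

lemma ip_minus_left: "ip (- x) y = - ip x y"
  using ip_scaleR_left[of "-1" x y] by simp

lemma ip_minus_right: "ip x (- y) = - ip x y"
  by (metis ip_commute ip_minus_left)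

lemma ip_diff_left: "ip (x - y) z = ip x z - ip y z"
  using ip_add_left[of x "- y" z] by (simp add: ip_minus_left)

lemma ip_diff_right: "ip z (x - y) = ip z x - ip z y"
  by (metis ip_commute ip_diff_left)

lemma ip_zero_left [simp]: "ip 0 y = 0"
  using ip_scaleR_left[of 0 0 y] by simp

lemma ip_zero_right [simp]: "ip y 0 = 0"
  by (metis ip_commute ip_zero_left)

lemma ip_self: "ip x x = (norm x)\<^sup>2"
  by (simp add: ip_def cinner_self)

lemmas ip_simps = ip_add_left ip_add_right ip_scaleR_left ip_scaleR_right ip_minus_left
  ip_minus_right ip_diff_left ip_diff_right

text \<open>Stated without a sign condition on \<open>a\<close>: the quadratic forms to which it is
  applied may vanish at a vector.\<close>

lemma discriminant_bound:
  fixes a b c :: real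
  assumes "\<And>t. 0 \<le> a * t\<^sup>2 + 2 * b * t + c"
  shows "b\<^sup>2 \<le> a * c"
proof (cases "a = 0")
  case True
  have "b = 0"
  proof (rule ccontr)
    assume "b \<noteq> 0"
    \<comment> \<open>At this point the linear function takes the value -1.\<close>
    then show False using assms[of "- (c + 1) / (2 * b)"] True by (simp add: field_simps)
  qed
  then show ?thesis using True by simp
next
  case False
  have "a > 0"
  proof (rule ccontr)
    assume "\<not> a > 0"
    then have a: "a < 0" using False by simp
    \<comment> \<open>The choice makes \<open>a * t\<close> equal to \<open>a\<close> minus the sum
      of the other two coefficients in absolute value, so the quadratic term wins.\<close>
    define t where "t = 1 + (2 * \<bar>b\<bar> + \<bar>c\<bar>) / (- a)"
    have t1: "t \<ge> 1" using a by (simp add: t_def divide_nonneg_neg)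
    have at: "a * t = a - (2 * \<bar>b\<bar> + \<bar>c\<bar>)" using a by (simp add: t_def field_simps)
    have "a * t\<^sup>2 + 2 * b * t + c = t * (a * t) + 2 * b * t + c"
      by (simp add: power2_eq_square)
    also have "\<dots> = t * a - 2 * (\<bar>b\<bar> - b) * t - \<bar>c\<bar> * t + c"
      by (simp add: at algebra_simps)
    also have "\<dots> \<le> t * a - \<bar>c\<bar> * t + c"
      using t1 mult_nonneg_nonneg[of "\<bar>b\<bar> - b" t] by simp
    also have "\<dots> < 0"
      using t1 a mult_left_mono[of 1 t "\<bar>c\<bar>"] mult_pos_neg[of t a] by simp
    finally show False using assms[of t] by simp
  qed
  then show ?thesis using assms[of "- b / a"]
    by (simp add: field_simps power2_eq_square)
qed

lemma ip_Cauchy_Schwarz: "\<bar>ip x y\<bar> \<le> norm x * norm y"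
proof -
  have "ip (t *\<^sub>R x + y) (t *\<^sub>R x + y) = (norm x)\<^sup>2 * t\<^sup>2 + 2 * ip x y * t + (norm y)\<^sup>2" for t
    by (simp add: ip_simps ip_commute[of y x] power2_eq_square[of t] algebra_simps flip: ip_self)
  then have "0 \<le> (norm x)\<^sup>2 * t\<^sup>2 + 2 * ip x y * t + (norm y)\<^sup>2" for t
    by (metis ip_self zero_le_power2)
  from discriminant_bound[OF this] have "(ip x y)\<^sup>2 \<le> (norm x * norm y)\<^sup>2"
    by (simp add: power_mult_distrib)
  then show ?thesis by (rule power2_le_imp_le[of "\<bar>ip x y\<bar>", simplified]) simp
qed

lemma bounded_linear_ip_left: "bounded_linear (\<lambda>x. ip x y)"
  by (rule bounded_linear_intro[of _ "norm y"])
    (auto simp: ip_simps intro: ip_Cauchy_Schwarz)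

lemma bounded_linear_ip_right: "bounded_linear (ip x)"
  using bounded_linear_ip_left[of x] by (simp add: ip_commute[of _ x])

lemmas tendsto_ip_left = bounded_linear.tendsto[OF bounded_linear_ip_left]
lemmas tendsto_ip_right = bounded_linear.tendsto[OF bounded_linear_ip_right]

lemma bounded_operatorsI:
  "(\<And>c x. blinfun_apply T (c *\<^sub>C x) = c *\<^sub>C T x) \<Longrightarrow> T \<in> bounded_operators"
  by (simp add: bounded_operators_def)

lemma bounded_operatorsD: "T \<in> bounded_operators \<Longrightarrow> blinfun_apply T (c *\<^sub>C x) = c *\<^sub>C T x"
  by (simp add: bounded_operators_def)

lemma scaleC_scaleR_commute: "c *\<^sub>C r *\<^sub>R x = r *\<^sub>R c *\<^sub>C (x::'h::complex_hilbert_space)"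
  by (metis scaleC_of_real scaleC_scaleC mult.commute)

lemma scaleC_zero_right [simp]: "c *\<^sub>C (0::'h::complex_hilbert_space) = 0"
  by (metis scaleC_scaleR_commute scaleR_zero_left)

lemma scaleC_minus_right: "c *\<^sub>C (- x) = - (c *\<^sub>C (x::'h::complex_hilbert_space))"
  using scaleC_scaleR_commute[of c "-1" x] by simp

lemma scaleC_diff_right: "c *\<^sub>C (x - y) = c *\<^sub>C x - c *\<^sub>C (y::'h::complex_hilbert_space)"
  using scaleC_add_right[of c x "- y"] by (simp add: scaleC_minus_right)

lemma norm_scaleC: "norm (c *\<^sub>C (x::'h::complex_hilbert_space)) = cmod c * norm x"
proof -
  have "complex_of_real ((norm (c *\<^sub>C x))\<^sup>2) = c * cnj (c * cinner x x)"
    by (metis cinner_self cinner_scaleC_left cinner_commute)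
  also have "\<dots> = complex_of_real ((cmod c * norm x)\<^sup>2)"
    by (simp add: cinner_self complex_norm_square power_mult_distrib mult.assoc[symmetric]
        del: of_real_power)
  finally have "(norm (c *\<^sub>C x))\<^sup>2 = (cmod c * norm x)\<^sup>2" using of_real_eq_iff by blast
  then show ?thesis by (simp add: power2_eq_iff_nonneg)
qed

lemma bounded_linear_scaleC_right: "bounded_linear (scaleC c :: 'h::complex_hilbert_space \<Rightarrow> 'h)"
  by (rule bounded_linear_intro[of _ "cmod c"])
    (auto simp: scaleC_add_right scaleC_scaleR_commute norm_scaleC mult.commute)

lemma bounded_operators_closed [intro, simp]:
  "id_blinfun \<in> bounded_operators"
  "0 \<in> bounded_operators"
  "S \<in> bounded_operators \<Longrightarrow> T \<in> bounded_operators \<Longrightarrow> S + T \<in> bounded_operators"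
  "S \<in> bounded_operators \<Longrightarrow> T \<in> bounded_operators \<Longrightarrow> S - T \<in> bounded_operators"
  "T \<in> bounded_operators \<Longrightarrow> r *\<^sub>R T \<in> bounded_operators"
  "S \<in> bounded_operators \<Longrightarrow> T \<in> bounded_operators \<Longrightarrow> S o\<^sub>L T \<in> bounded_operators"
  by (auto simp: bounded_operators_def blinfun.bilinear_simps scaleC_add_right scaleC_diff_right
      scaleC_scaleR_commute)

lemma tendsto_blinfun_apply: "(F \<longlongrightarrow> T) net \<Longrightarrow> ((\<lambda>n. blinfun_apply (F n) x) \<longlongrightarrow> T x) net"
  by (intro tendsto_intros)

text \<open>Symmetry for the real inner product suffices: for complex-linear operators it gives
  symmetry for \<open>cinner\<close>, as \<open>self_adjoint_cinner\<close> shows.\<close>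

definition self_adjoint :: "('h::complex_hilbert_space \<Rightarrow>\<^sub>L 'h) \<Rightarrow> bool" where
  "self_adjoint T \<longleftrightarrow> T \<in> bounded_operators \<and> (\<forall>x y. ip (T x) y = ip x (T y))"

lemma self_adjoint_ip: "self_adjoint T \<Longrightarrow> ip (blinfun_apply T x) y = ip x (T y)"
  by (simp add: self_adjoint_def)

lemma self_adjoint_bounded: "self_adjoint T \<Longrightarrow> T \<in> bounded_operators"
  by (simp add: self_adjoint_def)

lemma self_adjoint_closed [intro, simp]:
  "self_adjoint id_blinfun"
  "self_adjoint 0"
  "self_adjoint S \<Longrightarrow> self_adjoint T \<Longrightarrow> self_adjoint (S + T)"
  "self_adjoint S \<Longrightarrow> self_adjoint T \<Longrightarrow> self_adjoint (S - T)"
  "self_adjoint T \<Longrightarrow> self_adjoint (r *\<^sub>R T)"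
  by (auto simp: self_adjoint_def blinfun.bilinear_simps ip_simps)

lemma self_adjoint_compose:
  "self_adjoint S \<Longrightarrow> self_adjoint T \<Longrightarrow> S o\<^sub>L T = T o\<^sub>L S \<Longrightarrow> self_adjoint (S o\<^sub>L T)"
  unfolding self_adjoint_def
  by (metis blinfun_apply_blinfun_compose bounded_operators_closed(6))

lemma self_adjoint_sandwich:
  "self_adjoint S \<Longrightarrow> self_adjoint T \<Longrightarrow> self_adjoint (S o\<^sub>L T o\<^sub>L S)"
  by (auto simp: self_adjoint_def)

lemma self_adjoint_limit:
  assumes "\<And>n. self_adjoint (F n)" "F \<longlonglongrightarrow> T"
  shows "self_adjoint T"
  unfolding self_adjoint_def
proof (intro conjI allI bounded_operatorsI)
  fix c x y
  note lim = tendsto_blinfun_apply[OF assms(2)]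
  have "(\<lambda>n. F n (c *\<^sub>C x)) \<longlonglongrightarrow> c *\<^sub>C T x"
    using bounded_linear.tendsto[OF bounded_linear_scaleC_right lim[of x]]
    by (simp add: bounded_operatorsD[OF self_adjoint_bounded[OF assms(1)]])
  then show "T (c *\<^sub>C x) = c *\<^sub>C T x" using LIMSEQ_unique[OF lim] by blast
  have "(\<lambda>n. ip (F n x) y) \<longlonglongrightarrow> ip x (T y)"
    using tendsto_ip_right[OF lim, of x y] by (simp add: self_adjoint_ip[OF assms(1)])
  then show "ip (T x) y = ip x (T y)" using LIMSEQ_unique[OF tendsto_ip_left[OF lim]] by blast
qed

text \<open>This recovers \<open>cinner\<close> from its real part, so that arguments can be phrased
  with the real-valued \<open>ip\<close>.\<close>

lemma Im_cinner_eq: "Im (cinner x y) = ip x (\<i> *\<^sub>C y)"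
proof -
  have "ip x (\<i> *\<^sub>C y) = Re (\<i> * cinner y x)"
    unfolding ip_commute[of x] by (simp only: ip_def cinner_scaleC_left)
  also have "\<dots> = Im (cinner x y)" by (subst (2) cinner_commute) simp
  finally show ?thesis by simp
qed

text \<open>Over the complex numbers a real-valued quadratic form forces symmetry. Reality of
  \<open>cinner (T x) x\<close> means \<open>ip (T x) (\<i> *\<^sub>C x) = 0\<close>; polarizing
  this and inserting \<open>\<i> *\<^sub>C y\<close> gives
  \<open>ip (T x) y = ip x (T y)\<close>.\<close>

lemma positive_operators_iff:
  "T \<in> positive_operators \<longleftrightarrow> self_adjoint T \<and> (\<forall>x. 0 \<le> ip (blinfun_apply T x) x)"
proof (intro iffI conjI allI)
  assume T: "T \<in> positive_operators"
  then have b: "T \<in> bounded_operators"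
    and pos: "\<And>x. cinner (T x) x \<in> \<real>\<^sub>\<ge>\<^sub>0"
    by (auto simp: positive_operators_def)
  then show "0 \<le> ip (T x) x" for x by (auto simp: ip_def complex_nonneg_Reals_iff)
  have im: "ip (T x) (\<i> *\<^sub>C x) = 0" for x
    using pos[of x] by (simp add: Im_cinner_eq[symmetric] complex_nonneg_Reals_iff)
  have ii: "\<i> *\<^sub>C \<i> *\<^sub>C x = - x" for x :: 'a
    using scaleC_of_real[of "-1" x] by (simp add: scaleC_scaleC)
  have skew: "ip (\<i> *\<^sub>C u) (\<i> *\<^sub>C v) = ip u v" for u v :: 'a
  proof -
    have "cinner (\<i> *\<^sub>C u) (\<i> *\<^sub>C v) = \<i> * cnj (\<i> * cinner v u)"
      by (metis cinner_scaleC_left cinner_commute)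
    then show ?thesis by (simp add: ip_def cinner_commute[of u v])
  qed
  show "self_adjoint T"
    unfolding self_adjoint_def
  proof (intro conjI allI b)
    fix x y
    have *: "ip (T x) (\<i> *\<^sub>C z) + ip (T z) (\<i> *\<^sub>C x) = 0" for z
      using im[of "x + z"] by (simp add: blinfun.bilinear_simps scaleC_add_right ip_simps im add.commute)
    have "ip (T x) y = - ip (T x) (\<i> *\<^sub>C \<i> *\<^sub>C y)" by (simp add: ii ip_simps)
    also have "\<dots> = ip (T (\<i> *\<^sub>C y)) (\<i> *\<^sub>C x)" using *[of "\<i> *\<^sub>C y"] by simp
    also have "\<dots> = ip x (T y)"
      by (simp add: bounded_operatorsD[OF b] skew ip_commute)
    finally show "ip (T x) y = ip x (T y)" .
  qed
next
  assume T: "self_adjoint T \<and> (\<forall>x. 0 \<le> ip (T x) x)"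
  then have b: "T \<in> bounded_operators" by (simp add: self_adjoint_def)
  have "Im (cinner (T x) x) = 0" for x
  proof -
    have "ip (T x) (\<i> *\<^sub>C x) = ip x (\<i> *\<^sub>C T x)"
      using T by (simp add: self_adjoint_def bounded_operatorsD[OF b])
    then have "Im (cinner (T x) x) = Im (cinner x (T x))" by (simp add: Im_cinner_eq)
    then show ?thesis by (subst (asm) (2) cinner_commute) simp
  qed
  then show "T \<in> positive_operators"
    using T b by (auto simp: positive_operators_def complex_nonneg_Reals_iff ip_def)
qed

lemma loewner_le_iff:
  assumes "self_adjoint A" "self_adjoint B"
  shows "A \<le>\<^sub>L B \<longleftrightarrow> (\<forall>x. ip (blinfun_apply A x) x \<le> ip (blinfun_apply B x) x)"
  using assms by (simp add: loewner_le_def positive_operators_iff blinfun.bilinear_simps ip_simps)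

lemma loewner_le_ip: "A \<le>\<^sub>L B \<Longrightarrow> ip (blinfun_apply A x) x \<le> ip (blinfun_apply B x) x"
  by (simp add: loewner_le_def positive_operators_iff blinfun.bilinear_simps ip_simps)

lemma positive_Cauchy_Schwarz:
  assumes "self_adjoint G" "\<And>x. 0 \<le> ip (blinfun_apply G x) x"
  shows "(ip (blinfun_apply G x) y)\<^sup>2 \<le> ip (G x) x * ip (G y) y"
proof -
  have "0 \<le> ip (G (t *\<^sub>R x + y)) (t *\<^sub>R x + y)" for t by (rule assms(2))
  moreover have "ip (G y) x = ip (G x) y" by (metis assms(1) ip_commute self_adjoint_ip)
  ultimately have "0 \<le> ip (G x) x * t\<^sup>2 + 2 * ip (G x) y * t + ip (G y) y" for t
    by (simp add: ip_simps blinfun.bilinear_simps power2_eq_square algebra_simps)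
  from discriminant_bound[OF this] show ?thesis .
qed

text \<open>Cauchy-Schwarz for the semi-inner product \<open>ip (G x) y\<close>, taken at
  \<open>x\<close> and \<open>G x\<close>. It converts bounds on quadratic forms into bounds on
  norms.\<close>

lemma positive_norm_le:
  assumes G: "self_adjoint G" "\<And>x. 0 \<le> ip (blinfun_apply G x) x"
    and k: "\<And>x. ip (blinfun_apply G x) x \<le> k * (norm x)\<^sup>2"
  shows "(norm (blinfun_apply G x))\<^sup>2 \<le> k * ip (G x) x"
proof (cases "G x = 0")
  case False
  have "((norm (G x))\<^sup>2)\<^sup>2 \<le> ip (G x) x * ip (G (G x)) (G x)"
    using positive_Cauchy_Schwarz[OF G, of x "G x"] by (simp add: ip_self)
  also have "\<dots> \<le> ip (G x) x * (k * (norm (G x))\<^sup>2)"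
    by (intro mult_left_mono k G)
  finally show ?thesis using False by (simp add: power2_eq_square algebra_simps)
qed simp

section \<open>Invertibility and coercivity\<close>

definition invertible_operator :: "('h::complex_hilbert_space \<Rightarrow>\<^sub>L 'h) \<Rightarrow> bool" where
  "invertible_operator T \<longleftrightarrow>
     (\<exists>S \<in> bounded_operators. S o\<^sub>L T = id_blinfun \<and> T o\<^sub>L S = id_blinfun)"

lemma blinfun_compose_id [simp]: "id_blinfun o\<^sub>L T = T" "T o\<^sub>L id_blinfun = T"
  by (auto intro: blinfun_eqI)

lemma blinfun_compose_assoc: "(S o\<^sub>L T) o\<^sub>L U = S o\<^sub>L (T o\<^sub>L U)"
  by (auto intro: blinfun_eqI)

lemma blinfun_compose_add_left: "(S + T) o\<^sub>L U = (S o\<^sub>L U) + (T o\<^sub>L U)"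
  by (auto intro!: blinfun_eqI simp: blinfun.bilinear_simps)

lemma blinfun_compose_add_right: "U o\<^sub>L (S + T) = (U o\<^sub>L S) + (U o\<^sub>L T)"
  by (auto intro!: blinfun_eqI simp: blinfun.bilinear_simps)

lemma blinfun_compose_diff_left: "(S - T) o\<^sub>L U = (S o\<^sub>L U) - (T o\<^sub>L U)"
  by (auto intro!: blinfun_eqI simp: blinfun.bilinear_simps)

lemma blinfun_compose_diff_right: "U o\<^sub>L (S - T) = (U o\<^sub>L S) - (U o\<^sub>L T)"
  by (auto intro!: blinfun_eqI simp: blinfun.bilinear_simps)

lemma blinfun_compose_scaleR_left: "(r *\<^sub>R S) o\<^sub>L U = r *\<^sub>R (S o\<^sub>L U)"
  by (auto intro!: blinfun_eqI simp: blinfun.bilinear_simps)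

lemma blinfun_compose_scaleR_right: "U o\<^sub>L (r *\<^sub>R S) = r *\<^sub>R (U o\<^sub>L S)"
  by (auto intro!: blinfun_eqI simp: blinfun.bilinear_simps)

lemmas blinfun_compose_simps = blinfun_compose_add_left blinfun_compose_add_right
  blinfun_compose_diff_left blinfun_compose_diff_right
  blinfun_compose_scaleR_left blinfun_compose_scaleR_right

lemma invertible_operator_compose:
  assumes "invertible_operator S" "invertible_operator T"
  shows "invertible_operator (S o\<^sub>L T)"
proof -
  obtain S' T' where "S' \<in> bounded_operators" "S' o\<^sub>L S = id_blinfun" "S o\<^sub>L S' = id_blinfun"
    "T' \<in> bounded_operators" "T' o\<^sub>L T = id_blinfun" "T o\<^sub>L T' = id_blinfun"
    using assms by (auto simp: invertible_operator_def)
  then show ?thesis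
    unfolding invertible_operator_def
    by (intro bexI[of _ "T' o\<^sub>L S'"] conjI)
      (simp_all, (metis blinfun_compose_assoc blinfun_compose_id)+)
qed

text \<open>\<open>T = N (1 - G)\<close> with \<open>\<parallel>G\<parallel> < 1\<close>, so that \<open>T x = y\<close> is a fixed point equation for a
  contraction.\<close>

lemma coercive_invertible:
  assumes T: "self_adjoint T" and "c > 0"
    and coercive: "\<And>x. c * (norm x)\<^sup>2 \<le> ip (blinfun_apply T x) x"
  shows "invertible_operator T"
proof -
  \<comment> \<open>This \<open>N\<close> dominates the form of \<open>T\<close>, so
    \<open>G\<close> is positive; as \<open>c \<le> N\<close>, the number \<open>1 - c / N\<close>
    is a Lipschitz constant in \<open>[0, 1)\<close>.\<close>
  define N where "N = norm T + c"
  define G where "G = id_blinfun - (1 / N) *\<^sub>R T"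
  have N: "N > 0" "N \<ge> c" "N \<ge> norm T" using \<open>c > 0\<close> by (auto simp: N_def intro: add_nonneg_pos)
  have upper: "ip (T x) x \<le> N * (norm x)\<^sup>2" for x
  proof -
    have "ip (T x) x \<le> norm (T x) * norm x" using ip_Cauchy_Schwarz[of "T x" x] by simp
    also have "\<dots> \<le> norm T * norm x * norm x" by (intro mult_right_mono norm_blinfun) simp
    also have "\<dots> \<le> N * norm x * norm x" using N by (intro mult_right_mono) auto
    finally show ?thesis by (simp add: power2_eq_square)
  qed
  have G: "self_adjoint G" using T by (simp add: G_def)
  have Gip: "ip (G x) x = (norm x)\<^sup>2 - ip (T x) x / N" for x
    by (simp add: G_def blinfun.bilinear_simps ip_simps ip_self)
  have G0: "0 \<le> ip (G x) x" for x using upper[of x] N by (simp add: Gip field_simps)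
  define k where "k = 1 - c / N"
  have k: "0 \<le> k" "k < 1" using N \<open>c > 0\<close> by (auto simp: k_def)
  have Gk: "ip (G x) x \<le> k * (norm x)\<^sup>2" for x
    using divide_right_mono[OF coercive[of x], of N] N by (simp add: Gip k_def left_diff_distrib)
  have normG: "norm (G x) \<le> k * norm x" for x
  proof -
    have "(norm (G x))\<^sup>2 \<le> k * ip (G x) x" by (rule positive_norm_le[OF G G0 Gk])
    also have "\<dots> \<le> k * (k * (norm x)\<^sup>2)" by (intro mult_left_mono Gk k)
    also have "\<dots> = (k * norm x)\<^sup>2" by (simp add: power2_eq_square)
    finally show ?thesis by (rule power2_le_imp_le) (simp add: k)
  qed
  have ex: "\<exists>!x. T x = y" for y
  proof -
    have "\<exists>!x. G x + (1 / N) *\<^sub>R y = x"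
    proof (rule banach_fix_type[OF k], intro allI)
      fix u v
      show "dist (G u + (1 / N) *\<^sub>R y) (G v + (1 / N) *\<^sub>R y) \<le> k * dist u v"
        using normG[of "u - v"] by (simp add: dist_norm blinfun.bilinear_simps)
    qed
    moreover have "G x + (1 / N) *\<^sub>R y = x \<longleftrightarrow> T x = y" for x
      using N by (auto simp: G_def blinfun.bilinear_simps algebra_simps)
    ultimately show ?thesis by simp
  qed
  define s where "s = (\<lambda>y. THE x. T x = y)"
  have Ts: "T (s y) = y" for y unfolding s_def by (rule theI'[OF ex])
  have sT: "s (T x) = x" for x using ex[of "T x"] Ts by blast
  have bound: "norm x \<le> norm (T x) * (1 / c)" for x
  proof (cases "x = 0")
    case False
    have "c * (norm x * norm x) \<le> norm (T x) * norm x"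
      using coercive[of x] ip_Cauchy_Schwarz[of "T x" x] by (simp add: power2_eq_square)
    then have "c * norm x \<le> norm (T x)"
      using False by (simp add: mult.assoc[symmetric] mult_le_cancel_right)
    then show ?thesis using \<open>c > 0\<close> by (simp add: field_simps)
  qed simp
  have bl: "bounded_linear s"
  proof (rule bounded_linear_intro[of _ "1 / c"])
    show "s (x + y) = s x + s y" for x y
      by (metis Ts sT blinfun.add_right)
    show "s (r *\<^sub>R x) = r *\<^sub>R s x" for r x
      by (metis Ts sT blinfun.scaleR_right)
    show "norm (s x) \<le> norm x * (1 / c)" for x
      using bound[of "s x"] by (simp add: Ts)
  qed
  have app: "blinfun_apply (Blinfun s) = s" by (rule bounded_linear_Blinfun_apply[OF bl])
  have "Blinfun s \<in> bounded_operators"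
    by (rule bounded_operatorsI) (metis app Ts sT T bounded_operatorsD self_adjoint_bounded)
  then show ?thesis
    unfolding invertible_operator_def
    by (intro bexI[of _ "Blinfun s"]) (auto intro!: blinfun_eqI simp: app Ts sT)
qed

section \<open>Polynomials of self-adjoint operators\<close>

lemma op_poly_eq_sum:
  assumes "degree p \<le> n"
  shows "op_poly p A = (\<Sum>i\<le>n. coeff p i *\<^sub>R ((o\<^sub>L) A ^^ i) id_blinfun)"
  unfolding op_poly_def
  by (rule sum.mono_neutral_left) (use assms in \<open>auto simp: coeff_eq_0\<close>)

lemma op_poly_0 [simp]: "op_poly 0 A = 0"
  by (simp add: op_poly_def)

lemma op_poly_add: "op_poly (p + q) A = op_poly p A + op_poly q A"
proof -
  let ?n = "max (degree p) (degree q)"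
  show ?thesis
    using op_poly_eq_sum[of p ?n A] op_poly_eq_sum[of q ?n A]
      op_poly_eq_sum[of "p + q" ?n A, OF degree_add_le_max]
    by (simp add: sum.distrib scaleR_add_left)
qed

lemma op_poly_smult: "op_poly (smult c p) A = c *\<^sub>R op_poly p A"
  using op_poly_eq_sum[of "smult c p" "degree p" A, OF degree_smult_le]
  by (simp add: op_poly_def scaleR_sum_right)

lemma op_poly_pCons: "op_poly (pCons a p) A = a *\<^sub>R id_blinfun + (A o\<^sub>L op_poly p A)"
proof -
  have "op_poly (pCons a p) A =
      (\<Sum>i\<le>Suc (degree p). coeff (pCons a p) i *\<^sub>R ((o\<^sub>L) A ^^ i) id_blinfun)"
    by (rule op_poly_eq_sum) (simp add: degree_pCons_eq_if)
  also have "\<dots> = a *\<^sub>R id_blinfun +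
      (\<Sum>i\<le>degree p. coeff p i *\<^sub>R (A o\<^sub>L ((o\<^sub>L) A ^^ i) id_blinfun))"
    unfolding sum.atMost_Suc_shift by simp
  also have "(\<Sum>i\<le>degree p. coeff p i *\<^sub>R (A o\<^sub>L ((o\<^sub>L) A ^^ i) id_blinfun)) = A o\<^sub>L op_poly p A"
    by (simp add: op_poly_def blinfun_compose_scaleR_right
        bounded_bilinear.sum_right[OF bounded_bilinear_blinfun_compose])
  finally show ?thesis .
qed

lemma op_poly_diff: "op_poly (p - q) A = op_poly p A - op_poly q A"
  using op_poly_add[of p "smult (-1) q" A] op_poly_smult[of "-1" q A] by simp

lemma op_poly_mult: "op_poly (p * q) A = op_poly p A o\<^sub>L op_poly q A"
  by (induction p)
    (auto simp: op_poly_pCons op_poly_add op_poly_smult blinfun_compose_simps blinfun_compose_assoc)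

lemma op_poly_intertwine:
  assumes "V o\<^sub>L A = B o\<^sub>L V"
  shows "V o\<^sub>L op_poly p A = op_poly p B o\<^sub>L V"
proof (induction p)
  case (pCons a p)
  have "V o\<^sub>L (A o\<^sub>L op_poly p A) = B o\<^sub>L (V o\<^sub>L op_poly p A)"
    by (metis assms blinfun_compose_assoc)
  then show ?case by (simp add: op_poly_pCons blinfun_compose_simps pCons.IH blinfun_compose_assoc)
qed auto

lemma self_adjoint_op_poly: "self_adjoint A \<Longrightarrow> self_adjoint (op_poly p A)"
proof (induction p)
  case (pCons a p)
  then show ?case
    using op_poly_intertwine[of A A A p] by (auto simp: op_poly_pCons intro!: self_adjoint_compose)
qed auto

section \<open>The real spectrum and norms of polynomials\<close>

definition real_spectrum :: "('h::complex_hilbert_space \<Rightarrow>\<^sub>L 'h) \<Rightarrow> real set" where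
  "real_spectrum A = {t. complex_of_real t \<in> op_spectrum A}"

lemma blinfun_eq_iff: "S = T \<longleftrightarrow> (\<forall>x. blinfun_apply S x = blinfun_apply T x)"
  by (auto intro: blinfun_eqI)

lemma not_in_real_spectrum:
  "t \<notin> real_spectrum A \<longleftrightarrow> invertible_operator (A - t *\<^sub>R id_blinfun)"
  unfolding real_spectrum_def op_spectrum_def invertible_operator_def blinfun_eq_iff
  by (auto simp: scaleC_of_real blinfun.bilinear_simps)

lemma invertible_operator_scaleR:
  assumes "c \<noteq> 0" "invertible_operator T"
  shows "invertible_operator (c *\<^sub>R T)"
proof -
  obtain S where "S \<in> bounded_operators" "S o\<^sub>L T = id_blinfun" "T o\<^sub>L S = id_blinfun"
    using assms by (auto simp: invertible_operator_def)
  then show ?thesis unfolding invertible_operator_def using assms(1)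
    by (intro bexI[of _ "(1 / c) *\<^sub>R S"]) (auto simp: blinfun_compose_simps)
qed

lemma invertible_operator_id [simp]: "invertible_operator id_blinfun"
  unfolding invertible_operator_def by (intro bexI[of _ id_blinfun]) auto

abbreviation complex_poly :: "real poly \<Rightarrow> complex poly" where
  "complex_poly p \<equiv> map_poly complex_of_real p"

lemma complex_poly_add: "complex_poly (p + q) = complex_poly p + complex_poly q"
  by (rule poly_eqI) (simp add: coeff_map_poly)

lemma complex_poly_mult: "complex_poly (p * q) = complex_poly p * complex_poly q"
proof (induction p)
  case (pCons a p)
  have "complex_poly (smult a q) = smult (complex_of_real a) (complex_poly q)"
    by (rule poly_eqI) (simp add: coeff_map_poly)
  then show ?case by (simp add: complex_poly_add pCons.IH map_poly_pCons)
qed auto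

lemma poly_complex_poly_of_real: "poly (complex_poly p) (complex_of_real t) = complex_of_real (poly p t)"
  by (induction p) (simp_all add: map_poly_pCons)

text \<open>The remainder modulo the real minimal polynomial of \<open>z\<close> has degree at most
  one and the non-real root \<open>z\<close>, hence vanishes.\<close>

lemma real_quadratic_dvd:
  fixes q :: "real poly"
  assumes z: "poly (complex_poly q) z = 0" and "Im z \<noteq> 0"
  shows "[:(cmod z)\<^sup>2, -2 * Re z, 1:] dvd q"
proof -
  define d where "d = [:(cmod z)\<^sup>2, -2 * Re z, 1:]"
  define r where "r = q mod d"
  have "d \<noteq> 0" "degree d = 2" by (simp_all add: d_def)
  then have "degree r < 2"
    unfolding r_def using degree_mod_less[of d q] by auto
  then obtain r0 r1 where r: "r = [:r0, r1:]"
    by (metis degree_eq_zeroE less_2_cases pCons_0_0 degree_0 degree_pCons_eq_if pCons_cases nat.inject One_nat_def)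
  have "poly (complex_poly d) z = 0"
    unfolding d_def cmod_power2
    by (auto simp: map_poly_pCons complex_eq_iff power2_eq_square algebra_simps)
  moreover have "q = d * (q div d) + r" by (simp add: r_def)
  ultimately have "poly (complex_poly r) z = 0"
    using z by (metis complex_poly_add complex_poly_mult poly_add poly_mult mult_zero_left add_0)
  then have "of_real r0 + z * of_real r1 = 0" by (simp add: r map_poly_pCons)
  then have "r0 + Re z * r1 = 0" "Im z * r1 = 0" by (simp_all add: complex_eq_iff)
  then have "r = 0" using \<open>Im z \<noteq> 0\<close> by (simp add: r)
  then show ?thesis by (simp add: r_def d_def mod_eq_0_iff_dvd)
qed

text \<open>Factor \<open>q\<close> over the reals: linear factors are invertible off the spectrum, and a quadratic
  factor without real roots gives \<open>(A - a)\<^sup>2 + b\<^sup>2 \<ge> b\<^sup>2 > 0\<close>.\<close>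

lemma op_poly_invertible:
  assumes A: "self_adjoint A" and "q \<noteq> 0" and "\<And>t. t \<in> real_spectrum A \<Longrightarrow> poly q t \<noteq> 0"
  shows "invertible_operator (op_poly q A)"
  using assms(2,3)
proof (induction "degree q" arbitrary: q rule: less_induct)
  case less
  have step: "invertible_operator (op_poly q A)"
    if q: "q = d * k" and d: "degree d > 0" "invertible_operator (op_poly d A)" for d k
  proof -
    have nz: "d \<noteq> 0" "k \<noteq> 0" using q \<open>q \<noteq> 0\<close> by auto
    then have "degree k < degree q" using d by (simp add: q degree_mult_eq)
    moreover have "poly k t \<noteq> 0" if "t \<in> real_spectrum A" for t
      using less.prems(2)[OF that] by (simp add: q)
    ultimately have "invertible_operator (op_poly k A)" using less.hyps nz by blast
    then show ?thesis using d by (simp add: q op_poly_mult invertible_operator_compose)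
  qed
  consider "degree q = 0" | t where "poly q t = 0" | "degree q > 0" "\<And>t. poly q t \<noteq> 0" by auto
  then show ?case
  proof cases
    case 1
    then obtain c where "q = [:c:]" by (rule degree_eq_zeroE)
    then show ?thesis using \<open>q \<noteq> 0\<close> by (simp add: op_poly_pCons invertible_operator_scaleR)
  next
    case 2
    then obtain k where k: "q = [:-t, 1:] * k" by (metis poly_eq_0_iff_dvd dvdE)
    have "t \<notin> real_spectrum A" using 2 less.prems(2) by blast
    moreover have "op_poly [:-t, 1:] A = A - t *\<^sub>R id_blinfun" by (simp add: op_poly_pCons)
    ultimately show ?thesis using step[OF k] by (simp add: not_in_real_spectrum)
  next
    case 3
    have "degree (complex_poly q) > 0" using 3 by (simp add: degree_map_poly)
    then have "\<not> constant (poly (complex_poly q))" by (simp add: constant_degree)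
    then obtain z where z: "poly (complex_poly q) z = 0"
      using fundamental_theorem_of_algebra by blast
    have "Im z \<noteq> 0"
    proof
      assume "Im z = 0"
      then have "z = of_real (Re z)" by (simp add: complex_eq_iff)
      then show False using z 3 by (metis poly_complex_poly_of_real of_real_eq_0_iff)
    qed
    define d where "d = [:(cmod z)\<^sup>2, -2 * Re z, 1:]"
    obtain k where k: "q = d * k"
      using real_quadratic_dvd[OF z \<open>Im z \<noteq> 0\<close>] by (auto simp: d_def dvd_def)
    let ?D = "A - Re z *\<^sub>R id_blinfun"
    have "ip (op_poly d A x) x = ip (?D (?D x)) x + (Im z)\<^sup>2 * (norm x)\<^sup>2" for x
      unfolding d_def cmod_power2
      by (simp add: op_poly_pCons blinfun.bilinear_simps ip_simps ip_self
          power2_eq_square algebra_simps)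
    moreover have "self_adjoint ?D" using A by simp
    then have "ip (?D (?D x)) x = (norm (?D x))\<^sup>2" for x
      by (metis self_adjoint_ip ip_self)
    ultimately have "(Im z)\<^sup>2 * (norm x)\<^sup>2 \<le> ip (op_poly d A x) x" for x by simp
    then have "invertible_operator (op_poly d A)"
      using \<open>Im z \<noteq> 0\<close> by (intro coercive_invertible self_adjoint_op_poly A) auto
    then show ?thesis using step[OF k] by (simp add: d_def)
  qed
qed

text \<open>Converse of \<open>coercive_invertible\<close> for positive operators: a left inverse
  bounds \<open>norm x\<close> by a multiple of \<open>norm (W x)\<close>, and
  \<open>positive_norm_le\<close> bounds the latter by the form.\<close>

lemma positive_invertible_coercive:
  assumes W: "self_adjoint W" "\<And>x. 0 \<le> ip (blinfun_apply W x) x" "invertible_operator W"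
  obtains c where "c > 0" "\<And>x. c * (norm x)\<^sup>2 \<le> ip (blinfun_apply W x) x"
proof -
  obtain S where S: "S o\<^sub>L W = id_blinfun" using W(3) by (auto simp: invertible_operator_def)
  \<comment> \<open>Adding 1 keeps both constants positive even if an operator norm is 0.\<close>
  define k where "k = norm W + 1"
  define s where "s = norm S + 1"
  have pos: "k > 0" "s > 0" by (auto simp: k_def s_def intro: add_nonneg_pos)
  have "ip (W x) x \<le> k * (norm x)\<^sup>2" for x
  proof -
    have "ip (W x) x \<le> norm (W x) * norm x" using ip_Cauchy_Schwarz[of "W x" x] by simp
    also have "\<dots> \<le> norm W * norm x * norm x" by (intro mult_right_mono norm_blinfun) simp
    also have "\<dots> \<le> k * (norm x)\<^sup>2" by (simp add: k_def power2_eq_square algebra_simps)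
    finally show ?thesis .
  qed
  from positive_norm_le[OF W(1,2) this] have up: "(norm (W x))\<^sup>2 \<le> k * ip (W x) x" for x .
  have "(norm x)\<^sup>2 \<le> s\<^sup>2 * (norm (W x))\<^sup>2" for x
  proof -
    have "norm x = norm (S (W x))" by (metis S blinfun_apply_blinfun_compose id_blinfun.rep_eq)
    also have "\<dots> \<le> norm S * norm (W x)" by (rule norm_blinfun)
    also have "\<dots> \<le> s * norm (W x)" by (simp add: s_def algebra_simps)
    finally show ?thesis by (metis power_mono norm_ge_zero power_mult_distrib)
  qed
  then have "(norm x)\<^sup>2 \<le> s\<^sup>2 * (k * ip (W x) x)" for x
    using mult_left_mono[OF up[of x], of "s\<^sup>2"] by (meson order_trans zero_le_power2)
  then show thesis using that[of "1 / (s\<^sup>2 * k)"] pos by (simp add: field_simps)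
qed

text \<open>For \<open>N = \<parallel>p(A)\<parallel>\<close>, the operator \<open>N\<^sup>2 - p(A)\<^sup>2 \<ge> 0\<close> is not bounded below, hence not
  invertible, so \<open>N\<^sup>2 - p\<^sup>2\<close> has a zero on the spectrum.\<close>

lemma real_spectrum_attains_norm:
  fixes A :: "'h::complex_hilbert_space \<Rightarrow>\<^sub>L 'h"
  assumes A: "self_adjoint A" and nonzero: "[:(norm (op_poly p A))\<^sup>2:] - p * p \<noteq> 0"
    and nontrivial: "(x::'h) \<noteq> 0"
  shows "\<exists>t \<in> real_spectrum A. \<bar>poly p t\<bar> = norm (op_poly p A)"
proof (rule ccontr)
  define N where "N = norm (op_poly p A)"
  define q where "q = [:N\<^sup>2:] - p * p"
  assume "\<not> ?thesis"
  then have nz: "poly q t \<noteq> 0" if "t \<in> real_spectrum A" for t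
    using that power2_eq_iff_nonneg[of "\<bar>poly p t\<bar>" N] by (auto simp: q_def N_def power2_eq_square)
  have qA: "op_poly q A = N\<^sup>2 *\<^sub>R id_blinfun - (op_poly p A o\<^sub>L op_poly p A)"
    by (simp add: q_def op_poly_diff op_poly_mult op_poly_pCons)
  have qip: "ip (op_poly q A x) x = N\<^sup>2 * (norm x)\<^sup>2 - (norm (op_poly p A x))\<^sup>2" for x
    using self_adjoint_ip[OF self_adjoint_op_poly[OF A]]
    by (simp add: qA blinfun.bilinear_simps ip_simps ip_self)
  have q0: "0 \<le> ip (op_poly q A x) x" for x
    using power_mono[OF norm_blinfun[of "op_poly p A" x], of 2]
    by (simp add: qip N_def power_mult_distrib)
  have "invertible_operator (op_poly q A)"
    using nonzero by (intro op_poly_invertible[OF A _ nz]) (auto simp: q_def N_def)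
  then obtain d where d: "d > 0" "\<And>x. d * (norm x)\<^sup>2 \<le> ip (op_poly q A x) x"
    using positive_invertible_coercive[OF self_adjoint_op_poly[OF A] q0] by blast
  have le: "(norm (op_poly p A x))\<^sup>2 \<le> (N\<^sup>2 - d) * (norm x)\<^sup>2" for x
    using d(2)[of x] by (simp add: qip left_diff_distrib)
  then have "0 \<le> (N\<^sup>2 - d) * (norm x)\<^sup>2" by (meson order_trans zero_le_power2)
  then have Nd: "d \<le> N\<^sup>2" using nontrivial by (simp add: zero_le_mult_iff)
  have "norm (op_poly p A x) \<le> sqrt (N\<^sup>2 - d) * norm x" for x
    using le[of x] Nd by (intro power2_le_imp_le[of "norm (op_poly p A x)"]) (auto simp: power_mult_distrib)
  then have "N \<le> sqrt (N\<^sup>2 - d)" unfolding N_def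
    using Nd by (intro norm_blinfun_bound) (auto simp: N_def)
  then have "N\<^sup>2 \<le> (sqrt (N\<^sup>2 - d))\<^sup>2" by (intro power_mono) (auto simp: N_def)
  then show False using d(1) Nd by simp
qed

text \<open>This estimate lets polynomials of \<open>A\<close> pass to uniform limits on the
  spectrum. On the zero space the spectrum is empty, so \<open>0 \<le> c\<close> is assumed
  separately.\<close>

lemma norm_op_poly_le:
  fixes A :: "'h::complex_hilbert_space \<Rightarrow>\<^sub>L 'h"
  assumes A: "self_adjoint A" and "0 \<le> c" and bound: "\<And>t. t \<in> real_spectrum A \<Longrightarrow> \<bar>poly p t\<bar> \<le> c"
  shows "norm (op_poly p A) \<le> c"
proof (cases "\<exists>x::'h. x \<noteq> 0")
  case True
  then obtain x :: 'h where x: "x \<noteq> 0" ..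
  show ?thesis
  proof (cases "[:(norm (op_poly p A))\<^sup>2:] - p * p = 0")
    case False
    then show ?thesis using real_spectrum_attains_norm[OF A False x] bound by fastforce
  next
    case const: True
    \<comment> \<open>Here \<open>p * p\<close> is constant, so any point of the spectrum will do.
      One comes from the polynomial \<open>[:0, 1:]\<close>, for which the difference has leading
      coefficient -1 and cannot vanish.\<close>
    have "coeff ([:r:] - [:0, 1:] * [:0, 1:]) 2 \<noteq> 0" for r :: real by (simp add: numeral_2_eq_2)
    then have "[:(norm (op_poly [:0, 1:] A))\<^sup>2:] - [:0, 1:] * [:0, 1:] \<noteq> 0"
      by (metis coeff_0)
    then obtain t where "t \<in> real_spectrum A"
      using real_spectrum_attains_norm[OF A _ x] by blast
    moreover have "poly ([:(norm (op_poly p A))\<^sup>2:] - p * p) t = 0" using const by simp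
    then have "\<bar>poly p t\<bar> = norm (op_poly p A)"
      using power2_eq_iff_nonneg[of "\<bar>poly p t\<bar>" "norm (op_poly p A)"]
      by (simp add: power2_eq_square)
    ultimately show ?thesis using bound by fastforce
  qed
next
  case False
  then have "op_poly p A = 0" by (intro blinfun_eqI) metis
  then show ?thesis using \<open>0 \<le> c\<close> by simp
qed

section \<open>Continuous functional calculus\<close>

text \<open>Bounds on the quadratic form rather than on the spectrum: the interval contains the
  spectrum by \<open>real_spectrum_between\<close>, and such bounds survive convex combinations and
  direct sums.\<close>

definition operators_between :: "real \<Rightarrow> real \<Rightarrow> ('h::complex_hilbert_space \<Rightarrow>\<^sub>L 'h) set" where
  "operators_between m M =
     {A. self_adjoint A \<and> (\<forall>x. m * (norm x)\<^sup>2 \<le> ip (A x) x \<and> ip (A x) x \<le> M * (norm x)\<^sup>2)}"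

lemma operators_betweenI:
  "self_adjoint A \<Longrightarrow> (\<And>x. m * (norm x)\<^sup>2 \<le> ip (blinfun_apply A x) x) \<Longrightarrow>
   (\<And>x. ip (blinfun_apply A x) x \<le> M * (norm x)\<^sup>2) \<Longrightarrow> A \<in> operators_between m M"
  by (simp add: operators_between_def)

lemma operators_betweenD:
  assumes "A \<in> operators_between m M"
  shows "self_adjoint A" "m * (norm x)\<^sup>2 \<le> ip (blinfun_apply A x) x"
    "ip (blinfun_apply A x) x \<le> M * (norm x)\<^sup>2"
  using assms by (simp_all add: operators_between_def)

lemma operators_between_mono:
  assumes "A \<in> operators_between m M" "m' \<le> m" "M \<le> M'"
  shows "A \<in> operators_between m' M'"
proof (rule operators_betweenI)
  note A = operators_betweenD[OF assms(1)]
  show "m' * (norm x)\<^sup>2 \<le> ip (A x) x" for x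
    using mult_right_mono[OF assms(2), of "(norm x)\<^sup>2"] A(2)[of x] by simp
  show "ip (A x) x \<le> M' * (norm x)\<^sup>2" for x
    using mult_right_mono[OF assms(3), of "(norm x)\<^sup>2"] A(3)[of x] by simp
qed (rule operators_betweenD[OF assms(1)])

lemma ip_le_norm: "\<bar>ip (blinfun_apply A x) x\<bar> \<le> norm A * (norm x)\<^sup>2"
proof -
  have "\<bar>ip (A x) x\<bar> \<le> norm (A x) * norm x" by (rule ip_Cauchy_Schwarz)
  also have "\<dots> \<le> norm A * norm x * norm x" by (intro mult_right_mono norm_blinfun) simp
  finally show ?thesis by (simp add: power2_eq_square mult.assoc)
qed

lemma self_adjoint_between: "self_adjoint A \<Longrightarrow> A \<in> operators_between (- norm A) (norm A)"
  using ip_le_norm[of A] by (intro operators_betweenI) (auto simp: abs_le_iff minus_le_iff)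

lemma scaleR_id_between: "r *\<^sub>R id_blinfun \<in> operators_between r r"
  by (auto simp: operators_between_def blinfun.bilinear_simps ip_simps ip_self)

lemma real_spectrum_between:
  assumes A: "A \<in> operators_between m M"
  shows "real_spectrum A \<subseteq> {m..M}"
proof
  fix t assume t: "t \<in> real_spectrum A"
  note A = operators_betweenD[OF A]
  show "t \<in> {m..M}"
  proof (rule ccontr)
    assume "t \<notin> {m..M}"
    then consider "t < m" | "M < t" by fastforce
    then have "invertible_operator (A - t *\<^sub>R id_blinfun)"
    proof cases
      case 1
      then show ?thesis using A
        by (intro coercive_invertible[of _ "m - t"])
          (auto simp: blinfun.bilinear_simps ip_simps ip_self left_diff_distrib)
    next
      case 2
      then have "invertible_operator (t *\<^sub>R id_blinfun - A)" using A
        by (intro coercive_invertible[of _ "t - M"])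
          (auto simp: blinfun.bilinear_simps ip_simps ip_self left_diff_distrib)
      then show ?thesis using invertible_operator_scaleR[of "-1" "t *\<^sub>R id_blinfun - A"] by simp
    qed
    then show False using t not_in_real_spectrum by blast
  qed
qed

lemma polynomial_approximation:
  fixes f :: "real \<Rightarrow> real"
  assumes "continuous_on {m..M} f"
  obtains p where "uniform_limit {m..M} (\<lambda>n. poly (p n)) f sequentially"
proof -
  have "\<exists>p. \<forall>x\<in>{m..M}. \<bar>f x - poly p x\<bar> < 1 / real (Suc n)" for n
  proof -
    obtain g where g: "real_polynomial_function g" "\<And>x. x \<in> {m..M} \<Longrightarrow> \<bar>f x - g x\<bar> < 1 / real (Suc n)"
      using Stone_Weierstrass_real_polynomial_function[of "{m..M}" f "1 / real (Suc n)"] assms by auto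
    then obtain a k where "g = (\<lambda>x. \<Sum>i\<le>k. a i * x ^ i)"
      by (auto simp: real_polynomial_function_iff_sum)
    then have "g = poly (\<Sum>i\<le>k. monom (a i) i)" by (auto simp: poly_sum poly_monom)
    then show ?thesis using g by blast
  qed
  then obtain p where p: "\<And>n x. x \<in> {m..M} \<Longrightarrow> \<bar>f x - poly (p n) x\<bar> < 1 / real (Suc n)" by metis
  have "uniform_limit {m..M} (\<lambda>n. poly (p n)) f sequentially"
  proof (rule uniform_limitI)
    fix e :: real assume "e > 0"
    then have "\<forall>\<^sub>F n in sequentially. 1 / real (Suc n) < e" by real_asymp
    then show "\<forall>\<^sub>F n in sequentially. \<forall>x\<in>{m..M}. dist (poly (p n) x) (f x) < e"
    proof eventually_elim
      case (elim n)
      show ?case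
        using p[of _ n] elim less_trans by (fastforce simp: dist_real_def abs_minus_commute)
    qed
  qed
  then show thesis by (rule that)
qed

text \<open>Two approximating sequences are compared at once: with \<open>p = q\<close> this is the
  Cauchy property, with different ones independence of the limit from the approximation.\<close>

lemma op_poly_diff_tendsto_0:
  assumes A: "self_adjoint A"
    and p: "uniform_limit (real_spectrum A) (\<lambda>n. poly (p n)) f sequentially"
    and q: "uniform_limit (real_spectrum A) (\<lambda>n. poly (q n)) f sequentially"
    and e: "e > 0"
  obtains N where "\<And>i j. i \<ge> N \<Longrightarrow> j \<ge> N \<Longrightarrow> norm (op_poly (p i) A - op_poly (q j) A) \<le> e"
proof -
  obtain N1 where N1: "\<And>i t. i \<ge> N1 \<Longrightarrow> t \<in> real_spectrum A \<Longrightarrow> \<bar>poly (p i) t - f t\<bar> < e / 2"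
    using uniform_limitD[OF p, of "e / 2"] e by (auto simp: eventually_sequentially dist_real_def)
  obtain N2 where N2: "\<And>i t. i \<ge> N2 \<Longrightarrow> t \<in> real_spectrum A \<Longrightarrow> \<bar>poly (q i) t - f t\<bar> < e / 2"
    using uniform_limitD[OF q, of "e / 2"] e by (auto simp: eventually_sequentially dist_real_def)
  show thesis
  proof (rule that)
    fix i j assume "i \<ge> max N1 N2" "j \<ge> max N1 N2"
    then have "\<bar>poly (p i - q j) t\<bar> \<le> e" if "t \<in> real_spectrum A" for t
      using N1[of i t] N2[of j t] that unfolding poly_diff max.bounded_iff by argo
    then show "norm (op_poly (p i) A - op_poly (q j) A) \<le> e"
      unfolding op_poly_diff[symmetric] using e by (intro norm_op_poly_le[OF A]) auto
  qed
qed

text \<open>The description in \<open>fun_calc_def\<close> quantifies over all approximating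
  sequences. One such sequence determines the limit, and comparison with the others shows that they
  share it.\<close>

lemma fun_calc_LIMSEQ:
  assumes A: "A \<in> operators_between m M" and f: "continuous_on {m..M} f"
    and p: "uniform_limit {m..M} (\<lambda>n. poly (p n)) f sequentially"
  shows "(\<lambda>n. op_poly (p n) A) \<longlonglongrightarrow> fun_calc f A"
proof -
  note sa = operators_betweenD(1)[OF A]
  note lim = uniform_limit_on_subset[OF p real_spectrum_between[OF A]]
  have "Cauchy (\<lambda>n. op_poly (p n) A)"
  proof (rule metric_CauchyI)
    fix e :: real assume e: "e > 0"
    obtain N where "\<And>i j. i \<ge> N \<Longrightarrow> j \<ge> N \<Longrightarrow> norm (op_poly (p i) A - op_poly (p j) A) \<le> e / 2"
      using op_poly_diff_tendsto_0[OF sa lim lim, of "e / 2"] e by auto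
    then show "\<exists>N. \<forall>i\<ge>N. \<forall>j\<ge>N. dist (op_poly (p i) A) (op_poly (p j) A) < e"
      using e by (intro exI[of _ N] allI impI) (fastforce simp: dist_norm)
  qed
  then obtain T where T: "(\<lambda>n. op_poly (p n) A) \<longlonglongrightarrow> T"
    using Cauchy_convergent convergent_def by blast
  have all: "(\<lambda>n. op_poly (q n) A) \<longlonglongrightarrow> T"
    if q: "uniform_limit (real_spectrum A) (\<lambda>n. poly (q n)) f sequentially" for q
  proof -
    have "(\<lambda>n. op_poly (q n) A - op_poly (p n) A) \<longlonglongrightarrow> 0"
    proof (rule LIMSEQ_I)
      fix e :: real assume e: "e > 0"
      obtain N where "\<And>i j. i \<ge> N \<Longrightarrow> j \<ge> N \<Longrightarrow> norm (op_poly (q i) A - op_poly (p j) A) \<le> e / 2"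
        using op_poly_diff_tendsto_0[OF sa q lim, of "e / 2"] e by auto
      then show "\<exists>N. \<forall>n\<ge>N. norm (op_poly (q n) A - op_poly (p n) A - 0) < e"
        using e by (intro exI[of _ N] allI impI) fastforce
    qed
    from tendsto_add[OF this T] show ?thesis by simp
  qed
  have "fun_calc f A = T"
    unfolding fun_calc_def real_spectrum_def[symmetric]
  proof (rule the_equality)
    show "\<forall>q. uniform_limit (real_spectrum A) (\<lambda>n. poly (q n)) f sequentially
        \<longrightarrow> (\<lambda>n. op_poly (q n) A) \<longlonglongrightarrow> T"
      using all by blast
    show "T' = T" if "\<forall>q. uniform_limit (real_spectrum A) (\<lambda>n. poly (q n)) f sequentially
        \<longrightarrow> (\<lambda>n. op_poly (q n) A) \<longlonglongrightarrow> T'" for T'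
      using that lim T LIMSEQ_unique by blast
  qed
  then show ?thesis using T by simp
qed

lemma fun_calc_cong:
  assumes A: "A \<in> operators_between m M" and eq: "\<And>t. t \<in> {m..M} \<Longrightarrow> f t = g t"
    and g: "continuous_on {m..M} g"
  shows "fun_calc f A = fun_calc g A"
proof -
  obtain p where p: "uniform_limit {m..M} (\<lambda>n. poly (p n)) g sequentially"
    using polynomial_approximation[OF g] .
  have "continuous_on {m..M} f" using g eq continuous_on_cong[of "{m..M}" "{m..M}" f g] by simp
  moreover have "uniform_limit {m..M} (\<lambda>n. poly (p n)) f sequentially"
    using p uniform_limit_cong'[of "{m..M}" "\<lambda>n. poly (p n)" "\<lambda>n. poly (p n)" f g] eq by simp
  ultimately show ?thesis
    using fun_calc_LIMSEQ[OF A] g p LIMSEQ_unique by blast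
qed

lemma fun_calc_poly:
  assumes A: "A \<in> operators_between m M"
  shows "fun_calc (poly p) A = op_poly p A"
  using fun_calc_LIMSEQ[OF A, of "poly p" "\<lambda>_. p"]
  by (simp add: continuous_on_poly uniform_limit_const LIMSEQ_const_iff)

lemma fun_calc_const: "A \<in> operators_between m M \<Longrightarrow> fun_calc (\<lambda>_. c) A = c *\<^sub>R id_blinfun"
proof -
  have "poly [:c:] = (\<lambda>_. c)" by auto
  then show "A \<in> operators_between m M \<Longrightarrow> fun_calc (\<lambda>_. c) A = c *\<^sub>R id_blinfun"
    using fun_calc_poly[of A m M "[:c:]"] by (simp add: op_poly_pCons)
qed

lemma fun_calc_ident: "A \<in> operators_between m M \<Longrightarrow> fun_calc (\<lambda>t. t) A = A"
proof -
  have "poly [:0, 1:] = (\<lambda>t::real. t)" by auto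
  then show "A \<in> operators_between m M \<Longrightarrow> fun_calc (\<lambda>t. t) A = A"
    using fun_calc_poly[of A m M "[:0, 1:]"] by (simp add: op_poly_pCons)
qed

lemma fun_calc_add:
  assumes A: "A \<in> operators_between m M" and f: "continuous_on {m..M} f" and g: "continuous_on {m..M} g"
  shows "fun_calc (\<lambda>t. f t + g t) A = fun_calc f A + fun_calc g A"
proof -
  obtain p where p: "uniform_limit {m..M} (\<lambda>n. poly (p n)) f sequentially"
    using polynomial_approximation[OF f] .
  obtain q where q: "uniform_limit {m..M} (\<lambda>n. poly (q n)) g sequentially"
    using polynomial_approximation[OF g] .
  have "uniform_limit {m..M} (\<lambda>n. poly (p n + q n)) (\<lambda>t. f t + g t) sequentially"
    using uniform_limit_add[OF p q] by (simp add: poly_add[abs_def])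
  from fun_calc_LIMSEQ[OF A continuous_on_add[OF f g] this]
  have "(\<lambda>n. op_poly (p n) A + op_poly (q n) A) \<longlonglongrightarrow> fun_calc (\<lambda>t. f t + g t) A"
    by (simp add: op_poly_add)
  then show ?thesis
    using tendsto_add[OF fun_calc_LIMSEQ[OF A f p] fun_calc_LIMSEQ[OF A g q]] LIMSEQ_unique by blast
qed

lemma fun_calc_mult:
  assumes A: "A \<in> operators_between m M" and f: "continuous_on {m..M} f" and g: "continuous_on {m..M} g"
  shows "fun_calc (\<lambda>t. f t * g t) A = fun_calc f A o\<^sub>L fun_calc g A"
proof -
  obtain p where p: "uniform_limit {m..M} (\<lambda>n. poly (p n)) f sequentially"
    using polynomial_approximation[OF f] .
  obtain q where q: "uniform_limit {m..M} (\<lambda>n. poly (q n)) g sequentially"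
    using polynomial_approximation[OF g] .
  have bounded: "bounded (f ` {m..M})" "bounded (g ` {m..M})"
    using f g compact_continuous_image compact_imp_bounded by blast+
  have "uniform_limit {m..M} (\<lambda>n. poly (p n * q n)) (\<lambda>t. f t * g t) sequentially"
    using uniform_lim_mult[OF p q bounded] by (simp add: poly_mult[abs_def])
  from fun_calc_LIMSEQ[OF A continuous_on_mult[OF f g] this]
  have "(\<lambda>n. op_poly (p n) A o\<^sub>L op_poly (q n) A) \<longlonglongrightarrow> fun_calc (\<lambda>t. f t * g t) A"
    by (simp add: op_poly_mult)
  then show ?thesis
    using bounded_bilinear.tendsto[OF bounded_bilinear_blinfun_compose
        fun_calc_LIMSEQ[OF A f p] fun_calc_LIMSEQ[OF A g q]] LIMSEQ_unique by blast
qed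

lemma fun_calc_scaleR:
  assumes A: "A \<in> operators_between m M" and f: "continuous_on {m..M} f"
  shows "fun_calc (\<lambda>t. c * f t) A = c *\<^sub>R fun_calc f A"
  using fun_calc_mult[OF A continuous_on_const f, of c]
  by (simp add: fun_calc_const[OF A] blinfun_compose_scaleR_left)

lemma fun_calc_diff:
  assumes A: "A \<in> operators_between m M" and f: "continuous_on {m..M} f" and g: "continuous_on {m..M} g"
  shows "fun_calc (\<lambda>t. f t - g t) A = fun_calc f A - fun_calc g A"
  using fun_calc_add[OF A f, of "\<lambda>t. (-1) * g t"] fun_calc_scaleR[OF A g, of "-1"] g
  by (simp add: continuous_on_minus)

lemma self_adjoint_fun_calc:
  assumes A: "A \<in> operators_between m M" and f: "continuous_on {m..M} f"
  shows "self_adjoint (fun_calc f A)"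
proof -
  obtain p where p: "uniform_limit {m..M} (\<lambda>n. poly (p n)) f sequentially"
    using polynomial_approximation[OF f] .
  show ?thesis
    by (rule self_adjoint_limit[OF _ fun_calc_LIMSEQ[OF A f p]])
      (rule self_adjoint_op_poly[OF operators_betweenD(1)[OF A]])
qed

text \<open>The main way to compute f(A): \<open>V\<close> will be an isometry onto a block, a
  rank-one operator on an eigenvector, or the map linking two congruent means.\<close>

lemma fun_calc_intertwine:
  assumes A: "A \<in> operators_between m M" and B: "B \<in> operators_between m M"
    and f: "continuous_on {m..M} f" and V: "V o\<^sub>L A = B o\<^sub>L V"
  shows "V o\<^sub>L fun_calc f A = fun_calc f B o\<^sub>L V"
proof -
  obtain p where p: "uniform_limit {m..M} (\<lambda>n. poly (p n)) f sequentially"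
    using polynomial_approximation[OF f] .
  have "(\<lambda>n. V o\<^sub>L op_poly (p n) A) \<longlonglongrightarrow> (V o\<^sub>L fun_calc f A)"
    by (intro bounded_bilinear.tendsto[OF bounded_bilinear_blinfun_compose] tendsto_const
        fun_calc_LIMSEQ[OF A f p])
  moreover have "(\<lambda>n. op_poly (p n) B o\<^sub>L V) \<longlonglongrightarrow> (fun_calc f B o\<^sub>L V)"
    by (intro bounded_bilinear.tendsto[OF bounded_bilinear_blinfun_compose] tendsto_const
        fun_calc_LIMSEQ[OF B f p])
  ultimately show ?thesis
    using LIMSEQ_unique by (simp add: op_poly_intertwine[OF V]) blast
qed

text \<open>Positivity comes from writing \<open>f\<close> as the square of its square root, whose
  value at \<open>A\<close> is self-adjoint.\<close>

lemma fun_calc_nonneg: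
  assumes A: "A \<in> operators_between m M" and f: "continuous_on {m..M} f"
    and "\<And>t. t \<in> {m..M} \<Longrightarrow> 0 \<le> f t"
  shows "0 \<le> ip (blinfun_apply (fun_calc f A) x) x"
proof -
  define r where "r = (\<lambda>t. sqrt (f t))"
  have r: "continuous_on {m..M} r" unfolding r_def by (intro continuous_intros f)
  have "fun_calc f A = fun_calc (\<lambda>t. r t * r t) A"
    by (rule fun_calc_cong[OF A _ continuous_on_mult[OF r r]]) (use assms in \<open>simp add: r_def\<close>)
  also have "\<dots> = fun_calc r A o\<^sub>L fun_calc r A" by (rule fun_calc_mult[OF A r r])
  finally show ?thesis
    by (simp add: self_adjoint_ip[OF self_adjoint_fun_calc[OF A r]] ip_self)
qed

lemma fun_calc_le:
  assumes A: "A \<in> operators_between m M" and f: "continuous_on {m..M} f" and g: "continuous_on {m..M} g"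
    and "\<And>t. t \<in> {m..M} \<Longrightarrow> f t \<le> g t"
  shows "ip (blinfun_apply (fun_calc f A) x) x \<le> ip (blinfun_apply (fun_calc g A) x) x"
  using fun_calc_nonneg[OF A continuous_on_diff[OF g f], of x] assms
  by (simp add: fun_calc_diff[OF A g f] blinfun.bilinear_simps ip_simps)

lemma fun_calc_between:
  assumes A: "A \<in> operators_between m M" and f: "continuous_on {m..M} f"
    and "\<And>t. t \<in> {m..M} \<Longrightarrow> c \<le> f t \<and> f t \<le> d"
  shows "fun_calc f A \<in> operators_between c d"
proof (rule operators_betweenI)
  show "self_adjoint (fun_calc f A)" by (rule self_adjoint_fun_calc[OF A f])
  show "c * (norm x)\<^sup>2 \<le> ip (fun_calc f A x) x" for x
    using fun_calc_le[OF A continuous_on_const f, of c x] assms(3)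
    by (simp add: fun_calc_const[OF A] blinfun.bilinear_simps ip_simps ip_self)
  show "ip (fun_calc f A x) x \<le> d * (norm x)\<^sup>2" for x
    using fun_calc_le[OF A f continuous_on_const, of d x] assms(3)
    by (simp add: fun_calc_const[OF A] blinfun.bilinear_simps ip_simps ip_self)
qed

lemma norm_self_adjoint_le:
  assumes A: "A \<in> operators_between (- c) c" and "0 \<le> c"
  shows "norm A \<le> c"
proof -
  have "norm (op_poly [:0, 1:] A) \<le> c"
    using real_spectrum_between[OF A]
    by (intro norm_op_poly_le operators_betweenD(1)[OF A] \<open>0 \<le> c\<close>) (auto simp: abs_le_iff)
  then show ?thesis by (simp add: op_poly_pCons)
qed

text \<open>Polynomials \<open>g\<close> are settled by induction from the algebraic rules; uniform
  approximation of \<open>g\<close> on an interval containing the range of \<open>f\<close> does the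
  rest.\<close>

lemma fun_calc_compose:
  assumes A: "A \<in> operators_between m M" and f: "continuous_on {m..M} f"
    and range: "f ` {m..M} \<subseteq> {c..d}" and g: "continuous_on {c..d} g"
  shows "fun_calc g (fun_calc f A) = fun_calc (\<lambda>t. g (f t)) A"
proof -
  have fA: "fun_calc f A \<in> operators_between c d"
    by (rule fun_calc_between[OF A f]) (use range in \<open>auto simp: image_subset_iff\<close>)
  have gf: "continuous_on {m..M} (\<lambda>t. g (f t))"
    using continuous_on_compose2[OF g f range] .
  have poly: "op_poly p (fun_calc f A) = fun_calc (\<lambda>t. poly p (f t)) A" for p
  proof (induction p)
    case (pCons a p)
    have "continuous_on {m..M} (\<lambda>t. poly p (f t))" by (intro continuous_intros f)
    then show ?case using f
      by (simp add: op_poly_pCons pCons.IH fun_calc_add[OF A] fun_calc_mult[OF A]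
          fun_calc_const[OF A] continuous_intros)
  qed (simp add: fun_calc_const[OF A])
  obtain p where p: "uniform_limit {c..d} (\<lambda>n. poly (p n)) g sequentially"
    using polynomial_approximation[OF g] .
  have "(\<lambda>n. op_poly (p n) (fun_calc f A)) \<longlonglongrightarrow> fun_calc (\<lambda>t. g (f t)) A"
  proof (rule LIMSEQ_I)
    fix e :: real assume e: "e > 0"
    obtain N where N: "\<And>n s. n \<ge> N \<Longrightarrow> s \<in> {c..d} \<Longrightarrow> \<bar>poly (p n) s - g s\<bar> < e / 2"
      using uniform_limitD[OF p, of "e / 2"] e
      unfolding eventually_sequentially dist_real_def by (meson half_gt_zero)
    have "norm (op_poly (p n) (fun_calc f A) - fun_calc (\<lambda>t. g (f t)) A) < e" if "n \<ge> N" for n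
    proof -
      have pf: "continuous_on {m..M} (\<lambda>t. poly (p n) (f t))" by (intro continuous_intros f)
      have "- (e / 2) \<le> poly (p n) (f t) - g (f t) \<and> poly (p n) (f t) - g (f t) \<le> e / 2"
        if "t \<in> {m..M}" for t
        using N[OF \<open>n \<ge> N\<close>, of "f t"] that range unfolding image_subset_iff abs_less_iff by force
      then have "norm (fun_calc (\<lambda>t. poly (p n) (f t) - g (f t)) A) \<le> e / 2"
        using e by (intro norm_self_adjoint_le fun_calc_between[OF A] continuous_on_diff[OF pf gf]) auto
      then show ?thesis using e by (simp add: poly fun_calc_diff[OF A pf gf])
    qed
    then show "\<exists>N. \<forall>n\<ge>N. norm (op_poly (p n) (fun_calc f A) - fun_calc (\<lambda>t. g (f t)) A) < e" by blast
  qed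
  then show ?thesis using fun_calc_LIMSEQ[OF fA g p] LIMSEQ_unique by blast
qed

lemma fun_calc_scaleR_id: "fun_calc f (r *\<^sub>R id_blinfun) = f r *\<^sub>R id_blinfun"
proof -
  have "fun_calc f (r *\<^sub>R id_blinfun) = fun_calc (\<lambda>_. f r) (r *\<^sub>R id_blinfun)"
    by (rule fun_calc_cong[OF scaleR_id_between]) auto
  then show ?thesis by (simp add: fun_calc_const[OF scaleR_id_between])
qed

text \<open>\<open>u v\<^sup>*\<close> in operator notation; \<open>u u\<^sup>*\<close> intertwines \<open>A\<close> with a scalar when \<open>u\<close> is an eigenvector.\<close>

definition rank_one :: "'h::complex_hilbert_space \<Rightarrow> 'h \<Rightarrow> ('h \<Rightarrow>\<^sub>L 'h)" where
  "rank_one u v = Blinfun (\<lambda>x. cinner x v *\<^sub>C u)"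

lemma cmod_cinner_le: "cmod (cinner x y) \<le> norm x * norm y"
proof (cases "cinner x y = 0")
  case False
  \<comment> \<open>The phase that makes the inner product real and nonnegative, so that
    \<open>ip_Cauchy_Schwarz\<close> applies.\<close>
  define c where "c = cnj (cinner x y) / cmod (cinner x y)"
  have c: "cmod c = 1" using False by (simp add: c_def norm_divide)
  have "cinner (c *\<^sub>C x) y = complex_of_real (cmod (cinner x y))"
    using False by (simp add: cinner_scaleC_left c_def complex_norm_square[symmetric]
        power2_eq_square mult.commute)
  then have "cmod (cinner x y) = ip (c *\<^sub>C x) y" by (simp add: ip_def)
  also have "\<dots> \<le> norm (c *\<^sub>C x) * norm y" using ip_Cauchy_Schwarz[of "c *\<^sub>C x" y] by simp
  finally show ?thesis by (simp add: norm_scaleC c)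
qed simp

lemma cinner_add_right: "cinner z (x + y) = cinner z x + cinner z y"
  by (metis cinner_commute cinner_add_left complex_cnj_add)

lemma cinner_scaleC_right: "cinner x (c *\<^sub>C y) = cnj c * cinner x y"
  by (metis cinner_commute cinner_scaleC_left complex_cnj_mult)

lemma cinner_scaleR_left: "cinner (r *\<^sub>R x) y = complex_of_real r * cinner x y"
  by (metis scaleC_of_real cinner_scaleC_left)

lemma cinner_scaleR_right: "cinner x (r *\<^sub>R y) = complex_of_real r * cinner x y"
  by (metis scaleC_of_real cinner_scaleC_right complex_cnj_complex_of_real)

lemma cinner_diff_left: "cinner (x - y) z = cinner x z - cinner y z"
  using cinner_add_left[of x "(-1) *\<^sub>R y" z] cinner_scaleR_left[of "-1" y z] by simp

lemma cinner_diff_right: "cinner z (x - y) = cinner z x - cinner z y"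
  using cinner_add_right[of z x "(-1) *\<^sub>R y"] cinner_scaleR_right[of z "-1" y] by simp

lemma cinner_zero_left [simp]: "cinner 0 x = 0"
  using cinner_scaleR_left[of 0 0 x] by simp

lemma cinner_zero_right [simp]: "cinner x 0 = 0"
  using cinner_scaleR_right[of x 0 0] by simp

lemmas cinner_simps = cinner_add_left cinner_add_right cinner_diff_left cinner_diff_right
  cinner_scaleR_left cinner_scaleR_right cinner_scaleC_left cinner_scaleC_right

lemma rank_one_apply [simp]: "blinfun_apply (rank_one u v) x = cinner x v *\<^sub>C u"
proof -
  have "bounded_linear (\<lambda>x. cinner x v *\<^sub>C u)"
  proof (rule bounded_linear_intro[of _ "norm v * norm u"])
    show "norm (cinner x v *\<^sub>C u) \<le> norm x * (norm v * norm u)" for x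
      using mult_right_mono[OF cmod_cinner_le[of x v], of "norm u"]
      by (simp add: norm_scaleC mult.assoc)
  qed (simp_all add: cinner_add_left scaleC_add_left cinner_scaleR_left scaleC_of_real
      flip: scaleC_scaleC)
  then show ?thesis by (simp add: rank_one_def bounded_linear_Blinfun_apply)
qed

lemma rank_one_bounded [simp]: "rank_one u v \<in> bounded_operators"
  by (rule bounded_operatorsI) (simp add: cinner_scaleC_left scaleC_scaleC)

lemma ip_rank_one: "ip (blinfun_apply (rank_one u v) x) y = Re (cinner x v * cinner u y)"
  by (simp add: ip_def cinner_scaleC_left)

lemma self_adjoint_rank_one [simp]: "self_adjoint (rank_one u u)"
proof -
  have "ip (rank_one u u x) y = ip (rank_one u u y) x" for x y
    unfolding ip_rank_one
    by (subst cinner_commute[of u y], subst cinner_commute[of u x]) simp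
  then show ?thesis by (simp add: self_adjoint_def ip_commute)
qed

lemma ip_rank_one_self: "ip (blinfun_apply (rank_one u u) x) x = (cmod (cinner x u))\<^sup>2"
  unfolding ip_rank_one by (subst (2) cinner_commute) (simp add: complex_norm_square[symmetric])

lemma fun_calc_eigenvector:
  assumes A: "A \<in> operators_between m M" and f: "continuous_on {m..M} f"
    and u: "blinfun_apply A u = r *\<^sub>R u"
  shows "blinfun_apply (fun_calc f A) u = f r *\<^sub>R u"
proof (cases "u = 0")
  case False
  \<comment> \<open>The eigenvalue lies between the bounds of the form, so the scalar operator
    belongs to the same class as \<open>A\<close> and the two can be intertwined.\<close>
  have "m * (norm u)\<^sup>2 \<le> r * (norm u)\<^sup>2" "r * (norm u)\<^sup>2 \<le> M * (norm u)\<^sup>2"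
    using operators_betweenD(2,3)[OF A, of u] by (simp_all add: u ip_simps ip_self)
  then have "m \<le> r" "r \<le> M" using False by simp_all
  then have r: "r *\<^sub>R id_blinfun \<in> operators_between m M"
    using operators_between_mono[OF scaleR_id_between] by blast
  have "rank_one u u o\<^sub>L (r *\<^sub>R id_blinfun) = A o\<^sub>L rank_one u u"
    using operators_betweenD(1)[OF A]
    by (intro blinfun_eqI)
      (simp add: blinfun.bilinear_simps cinner_scaleR_left u scaleC_scaleR_commute scaleC_of_real
        bounded_operatorsD[OF self_adjoint_bounded] flip: scaleC_scaleC)
  from fun_calc_intertwine[OF r A f this]
  have "(f r *\<^sub>R rank_one u u) u = (fun_calc f A o\<^sub>L rank_one u u) u"
    by (simp add: fun_calc_scaleR_id blinfun_compose_scaleR_right)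
  then have "(norm u)\<^sup>2 *\<^sub>R (f r *\<^sub>R u) = (norm u)\<^sup>2 *\<^sub>R fun_calc f A u"
    by (simp add: blinfun.bilinear_simps cinner_self scaleC_of_real del: of_real_power)
      (simp add: mult.commute)
  then show ?thesis using False by (simp only: scaleR_cancel_left) simp
qed (simp add: blinfun.bilinear_simps)

section \<open>Orthonormal sequences\<close>

definition orthonormal_seq :: "(nat \<Rightarrow> 'h::complex_hilbert_space) \<Rightarrow> bool" where
  "orthonormal_seq a \<longleftrightarrow> (\<forall>i j. cinner (a i) (a j) = (if i = j then 1 else 0))"

definition orthonormal_set :: "'h::complex_hilbert_space set \<Rightarrow> bool" where
  "orthonormal_set E \<longleftrightarrow> (\<forall>u\<in>E. \<forall>v\<in>E. cinner u v = (if u = v then 1 else 0))"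

lemma bounded_linear_cinner_left: "bounded_linear (\<lambda>x. cinner x y)"
  by (rule bounded_linear_intro[of _ "norm y"])
    (auto simp: cinner_simps cmod_cinner_le scaleR_conv_of_real)

lemma bounded_linear_cinner_right: "bounded_linear (\<lambda>y. cinner x y)"
  by (rule bounded_linear_intro[of _ "norm x"])
    (use cmod_cinner_le[of x] in \<open>auto simp: cinner_simps scaleR_conv_of_real mult.commute\<close>)

lemma cinner_sum_left: "cinner (sum f S) y = (\<Sum>i\<in>S. cinner (f i) y)"
  by (rule linear_sum[OF bounded_linear.linear[OF bounded_linear_cinner_left]])

lemma cinner_sum_right: "cinner x (sum f S) = (\<Sum>i\<in>S. cinner x (f i))"
  by (rule linear_sum[OF bounded_linear.linear[OF bounded_linear_cinner_right]])

lemma ex_maximal_orthonormal_set: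
  obtains E :: "'h::complex_hilbert_space set"
  where "orthonormal_set E" "\<forall>x. (\<forall>u\<in>E. cinner x u = 0) \<longrightarrow> x = 0"
proof -
  have "\<Union> C \<in> Collect orthonormal_set" if C: "C \<in> chains (Collect orthonormal_set)" for C :: "'h::complex_hilbert_space set set"
  proof -
    have "cinner u v = (if u = v then 1 else 0)"
      if uv: "X \<in> C" "Y \<in> C" "u \<in> X" "v \<in> Y" for u v X Y
    proof -
      have "X \<subseteq> Y \<or> Y \<subseteq> X" "orthonormal_set X" "orthonormal_set Y"
        using C uv by (auto simp: chains_def chain_subset_def)
      then show ?thesis using uv unfolding orthonormal_set_def by (meson subsetD)
    qed
    then show ?thesis by (auto simp: orthonormal_set_def)
  qed
  then obtain E where E: "orthonormal_set E"
    and max: "\<And>X :: 'h set. orthonormal_set X \<Longrightarrow> E \<subseteq> X \<Longrightarrow> X = E"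
    using Zorn_Lemma[of "Collect orthonormal_set"] by blast
  have "x = 0" if x: "\<forall>u\<in>E. cinner x u = 0" for x
  proof (rule ccontr)
    assume "x \<noteq> 0"
    define v where "v = (1 / norm x) *\<^sub>R x"
    have v: "cinner v v = 1"
      using \<open>x \<noteq> 0\<close> by (simp add: v_def cinner_simps cinner_self power2_eq_square)
    have vu: "cinner v u = 0" "cinner u v = 0" if "u \<in> E" for u
    proof -
      show "cinner v u = 0" using x that by (simp add: v_def cinner_simps)
      then show "cinner u v = 0" by (metis cinner_commute complex_cnj_zero)
    qed
    have "v \<notin> E" using vu v by force
    moreover have "orthonormal_set (insert v E)"
      using E vu v \<open>v \<notin> E\<close> by (auto simp: orthonormal_set_def)
    ultimately show False using max[of "insert v E"] by blast
  qed
  then show thesis using E that by blast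
qed

text \<open>Distinct members of \<open>E\<close> are at distance \<open>sqrt 2\<close>, so points of
  a countable dense set chosen within \<open>1 / 2\<close> of them are distinct.\<close>

lemma orthonormal_set_countable:
  assumes "separable_space (euclidean :: 'h::complex_hilbert_space topology)"
    and E: "orthonormal_set (E :: 'h set)"
  shows "countable E"
proof -
  obtain D :: "'h set" where D: "countable D" "closure D = UNIV"
    using assms(1) by (auto simp: separable_space_def)
  have "\<exists>d\<in>D. dist d u < 1 / 2" for u
    using D(2) closure_approachable[of u D] by (metis UNIV_I zero_less_divide_1_iff zero_less_numeral)
  then obtain s where s: "\<And>u. s u \<in> D" "\<And>u. dist (s u) u < 1 / 2" by metis
  have "inj_on s E"
  proof (rule inj_onI, rule ccontr)
    fix u v assume uv: "u \<in> E" "v \<in> E" "s u = s v" "u \<noteq> v"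
    have "dist u v < 1"
      using s(2)[of u] s(2)[of v] dist_triangle2[of u v "s u"] uv by (simp add: dist_commute)
    then have "(norm (u - v))\<^sup>2 < 1"
      unfolding dist_norm abs_square_less_1 by simp
    moreover have "cinner (u - v) (u - v) = 2"
      using E uv by (auto simp: orthonormal_set_def cinner_simps)
    then have "complex_of_real ((norm (u - v))\<^sup>2) = complex_of_real 2"
      by (simp add: cinner_self del: of_real_power)
    then have "(norm (u - v))\<^sup>2 = 2" unfolding of_real_eq_iff .
    ultimately show False by simp
  qed
  moreover have "countable (s ` E)" using s(1) by (intro countable_subset[OF _ D(1)]) auto
  ultimately show ?thesis by (metis countable_image_inj_on)
qed

text \<open>For finite \<open>E\<close> the difference of \<open>x\<close> and its Fourier sum is
  orthogonal to \<open>E\<close>, hence zero, so \<open>E\<close> would span the space.\<close>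

lemma orthonormal_set_infinite:
  fixes E :: "'h::complex_hilbert_space set"
  assumes infinite_dim: "\<not> (\<exists>S :: 'h::complex_hilbert_space set. finite S \<and> module.span scaleC S = UNIV)"
    and E: "orthonormal_set E" and total: "\<forall>x. (\<forall>u\<in>E. cinner x u = 0) \<longrightarrow> x = 0"
  shows "infinite E"
proof
  assume fin: "finite E"
  interpret vector_space "scaleC :: complex \<Rightarrow> 'h \<Rightarrow> 'h" by (rule vector_space_scaleC)
  have "x \<in> span E" for x
  proof -
    let ?y = "\<Sum>u\<in>E. cinner x u *\<^sub>C u"
    have "x - ?y = 0"
    proof (rule total[rule_format])
      fix v assume v: "v \<in> E"
      have "(\<Sum>u\<in>E. cinner x u * cinner u v) = (\<Sum>u\<in>E. if u = v then cinner x u else 0)"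
        by (rule sum.cong) (use E v in \<open>auto simp: orthonormal_set_def\<close>)
      then show "cinner (x - ?y) v = 0"
        using fin v by (simp add: cinner_diff_left cinner_sum_left cinner_scaleC_left)
    qed
    moreover have "?y \<in> span E" by (intro span_sum span_scale span_base)
    ultimately show ?thesis by simp
  qed
  then show False using infinite_dim fin by auto
qed

lemma ex_orthonormal_basis:
  assumes "separable_space (euclidean :: 'h::complex_hilbert_space topology)"
    and "\<not> (\<exists>S :: 'h::complex_hilbert_space set. finite S \<and> module.span scaleC S = UNIV)"
  obtains e :: "nat \<Rightarrow> 'h::complex_hilbert_space"
  where "orthonormal_seq e" "\<forall>x. (\<forall>n. cinner x (e n) = 0) \<longrightarrow> x = 0"
proof -
  obtain E :: "'h set" where E: "orthonormal_set E"
    and total: "\<forall>x. (\<forall>u\<in>E. cinner x u = 0) \<longrightarrow> x = 0"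
    using ex_maximal_orthonormal_set .
  have bij: "bij_betw (from_nat_into E) UNIV E"
    using orthonormal_set_countable[OF assms(1) E] orthonormal_set_infinite[OF assms(2) E total]
    by (rule bij_betw_from_nat_into)
  then have mem: "from_nat_into E n \<in> E" for n by (auto simp: bij_betw_def)
  have "orthonormal_seq (from_nat_into E)"
    unfolding orthonormal_seq_def
  proof (intro allI)
    fix i j
    show "cinner (from_nat_into E i) (from_nat_into E j) = (if i = j then 1 else 0)"
      using E mem[of i] mem[of j] bij_betw_imp_inj_on[OF bij] inj_eq
      unfolding orthonormal_set_def by metis
  qed
  moreover have "x = 0" if "\<forall>n. cinner x (from_nat_into E n) = 0" for x
    using total that bij by (metis bij_betw_imp_surj_on imageE)
  ultimately show thesis using that by blast
qed

lemma norm_orthonormal_sum: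
  assumes "orthonormal_seq b" "finite F"
  shows "(norm (\<Sum>n\<in>F. c n *\<^sub>C b n))\<^sup>2 = (\<Sum>n\<in>F. (cmod (c n))\<^sup>2)"
proof -
  have "cinner (\<Sum>n\<in>F. c n *\<^sub>C b n) (\<Sum>n\<in>F. c n *\<^sub>C b n)
      = (\<Sum>n\<in>F. \<Sum>m\<in>F. if m = n then c n * cnj (c n) else 0)"
    unfolding cinner_sum_left unfolding cinner_sum_right using assms(1)
    by (intro sum.cong refl) (auto simp: cinner_simps orthonormal_seq_def)
  also have "\<dots> = (\<Sum>n\<in>F. c n * cnj (c n))" using assms(2) by simp
  also have "\<dots> = complex_of_real (\<Sum>n\<in>F. (cmod (c n))\<^sup>2)" by (simp add: complex_norm_square del: of_real_power)
  finally show ?thesis unfolding cinner_self using of_real_eq_iff by blast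
qed

lemma Bessel_inequality:
  assumes a: "orthonormal_seq a" and "finite F"
  shows "(\<Sum>n\<in>F. (cmod (cinner x (a n)))\<^sup>2) \<le> (norm x)\<^sup>2"
proof -
  let ?y = "\<Sum>n\<in>F. cinner x (a n) *\<^sub>C a n" and ?s = "\<Sum>n\<in>F. (cmod (cinner x (a n)))\<^sup>2"
  have "cinner x ?y = complex_of_real ?s"
    by (simp add: cinner_sum_right cinner_scaleC_right complex_norm_square mult.commute
        del: of_real_power)
  then have "ip x ?y = ?s" by (simp add: ip_def)
  moreover have "ip ?y ?y = ?s" unfolding ip_self by (rule norm_orthonormal_sum[OF assms])
  ultimately have "ip (x - ?y) (x - ?y) = (norm x)\<^sup>2 - ?s"
    by (simp add: ip_simps ip_commute[of ?y x] ip_self[of x])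
  then show ?thesis using ip_self[of "x - ?y"] by (metis diff_ge_0_iff_ge zero_le_power2)
qed

text \<open>The partial isometry sending \<open>a n\<close> to \<open>b n\<close> and the orthogonal complement of all \<open>a n\<close> to \<open>0\<close>.\<close>

definition transfer :: "(nat \<Rightarrow> 'h) \<Rightarrow> (nat \<Rightarrow> 'h) \<Rightarrow> ('h::complex_hilbert_space \<Rightarrow>\<^sub>L 'h)" where
  "transfer a b = Blinfun (\<lambda>x. \<Sum>n. cinner x (a n) *\<^sub>C b n)"

context
  fixes a b :: "nat \<Rightarrow> 'h::complex_hilbert_space"
  assumes a: "orthonormal_seq a" and b: "orthonormal_seq b"
begin

lemma summable_transfer: "summable (\<lambda>n. cinner x (a n) *\<^sub>C b n)"
  unfolding summable_Cauchy
proof (intro allI impI)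
  fix e :: real assume e: "e > 0"
  \<comment> \<open>Bessel's inequality makes the squared coefficients summable, and orthonormality
    of \<open>b\<close> carries their Cauchy criterion over to the vectors.\<close>
  have "summable (\<lambda>n. (cmod (cinner x (a n)))\<^sup>2)"
    using Bessel_inequality[OF a, of "{..<_}" x]
    by (intro summableI_nonneg_bounded[of _ "(norm x)\<^sup>2"]) auto
  then obtain N where N: "\<And>m n. m \<ge> N \<Longrightarrow> norm (\<Sum>n=m..<n. (cmod (cinner x (a n)))\<^sup>2) < e\<^sup>2"
    using e unfolding summable_Cauchy by (meson zero_less_power)
  have "norm (\<Sum>n=m..<n. cinner x (a n) *\<^sub>C b n) < e" if "m \<ge> N" for m n
  proof -
    have "(norm (\<Sum>n=m..<n. cinner x (a n) *\<^sub>C b n))\<^sup>2 < e\<^sup>2"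
      unfolding norm_orthonormal_sum[OF b finite_atLeastLessThan] using N[OF that, of n] by simp
    then show ?thesis using e by (simp add: power_less_imp_less_base)
  qed
  then show "\<exists>N. \<forall>m\<ge>N. \<forall>n. norm (\<Sum>n=m..<n. cinner x (a n) *\<^sub>C b n) < e" by blast
qed

lemma transfer_apply: "blinfun_apply (transfer a b) x = (\<Sum>n. cinner x (a n) *\<^sub>C b n)"
proof -
  have "bounded_linear (\<lambda>x. \<Sum>n. cinner x (a n) *\<^sub>C b n)"
  proof (rule bounded_linear_intro[of _ 1])
    show "(\<Sum>n. cinner (x + y) (a n) *\<^sub>C b n) =
        (\<Sum>n. cinner x (a n) *\<^sub>C b n) + (\<Sum>n. cinner y (a n) *\<^sub>C b n)" for x y
      by (simp add: cinner_add_left scaleC_add_left suminf_add summable_transfer)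
    show "(\<Sum>n. cinner (r *\<^sub>R x) (a n) *\<^sub>C b n) = r *\<^sub>R (\<Sum>n. cinner x (a n) *\<^sub>C b n)" for r x
      by (simp add: cinner_scaleR_left scaleC_of_real suminf_scaleR_right summable_transfer
          flip: scaleC_scaleC)
    show "norm (\<Sum>n. cinner x (a n) *\<^sub>C b n) \<le> norm x * 1" for x
    proof (rule LIMSEQ_le_const2[OF tendsto_norm[OF summable_LIMSEQ[OF summable_transfer]]])
      have "(norm (\<Sum>n<k. cinner x (a n) *\<^sub>C b n))\<^sup>2 \<le> (norm x)\<^sup>2" for k
        unfolding norm_orthonormal_sum[OF b finite_lessThan]
        by (rule Bessel_inequality[OF a]) simp
      then show "\<exists>N. \<forall>k\<ge>N. norm (\<Sum>n<k. cinner x (a n) *\<^sub>C b n) \<le> norm x * 1"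
        using power2_le_imp_le by fastforce
    qed
  qed
  then show ?thesis by (simp add: transfer_def bounded_linear_Blinfun_apply)
qed

lemma sums_cinner_transfer:
  "(\<lambda>n. cinner x (a n) * cinner (b n) y) sums cinner (blinfun_apply (transfer a b) x) y"
  using bounded_linear.sums[OF bounded_linear_cinner_left summable_sums[OF summable_transfer]]
  by (simp add: transfer_apply cinner_scaleC_left)

lemma transfer_bounded: "transfer a b \<in> bounded_operators"
proof (rule bounded_operatorsI)
  fix c x
  have "(\<lambda>n. c *\<^sub>C (cinner x (a n) *\<^sub>C b n)) sums (c *\<^sub>C transfer a b x)"
    unfolding transfer_apply
    by (rule bounded_linear.sums[OF bounded_linear_scaleC_right summable_sums[OF summable_transfer]])
  then show "transfer a b (c *\<^sub>C x) = c *\<^sub>C transfer a b x"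
    by (simp add: transfer_apply cinner_scaleC_left scaleC_scaleC sums_iff)
qed

lemma cinner_transfer_same: "cinner (blinfun_apply (transfer a b) x) (b m) = cinner x (a m)"
proof -
  have "(\<lambda>n. cinner x (a n) * cinner (b n) (b m)) = (\<lambda>n. if n = m then cinner x (a n) else 0)"
    using b by (auto simp: orthonormal_seq_def)
  then have "(\<lambda>n. cinner x (a n) * cinner (b n) (b m)) sums cinner x (a m)"
    using sums_single[of m "\<lambda>n. cinner x (a n)"] by simp
  from sums_unique2[OF sums_cinner_transfer this] show ?thesis .
qed

lemma cinner_transfer_orthogonal:
  assumes "\<And>n. cinner (b n) y = 0"
  shows "cinner (blinfun_apply (transfer a b) x) y = 0"
proof -
  have "(\<lambda>n. 0) sums cinner (transfer a b x) y"
    using sums_cinner_transfer[of x y] by (simp add: assms)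
  from sums_unique2[OF this sums_zero] show ?thesis .
qed

end

lemma transfer_adjoint:
  assumes a: "orthonormal_seq a" and b: "orthonormal_seq b"
  shows "ip (blinfun_apply (transfer a b) x) y = ip x (transfer b a y)"
proof -
  have "(\<lambda>n. cnj (cinner y (b n) * cinner (a n) x)) sums cnj (cinner (transfer b a y) x)"
    unfolding sums_cnj by (rule sums_cinner_transfer[OF b a])
  moreover have "cnj (cinner y (b n) * cinner (a n) x) = cinner x (a n) * cinner (b n) y" for n
    using cinner_commute[of "b n" y] cinner_commute[of x "a n"] by (simp add: mult.commute)
  moreover have "cnj (cinner (transfer b a y) x) = cinner x (transfer b a y)"
    by (rule cinner_commute[symmetric])
  ultimately have "(\<lambda>n. cinner x (a n) * cinner (b n) y) sums cinner x (transfer b a y)"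
    by simp
  from sums_unique2[OF this sums_cinner_transfer[OF a b, of x y]]
  have "cinner (transfer a b x) y = cinner x (transfer b a y)" by simp
  then show ?thesis by (simp add: ip_def)
qed

lemma transfer_compose:
  assumes "orthonormal_seq a" "orthonormal_seq b" "orthonormal_seq c"
  shows "transfer b c o\<^sub>L transfer a b = transfer a c"
  by (rule blinfun_eqI) (simp add: transfer_apply[OF assms(2,3)] transfer_apply[OF assms(1,3)]
      cinner_transfer_same[OF assms(1,2)])

lemma transfer_compose_orthogonal:
  assumes "orthonormal_seq a" "orthonormal_seq b" "orthonormal_seq b'" "orthonormal_seq c"
    and "\<And>m n. cinner (b m) (b' n) = 0"
  shows "transfer b' c o\<^sub>L transfer a b = 0"
  by (rule blinfun_eqI) (simp add: transfer_apply[OF assms(3,4)]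
      cinner_transfer_orthogonal[OF assms(1,2,5)] scaleC_of_real[of 0, simplified])

text \<open>An orthogonal decomposition of the space into two copies of itself.\<close>

definition doubling where
  "doubling V1 V2 W1 W2 \<longleftrightarrow>
     {V1, V2, W1, W2} \<subseteq> bounded_operators \<and>
     W1 o\<^sub>L V1 = id_blinfun \<and> W2 o\<^sub>L V2 = id_blinfun \<and> W1 o\<^sub>L V2 = 0 \<and> W2 o\<^sub>L V1 = 0 \<and>
     (V1 o\<^sub>L W1) + (V2 o\<^sub>L W2) = id_blinfun \<and>
     (\<forall>x y. ip (blinfun_apply V1 x) y = ip x (W1 y)) \<and>
     (\<forall>x y. ip (blinfun_apply V2 x) y = ip x (W2 y))"

text \<open>The even- and the odd-indexed members of an orthonormal basis are again sequences
  indexed by \<open>nat\<close>; sending the whole basis to either half gives the two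
  isometries.\<close>

lemma ex_doubling:
  assumes "separable_space (euclidean :: 'h::complex_hilbert_space topology)"
    and "\<not> (\<exists>S :: 'h::complex_hilbert_space set. finite S \<and> module.span scaleC S = UNIV)"
  obtains V1 V2 W1 W2 :: "'h::complex_hilbert_space \<Rightarrow>\<^sub>L 'h" where "doubling V1 V2 W1 W2"
proof -
  obtain e :: "nat \<Rightarrow> 'h"
    where e: "orthonormal_seq e" and total: "\<forall>x. (\<forall>n. cinner x (e n) = 0) \<longrightarrow> x = 0"
    using ex_orthonormal_basis[OF assms] .
  define p where "p = (\<lambda>n. e (2 * n))"
  define q where "q = (\<lambda>n. e (2 * n + 1))"
  have p: "orthonormal_seq p" and q: "orthonormal_seq q"
    using e by (auto simp: orthonormal_seq_def p_def q_def)
  have "2 * m \<noteq> 2 * n + 1" "2 * n + 1 \<noteq> 2 * m" for m n :: nat by presburger+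
  then have pq: "cinner (p m) (q n) = 0" "cinner (q n) (p m) = 0" for m n
    using e by (auto simp: orthonormal_seq_def p_def q_def)
  have id: "transfer e e = id_blinfun"
  proof (rule blinfun_eqI)
    fix x
    have "transfer e e x - x = 0"
      by (rule total[rule_format]) (simp add: cinner_diff_left cinner_transfer_same[OF e e])
    then show "transfer e e x = id_blinfun x" by simp
  qed
  have sum: "transfer p p + transfer q q = id_blinfun"
  proof (rule blinfun_eqI)
    fix x
    have "transfer p p x + transfer q q x - x = 0"
    proof (rule total[rule_format])
      fix n
      consider m where "e n = p m" | m where "e n = q m"
        unfolding p_def q_def by (metis oddE evenE)
      then show "cinner (transfer p p x + transfer q q x - x) (e n) = 0"
        by cases (simp_all add: cinner_simps cinner_transfer_same[OF p p] cinner_transfer_same[OF q q]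
            cinner_transfer_orthogonal[OF p p] cinner_transfer_orthogonal[OF q q] pq)
    qed
    then show "(transfer p p + transfer q q) x = id_blinfun x" by (simp add: plus_blinfun.rep_eq)
  qed
  have "doubling (transfer e p) (transfer e q) (transfer p e) (transfer q e)"
    unfolding doubling_def
    using e p q by (simp add: transfer_bounded transfer_compose id sum transfer_adjoint pq
        transfer_compose_orthogonal)
  then show thesis by (rule that)
qed

lemma ex_orthonormal_pair:
  assumes "separable_space (euclidean :: 'h::complex_hilbert_space topology)"
    and "\<not> (\<exists>S :: 'h::complex_hilbert_space set. finite S \<and> module.span scaleC S = UNIV)"
  obtains e1 e2 :: "'h::complex_hilbert_space" where "cinner e1 e1 = 1" "cinner e2 e2 = 1" "cinner e1 e2 = 0" "cinner e2 e1 = 0"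
proof -
  obtain e :: "nat \<Rightarrow> 'h" where "orthonormal_seq e"
    using ex_orthonormal_basis[OF assms] by metis
  then show thesis using that[of "e 0" "e 1"] by (simp add: orthonormal_seq_def)
qed

section \<open>Operator monotone functions are operator concave\<close>

text \<open>One family for both domains in use: \<open>{0..}\<close> yields the positive operators
  and \<open>{0<..}\<close> the positive invertible ones. Only the lower bound is restricted,
  because upper bounds get enlarged freely.\<close>

definition operators_above :: "real set \<Rightarrow> ('h::complex_hilbert_space \<Rightarrow>\<^sub>L 'h) set" where
  "operators_above S = {A. \<exists>m\<in>S. \<exists>M. A \<in> operators_between m M}"

text \<open>Ensures \<open>{m..M} \<subseteq> S\<close> for \<open>m \<in> S\<close>, so that
  continuity on \<open>S\<close> is enough for the calculus of every operator in
  \<open>operators_above S\<close>.\<close>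

definition up_closed :: "real set \<Rightarrow> bool" where
  "up_closed S \<longleftrightarrow> (\<forall>s\<in>S. \<forall>t\<ge>s. t \<in> S)"

lemma up_closed_Ioi [simp]: "up_closed {0<..}"
  and up_closed_Ici [simp]: "up_closed {0..}"
  by (auto simp: up_closed_def)

lemma up_closed_Icc: "up_closed S \<Longrightarrow> m \<in> S \<Longrightarrow> {m..M} \<subseteq> S"
  by (auto simp: up_closed_def)

lemma operators_aboveI: "A \<in> operators_between m M \<Longrightarrow> m \<in> S \<Longrightarrow> A \<in> operators_above S"
  by (auto simp: operators_above_def)

lemma operators_aboveE:
  assumes "A \<in> operators_above S"
  obtains m M where "m \<in> S" "m \<le> M" "A \<in> operators_between m M"
proof -
  obtain m M where "m \<in> S" "A \<in> operators_between m M"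
    using assms by (auto simp: operators_above_def)
  then show thesis
    using that[of m "max m M"] operators_between_mono[of A m M m "max m M"] by auto
qed

lemma operators_above_common:
  assumes "A \<in> operators_above S" "B \<in> operators_above S"
  obtains m M where "m \<in> S" "m \<le> M" "A \<in> operators_between m M" "B \<in> operators_between m M"
proof -
  obtain m M m' M' where "m \<in> S" "m \<le> M" "A \<in> operators_between m M"
    and "m' \<in> S" "m' \<le> M'" "B \<in> operators_between m' M'"
    using assms by (meson operators_aboveE)
  then show thesis
    using that[of "min m m'" "max M M'"] operators_between_mono[of A m M "min m m'" "max M M'"]
      operators_between_mono[of B m' M' "min m m'" "max M M'"]
    by (auto simp: min_def max_def)
qed

lemma positive_operators_eq: "positive_operators = operators_above {0..}"
proof (intro set_eqI iffI)
  fix A :: "'a \<Rightarrow>\<^sub>L 'a"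
  assume "A \<in> positive_operators"
  then have "A \<in> operators_between 0 (norm A)"
    using operators_betweenD(3)[OF self_adjoint_between[of A]]
    by (intro operators_betweenI) (auto simp: positive_operators_iff)
  then show "A \<in> operators_above {0..}" by (rule operators_aboveI) simp
next
  fix A :: "'a \<Rightarrow>\<^sub>L 'a"
  assume "A \<in> operators_above {0..}"
  then obtain m M where "0 \<le> m" "A \<in> operators_between m M" by (auto simp: operators_above_def)
  then show "A \<in> positive_operators"
    using operators_betweenD[OF operators_between_mono[of A m M 0 M]]
    by (simp add: positive_operators_iff)
qed

lemma positive_invertible_operators_eq: "positive_invertible_operators = operators_above {0<..}"
proof (intro set_eqI iffI)
  fix A :: "'a \<Rightarrow>\<^sub>L 'a"
  assume A: "A \<in> positive_invertible_operators"
  then have sa: "self_adjoint A" and pos: "\<And>x. 0 \<le> ip (A x) x" and "invertible_operator A"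
    by (auto simp: positive_invertible_operators_def positive_operators_iff invertible_operator_def)
  then obtain c where "c > 0" "\<And>x. c * (norm x)\<^sup>2 \<le> ip (A x) x"
    using positive_invertible_coercive by blast
  then have "A \<in> operators_between c (norm A)"
    using operators_betweenD(3)[OF self_adjoint_between[OF sa]] sa by (intro operators_betweenI) auto
  then show "A \<in> operators_above {0<..}" using \<open>c > 0\<close> by (intro operators_aboveI) auto
next
  fix A :: "'a \<Rightarrow>\<^sub>L 'a"
  assume "A \<in> operators_above {0<..}"
  then obtain m M where m: "0 < m" and A: "A \<in> operators_between m M"
    by (auto simp: operators_above_def)
  then have "A \<in> positive_operators"
    by (auto simp: positive_operators_eq intro: operators_aboveI)
  moreover have "invertible_operator A"
    using coercive_invertible[OF operators_betweenD(1)[OF A] m] operators_betweenD(2)[OF A] .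
  ultimately show "A \<in> positive_invertible_operators"
    by (auto simp: positive_invertible_operators_def invertible_operator_def)
qed

lemma operators_above_mono: "S \<subseteq> T \<Longrightarrow> operators_above S \<subseteq> operators_above T"
  by (auto simp: operators_above_def)

lemma fun_calc_self_adjoint_above:
  assumes "A \<in> operators_above S" "up_closed S" "continuous_on S f"
  shows "self_adjoint (fun_calc f A)"
  using assms by (meson operators_aboveE self_adjoint_fun_calc continuous_on_subset up_closed_Icc)

lemma operator_monotoneD:
  fixes A B :: "'h::complex_hilbert_space \<Rightarrow>\<^sub>L 'h"
  assumes "operator_monotone_on (operators_above S :: ('h \<Rightarrow>\<^sub>L 'h) set) f"
    and "A \<in> operators_above S" "B \<in> operators_above S" "\<And>x. ip (blinfun_apply A x) x \<le> ip (blinfun_apply B x) x"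
  shows "ip (blinfun_apply (fun_calc f A) x) x \<le> ip (fun_calc f B x) x"
proof -
  have "self_adjoint A" "self_adjoint B"
    using assms(2,3) by (meson operators_aboveE operators_betweenD(1))+
  then have "A \<le>\<^sub>L B" using assms(4) by (simp add: loewner_le_iff)
  then have "fun_calc f A \<le>\<^sub>L fun_calc f B"
    using assms(1-3) by (simp add: operator_monotone_on_def)
  then show ?thesis by (rule loewner_le_ip)
qed

section \<open>Doublings and block-diagonal operators\<close>

lemma doublingD:
  assumes "doubling V1 V2 W1 W2"
  shows "V1 \<in> bounded_operators" "V2 \<in> bounded_operators"
    "W1 \<in> bounded_operators" "W2 \<in> bounded_operators"
    "W1 (V1 x) = x" "W2 (V2 x) = x" "W1 (V2 x) = 0" "W2 (V1 x) = 0"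
    "V1 (W1 x) + V2 (W2 x) = x"
    "ip (V1 x) y = ip x (W1 y)" "ip (V2 x) y = ip x (W2 y)"
  using assms unfolding doubling_def
  by (auto simp: blinfun_eq_iff blinfun.bilinear_simps)

lemma doublingI:
  assumes "V1 \<in> bounded_operators" "V2 \<in> bounded_operators"
    "W1 \<in> bounded_operators" "W2 \<in> bounded_operators"
    "\<And>x. W1 (V1 x) = x" "\<And>x. W2 (V2 x) = x" "\<And>x. W1 (V2 x) = 0" "\<And>x. W2 (V1 x) = 0"
    "\<And>x. V1 (W1 x) + V2 (W2 x) = x"
    "\<And>x y. ip (V1 x) y = ip x (W1 y)" "\<And>x y. ip (V2 x) y = ip x (W2 y)"
  shows "doubling V1 V2 W1 W2"
  using assms unfolding doubling_def
  by (auto simp: blinfun_eq_iff blinfun.bilinear_simps)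

lemma doubling_norm:
  assumes D: "doubling V1 V2 W1 W2"
  shows "norm (V1 x) = norm x" "norm (V2 x) = norm x"
    "(norm (W1 x))\<^sup>2 + (norm (W2 x))\<^sup>2 = (norm x)\<^sup>2"
proof -
  have "(norm (V1 x))\<^sup>2 = (norm x)\<^sup>2" "(norm (V2 x))\<^sup>2 = (norm x)\<^sup>2"
    by (simp_all add: ip_self[symmetric] doublingD[OF D])
  then show "norm (V1 x) = norm x" "norm (V2 x) = norm x" by simp_all
  have "(norm x)\<^sup>2 = ip (V1 (W1 x) + V2 (W2 x)) x"
    by (simp add: doublingD(9)[OF D] ip_self)
  then show "(norm (W1 x))\<^sup>2 + (norm (W2 x))\<^sup>2 = (norm x)\<^sup>2"
    by (simp add: ip_add_left doublingD(10,11)[OF D] ip_self)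
qed

text \<open>Provides a second decomposition of the same space: an operator that is block-diagonal in
  the rotated doubling has a weighted average as its diagonal block in the original one.\<close>

lemma rotate_doubling:
  assumes D: "doubling V1 V2 W1 W2" and cs: "c\<^sup>2 + s\<^sup>2 = 1"
  shows "doubling (c *\<^sub>R V1 + s *\<^sub>R V2) (c *\<^sub>R V2 - s *\<^sub>R V1) (c *\<^sub>R W1 + s *\<^sub>R W2) (c *\<^sub>R W2 - s *\<^sub>R W1)"
proof -
  have one: "(c * c) *\<^sub>R x + (s * s) *\<^sub>R x = x" for x :: 'a
    unfolding scaleR_add_left[symmetric] using cs by (simp add: power2_eq_square)
  then have two: "(s * s) *\<^sub>R x + (c * c) *\<^sub>R x = x" for x :: 'a
    by (simp add: add.commute)
  show ?thesis
  proof (rule doublingI)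
    fix x
    have "blinfun_apply (c *\<^sub>R V1 + s *\<^sub>R V2) ((c *\<^sub>R W1 + s *\<^sub>R W2) x) +
        blinfun_apply (c *\<^sub>R V2 - s *\<^sub>R V1) ((c *\<^sub>R W2 - s *\<^sub>R W1) x)
      = (c\<^sup>2 + s\<^sup>2) *\<^sub>R (V1 (W1 x) + V2 (W2 x))"
      by (simp add: blinfun.bilinear_simps algebra_simps power2_eq_square)
    then show "blinfun_apply (c *\<^sub>R V1 + s *\<^sub>R V2) ((c *\<^sub>R W1 + s *\<^sub>R W2) x) +
        blinfun_apply (c *\<^sub>R V2 - s *\<^sub>R V1) ((c *\<^sub>R W2 - s *\<^sub>R W1) x) = x"
      unfolding doublingD(9)[OF D] cs by simp
  qed (simp_all add: doublingD(1-8,10,11)[OF D] blinfun.bilinear_simps ip_simps one two)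
qed

definition direct_sum where
  "direct_sum V1 V2 W1 W2 A B = (V1 o\<^sub>L A o\<^sub>L W1) + (V2 o\<^sub>L B o\<^sub>L W2)"

context
  fixes V1 V2 W1 W2 :: "'h::complex_hilbert_space \<Rightarrow>\<^sub>L 'h"
  assumes D: "doubling V1 V2 W1 W2"
begin

lemma direct_sum_apply:
  "blinfun_apply (direct_sum V1 V2 W1 W2 A B) x = V1 (A (W1 x)) + V2 (B (W2 x))"
  by (simp add: direct_sum_def blinfun.bilinear_simps)

lemma ip_direct_sum:
  "ip (blinfun_apply (direct_sum V1 V2 W1 W2 A B) x) x = ip (A (W1 x)) (W1 x) + ip (B (W2 x)) (W2 x)"
  by (simp add: direct_sum_apply ip_add_left doublingD(10,11)[OF D])

lemma direct_sum_between:
  assumes A: "A \<in> operators_between m M" and B: "B \<in> operators_between m M"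
  shows "direct_sum V1 V2 W1 W2 A B \<in> operators_between m M"
proof (rule operators_betweenI)
  note sa = operators_betweenD(1)[OF A] operators_betweenD(1)[OF B]
  have right: "ip y (V1 z) = ip (W1 y) z" "ip y (V2 z) = ip (W2 y) z" for y z
    using doublingD(10,11)[OF D, of z y] by (simp_all add: ip_commute)
  have "ip (direct_sum V1 V2 W1 W2 A B x) y = ip x (direct_sum V1 V2 W1 W2 A B y)" for x y
    by (simp add: direct_sum_apply ip_add_left ip_add_right doublingD(10,11)[OF D] right
        self_adjoint_ip[OF sa(1)] self_adjoint_ip[OF sa(2)])
  then show "self_adjoint (direct_sum V1 V2 W1 W2 A B)"
    using doublingD(1-4)[OF D] self_adjoint_bounded[OF sa(1)] self_adjoint_bounded[OF sa(2)]
    by (auto simp: self_adjoint_def direct_sum_def)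
  fix x
  have n: "r * (norm x)\<^sup>2 = r * (norm (W1 x))\<^sup>2 + r * (norm (W2 x))\<^sup>2" for r
    unfolding doubling_norm(3)[OF D, of x, symmetric] by (rule distrib_left)
  show "m * (norm x)\<^sup>2 \<le> ip (direct_sum V1 V2 W1 W2 A B x) x"
    unfolding ip_direct_sum n by (intro add_mono operators_betweenD(2)[OF A] operators_betweenD(2)[OF B])
  show "ip (direct_sum V1 V2 W1 W2 A B x) x \<le> M * (norm x)\<^sup>2"
    unfolding ip_direct_sum n by (intro add_mono operators_betweenD(3)[OF A] operators_betweenD(3)[OF B])
qed

text \<open>\<open>V1\<close> intertwines \<open>A\<close>, and \<open>V2\<close> intertwines
  \<open>B\<close>, with the direct sum; the ranges of the two isometries together span the
  space.\<close>

lemma fun_calc_direct_sum: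
  assumes A: "A \<in> operators_between m M" and B: "B \<in> operators_between m M"
    and f: "continuous_on {m..M} f"
  shows "fun_calc f (direct_sum V1 V2 W1 W2 A B) = direct_sum V1 V2 W1 W2 (fun_calc f A) (fun_calc f B)"
proof (rule blinfun_eqI)
  fix x
  let ?T = "direct_sum V1 V2 W1 W2 A B"
  note T = direct_sum_between[OF A B]
  have "V1 o\<^sub>L A = ?T o\<^sub>L V1" "V2 o\<^sub>L B = ?T o\<^sub>L V2"
    by (auto intro!: blinfun_eqI simp: direct_sum_apply doublingD[OF D])
  from fun_calc_intertwine[OF A T f this(1)] fun_calc_intertwine[OF B T f this(2)]
  have eq: "fun_calc f ?T (V1 y) = V1 (fun_calc f A y)" "fun_calc f ?T (V2 y) = V2 (fun_calc f B y)" for y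
    by (metis blinfun_apply_blinfun_compose)+
  have "fun_calc f ?T x = fun_calc f ?T (V1 (W1 x) + V2 (W2 x))" by (simp add: doublingD(9)[OF D])
  then show "fun_calc f ?T x = direct_sum V1 V2 W1 W2 (fun_calc f A) (fun_calc f B) x"
    by (simp add: blinfun.add_right eq direct_sum_apply)
qed

text \<open>Completing the square: the off-diagonal blocks of \<open>T\<close> are absorbed by \<open>\<epsilon>\<close> in the first and by a
  large multiple of the identity in the second diagonal block.\<close>

lemma le_direct_sum:
  assumes \<epsilon>: "\<epsilon> > 0" and T: "self_adjoint T" and C: "\<And>y. ip (T (V1 y)) (V1 y) = ip (blinfun_apply C y) y"
    and N: "(norm T)\<^sup>2 / \<epsilon> + norm T \<le> N"
  shows "ip (blinfun_apply T x) x \<le>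
    ip (direct_sum V1 V2 W1 W2 (C + \<epsilon> *\<^sub>R id_blinfun) (N *\<^sub>R id_blinfun) x) x"
proof -
  define y where "y = W1 x"
  define z where "z = W2 x"
  have x: "x = V1 y + V2 z" by (simp add: y_def z_def doublingD(9)[OF D])
  have "ip (T (V2 z)) (V1 y) = ip (T (V1 y)) (V2 z)" by (metis self_adjoint_ip[OF T] ip_commute)
  then have "ip (T x) x = ip (C y) y + 2 * ip (T (V1 y)) (V2 z) + ip (T (V2 z)) (V2 z)"
    unfolding x by (simp add: blinfun.bilinear_simps ip_simps C)
  moreover have "ip (T (V2 z)) (V2 z) \<le> norm T * (norm z)\<^sup>2"
    using ip_le_norm[of T "V2 z"] by (simp add: doubling_norm[OF D])
  moreover have "2 * ip (T (V1 y)) (V2 z) \<le> \<epsilon> * (norm y)\<^sup>2 + (norm T)\<^sup>2 / \<epsilon> * (norm z)\<^sup>2"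
  proof -
    have "ip (T (V1 y)) (V2 z) \<le> norm (T (V1 y)) * norm (V2 z)"
      using ip_Cauchy_Schwarz[of "T (V1 y)" "V2 z"] by simp
    also have "\<dots> \<le> norm T * norm (V1 y) * norm (V2 z)"
      by (intro mult_right_mono norm_blinfun) simp
    finally have "ip (T (V1 y)) (V2 z) \<le> norm T * norm y * norm z"
      by (simp add: doubling_norm[OF D])
    moreover have "0 \<le> (\<epsilon> * norm y - norm T * norm z)\<^sup>2 / \<epsilon>" using \<epsilon> by simp
    then have "2 * (norm T * norm y * norm z) \<le> \<epsilon> * (norm y)\<^sup>2 + (norm T)\<^sup>2 / \<epsilon> * (norm z)\<^sup>2"
      using \<epsilon> by (simp add: power2_eq_square field_simps)
    ultimately show ?thesis by simp
  qed
  moreover have "((norm T)\<^sup>2 / \<epsilon> + norm T) * (norm z)\<^sup>2 \<le> N * (norm z)\<^sup>2"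
    by (intro mult_right_mono N) simp
  ultimately show ?thesis
    by (simp add: ip_direct_sum y_def[symmetric] z_def[symmetric] blinfun.bilinear_simps ip_simps
        ip_self algebra_simps)
qed

end

text \<open>Removes the \<open>\<epsilon>\<close> spent on dominating the off-diagonal blocks. The
  interval reaches to \<open>M + 1\<close> because the shift stays below 1.\<close>

lemma fun_calc_shift:
  assumes A: "A \<in> operators_between m M" and f: "continuous_on {m..M + 1} f" and "\<eta> > 0"
  obtains \<epsilon> where "0 < \<epsilon>" "\<epsilon> < 1"
    "\<forall>x. ip (blinfun_apply (fun_calc f (A + \<epsilon> *\<^sub>R id_blinfun)) x) x \<le> ip (fun_calc f A x) x + \<eta> * (norm x)\<^sup>2"
proof -
  have "uniformly_continuous_on {m..M + 1} f"
    using f compact_uniformly_continuous by blast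
  then obtain d where d: "d > 0"
    "\<And>s t. s \<in> {m..M + 1} \<Longrightarrow> t \<in> {m..M + 1} \<Longrightarrow> dist t s < d \<Longrightarrow> dist (f t) (f s) < \<eta>"
    using \<open>\<eta> > 0\<close> unfolding uniformly_continuous_on_def by metis
  define \<epsilon> where "\<epsilon> = min (d / 2) (1 / 2)"
  have \<epsilon>: "0 < \<epsilon>" "\<epsilon> < 1" "\<epsilon> < d" using d(1) by (auto simp: \<epsilon>_def)
  have shift: "fun_calc (\<lambda>t. t + \<epsilon>) A = A + \<epsilon> *\<^sub>R id_blinfun"
    by (simp add: fun_calc_add[OF A] fun_calc_const[OF A] fun_calc_ident[OF A])
  have f': "continuous_on {m..M} f" using f by (rule continuous_on_subset) auto
  have fs: "continuous_on {m..M} (\<lambda>t. f (t + \<epsilon>))"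
    by (rule continuous_on_compose2[OF f]) (use \<epsilon> in \<open>auto intro!: continuous_intros\<close>)
  have "fun_calc f (A + \<epsilon> *\<^sub>R id_blinfun) = fun_calc (\<lambda>t. f (t + \<epsilon>)) A"
    unfolding shift[symmetric]
    by (rule fun_calc_compose[OF A _ _ f]) (use \<epsilon> in \<open>auto intro!: continuous_intros\<close>)
  moreover have "ip (fun_calc (\<lambda>t. f (t + \<epsilon>)) A x) x \<le> ip (fun_calc (\<lambda>t. f t + \<eta>) A x) x" for x
  proof (rule fun_calc_le[OF A fs])
    show "continuous_on {m..M} (\<lambda>t. f t + \<eta>)" by (intro continuous_intros f')
    show "f (t + \<epsilon>) \<le> f t + \<eta>" if "t \<in> {m..M}" for t
      using d(2)[of t "t + \<epsilon>"] that \<epsilon> by (auto simp: dist_real_def)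
  qed
  moreover have "fun_calc (\<lambda>t. f t + \<eta>) A = fun_calc f A + \<eta> *\<^sub>R id_blinfun"
    by (simp add: fun_calc_add[OF A f'] fun_calc_const[OF A])
  ultimately show thesis
    using that[of \<epsilon>] \<epsilon> by (simp add: blinfun.bilinear_simps ip_simps ip_self)
qed

lemma operators_between_combine:
  assumes A: "A \<in> operators_between m M" and B: "B \<in> operators_between m' M'" and "0 \<le> a" "0 \<le> b"
  shows "a *\<^sub>R A + b *\<^sub>R B \<in> operators_between (a * m + b * m') (a * M + b * M')"
proof (rule operators_betweenI)
  show "self_adjoint (a *\<^sub>R A + b *\<^sub>R B)"
    using operators_betweenD(1)[OF A] operators_betweenD(1)[OF B] by simp
  fix x
  show "(a * m + b * m') * (norm x)\<^sup>2 \<le> ip ((a *\<^sub>R A + b *\<^sub>R B) x) x"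
    using mult_left_mono[OF operators_betweenD(2)[OF A, of x] \<open>0 \<le> a\<close>]
      mult_left_mono[OF operators_betweenD(2)[OF B, of x] \<open>0 \<le> b\<close>]
    by (simp add: blinfun.bilinear_simps ip_simps algebra_simps)
  show "ip ((a *\<^sub>R A + b *\<^sub>R B) x) x \<le> (a * M + b * M') * (norm x)\<^sup>2"
    using mult_left_mono[OF operators_betweenD(3)[OF A, of x] \<open>0 \<le> a\<close>]
      mult_left_mono[OF operators_betweenD(3)[OF B, of x] \<open>0 \<le> b\<close>]
    by (simp add: blinfun.bilinear_simps ip_simps algebra_simps)
qed

lemma operators_between_add_id:
  assumes "A \<in> operators_between m M"
  shows "A + r *\<^sub>R id_blinfun \<in> operators_between (m + r) (M + r)"
  using assms
  by (auto simp: operators_between_def blinfun.bilinear_simps ip_simps ip_self algebra_simps)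

text \<open>In block form: \<open>T\<close> is \<open>A \<oplus> B\<close> conjugated by a rotation, its upper left block is
  \<open>c\<^sup>2 A + s\<^sup>2 B\<close>, and \<open>f(T)\<close> has upper left block \<open>c\<^sup>2 f(A) + s\<^sup>2 f(B)\<close>.\<close>

lemma operator_monotone_imp_concave:
  fixes A B :: "'h::complex_hilbert_space \<Rightarrow>\<^sub>L 'h"
  assumes D: "doubling V1 V2 W1 (W2 :: 'h \<Rightarrow>\<^sub>L 'h)"
    and mono: "operator_monotone_on (operators_above S :: ('h \<Rightarrow>\<^sub>L 'h) set) f"
    and S: "up_closed S" and f: "continuous_on S f"
    and A: "A \<in> operators_above S" and B: "B \<in> operators_above S" and cs: "c\<^sup>2 + s\<^sup>2 = 1"
  shows "c\<^sup>2 * ip (fun_calc f A x) x + s\<^sup>2 * ip (fun_calc f B x) x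
    \<le> ip (fun_calc f (c\<^sup>2 *\<^sub>R A + s\<^sup>2 *\<^sub>R B) x) x"
proof -
  obtain m M where m: "m \<in> S" and mM: "m \<le> M"
    and A: "A \<in> operators_between m M" and B: "B \<in> operators_between m M"
    using operators_above_common[OF A B] .
  define X1 X2 Y1 Y2 where XY: "X1 = c *\<^sub>R V1 + s *\<^sub>R V2" "X2 = c *\<^sub>R V2 - s *\<^sub>R V1"
    "Y1 = c *\<^sub>R W1 + s *\<^sub>R W2" "Y2 = c *\<^sub>R W2 - s *\<^sub>R W1"
  have D': "doubling X1 X2 Y1 Y2" unfolding XY by (rule rotate_doubling[OF D cs])
  have YV: "Y1 (V1 x) = c *\<^sub>R x" "Y2 (V1 x) = - s *\<^sub>R x" for x
    by (simp_all add: XY blinfun.bilinear_simps doublingD[OF D])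
  define T where "T = direct_sum X1 X2 Y1 Y2 A B"
  define C where "C = c\<^sup>2 *\<^sub>R A + s\<^sup>2 *\<^sub>R B"
  have T: "T \<in> operators_between m M" unfolding T_def by (rule direct_sum_between[OF D' A B])
  have C: "C \<in> operators_between m M"
    using operators_between_combine[OF A B, of "c\<^sup>2" "s\<^sup>2"] cs
    by (simp add: C_def flip: distrib_right)
  have compress: "ip (direct_sum X1 X2 Y1 Y2 P Q (V1 y)) (V1 y) = c\<^sup>2 * ip (P y) y + s\<^sup>2 * ip (Q y) y" for P Q y
    unfolding ip_direct_sum[OF D'] YV by (simp add: blinfun.bilinear_simps ip_simps power2_eq_square)
  have f_Icc: "continuous_on {m..r} f" for r
    using f up_closed_Icc[OF S m] by (rule continuous_on_subset)
  let ?l = "c\<^sup>2 * ip (fun_calc f A x) x + s\<^sup>2 * ip (fun_calc f B x) x"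
  have "?l \<le> ip (fun_calc f C x) x + \<eta> * (norm x)\<^sup>2" if \<eta>: "\<eta> > 0" for \<eta>
  proof -
    obtain \<epsilon> where \<epsilon>: "0 < \<epsilon>" "\<epsilon> < 1"
      and shift: "\<forall>x. ip (fun_calc f (C + \<epsilon> *\<^sub>R id_blinfun) x) x \<le> ip (fun_calc f C x) x + \<eta> * (norm x)\<^sup>2"
      using fun_calc_shift[OF C f_Icc \<eta>] .
    \<comment> \<open>The maximum with \<open>m\<close> keeps the second block in the domain of
      \<open>f\<close>; compression to the range of \<open>V1\<close> later discards that block,
      however large it is.\<close>
    define N where "N = max m ((norm T)\<^sup>2 / \<epsilon> + norm T)"
    define K where "K = max (M + \<epsilon>) N"
    have C': "C + \<epsilon> *\<^sub>R id_blinfun \<in> operators_between m K"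
      by (rule operators_between_mono[OF operators_between_add_id[OF C]]) (use \<epsilon> in \<open>auto simp: K_def\<close>)
    have N': "N *\<^sub>R id_blinfun \<in> operators_between m K"
      by (rule operators_between_mono[OF scaleR_id_between]) (auto simp: K_def N_def)
    define U where "U = direct_sum V1 V2 W1 W2 (C + \<epsilon> *\<^sub>R id_blinfun) (N *\<^sub>R id_blinfun)"
    have U: "U \<in> operators_between m K" unfolding U_def by (rule direct_sum_between[OF D C' N'])
    have "ip (T x) x \<le> ip (U x) x" for x
      unfolding U_def using \<epsilon>(1) operators_betweenD(1)[OF T]
      by (rule le_direct_sum[OF D])
        (simp_all add: T_def compress C_def N_def blinfun.bilinear_simps ip_simps)
    then have "ip (fun_calc f T (V1 x)) (V1 x) \<le> ip (fun_calc f U (V1 x)) (V1 x)"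
      using operator_monotoneD[OF mono operators_aboveI[OF T m] operators_aboveI[OF U m]] by blast
    moreover have "ip (fun_calc f T (V1 x)) (V1 x) = ?l"
      unfolding T_def fun_calc_direct_sum[OF D' A B f_Icc] by (rule compress)
    moreover have "ip (fun_calc f U (V1 x)) (V1 x) = ip (fun_calc f (C + \<epsilon> *\<^sub>R id_blinfun) x) x"
      unfolding U_def fun_calc_direct_sum[OF D C' N' f_Icc] ip_direct_sum[OF D]
      by (simp add: doublingD[OF D])
    ultimately show ?thesis using shift[rule_format, of x] by linarith
  qed
  then have *: "?l \<le> ip (fun_calc f C x) x + \<eta> * (norm x)\<^sup>2" if "\<eta> > 0" for \<eta> using that by blast
  have "?l \<le> ip (fun_calc f C x) x"
  proof (rule field_le_epsilon)
    fix e :: real assume e: "e > 0"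
    \<comment> \<open>The 1 in the denominator covers \<open>x = 0\<close>.\<close>
    have "e / (1 + (norm x)\<^sup>2) * (norm x)\<^sup>2 \<le> e" 
      using e by (simp add: field_simps add_pos_nonneg)
    then show "?l \<le> ip (fun_calc f C x) x + e"
      using *[of "e / (1 + (norm x)\<^sup>2)"] e by (simp add: add_pos_nonneg)
  qed
  then show ?thesis by (simp add: C_def)
qed

lemma operator_monotone_imp_concave_real:
  assumes D: "doubling V1 V2 W1 (W2 :: 'h::complex_hilbert_space \<Rightarrow>\<^sub>L 'h)"
    and mono: "operator_monotone_on (operators_above S :: ('h \<Rightarrow>\<^sub>L 'h) set) f"
    and S: "up_closed S" and f: "continuous_on S f" and nontrivial: "(x::'h) \<noteq> 0"
    and ab: "a \<in> S" "b \<in> S" and l: "0 \<le> l" "l \<le> 1"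
  shows "(1 - l) * f a + l * f b \<le> f ((1 - l) * a + l * b)"
proof -
  have above: "r *\<^sub>R id_blinfun \<in> operators_above S" if "r \<in> S" for r
    using operators_aboveI[OF scaleR_id_between that] .
  have "((sqrt (1 - l))\<^sup>2 * f a + (sqrt l)\<^sup>2 * f b) * (norm x)\<^sup>2
      \<le> f ((sqrt (1 - l))\<^sup>2 * a + (sqrt l)\<^sup>2 * b) * (norm x)\<^sup>2"
    using operator_monotone_imp_concave[OF D mono S f above[OF ab(1)] above[OF ab(2)], of "sqrt (1 - l)" "sqrt l" x] l
    by (simp add: fun_calc_scaleR_id blinfun.bilinear_simps ip_simps ip_self distrib_right
        flip: scaleR_add_left)
  then show ?thesis using nontrivial l by simp
qed

section \<open>Functional calculus on strictly positive operators\<close>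

abbreviation strictly_positive :: "('h::complex_hilbert_space \<Rightarrow>\<^sub>L 'h) set" where
  "strictly_positive \<equiv> operators_above {0<..}"

lemma continuous_on_subinterval:
  "up_closed S \<Longrightarrow> m \<in> S \<Longrightarrow> continuous_on S f \<Longrightarrow> continuous_on {m..M::real} f"
  by (meson continuous_on_subset up_closed_Icc)

context
  fixes A :: "'h::complex_hilbert_space \<Rightarrow>\<^sub>L 'h" and S :: "real set"
  assumes A: "A \<in> operators_above S" and S: "up_closed S"
begin

lemma above_fun_calc_mult:
  assumes "continuous_on S f" "continuous_on S g"
  shows "fun_calc (\<lambda>t. f t * g t) A = fun_calc f A o\<^sub>L fun_calc g A"
  using A by (rule operators_aboveE) (use assms continuous_on_subinterval[OF S] fun_calc_mult in metis)

lemma above_fun_calc_add: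
  assumes "continuous_on S f" "continuous_on S g"
  shows "fun_calc (\<lambda>t. f t + g t) A = fun_calc f A + fun_calc g A"
  using A by (rule operators_aboveE) (use assms continuous_on_subinterval[OF S] fun_calc_add in metis)

lemma above_fun_calc_scaleR:
  assumes "continuous_on S f"
  shows "fun_calc (\<lambda>t. c * f t) A = c *\<^sub>R fun_calc f A"
  using A by (rule operators_aboveE) (use assms continuous_on_subinterval[OF S] fun_calc_scaleR in metis)

lemma above_fun_calc_const: "fun_calc (\<lambda>_. c) A = c *\<^sub>R id_blinfun"
  using A by (rule operators_aboveE) (rule fun_calc_const)

lemma above_fun_calc_ident: "fun_calc (\<lambda>t. t) A = A"
  using A by (rule operators_aboveE) (rule fun_calc_ident)

lemma above_fun_calc_cong:
  assumes "continuous_on S g" and eq: "\<And>t. t \<in> S \<Longrightarrow> f t = g t"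
  shows "fun_calc f A = fun_calc g A"
proof -
  obtain m M where m: "m \<in> S" "A \<in> operators_between m M" using A by (rule operators_aboveE)
  show ?thesis
    by (rule fun_calc_cong[OF m(2) eq continuous_on_subinterval[OF S m(1) assms(1)]])
      (use up_closed_Icc[OF S m(1), of M] in auto)
qed

lemma above_fun_calc_le:
  assumes "continuous_on S f" "continuous_on S g" and le: "\<And>t. t \<in> S \<Longrightarrow> f t \<le> g t"
  shows "ip (fun_calc f A x) x \<le> ip (fun_calc g A x) x"
proof -
  obtain m M where m: "m \<in> S" "A \<in> operators_between m M" using A by (rule operators_aboveE)
  show ?thesis
    by (rule fun_calc_le[OF m(2) continuous_on_subinterval[OF S m(1) assms(1)]
          continuous_on_subinterval[OF S m(1) assms(2)] le])
      (use up_closed_Icc[OF S m(1), of M] in auto)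
qed

lemma above_fun_calc_image:
  fixes f :: "real \<Rightarrow> real"
  assumes "continuous_on S f"
  obtains m M c d where "A \<in> operators_between m M" "continuous_on {m..M} f" "c \<in> f ` S" "f ` {m..M} \<subseteq> {c..d}"
proof -
  obtain m M where m: "m \<in> S" "m \<le> M" "A \<in> operators_between m M" using A by (rule operators_aboveE)
  note f = continuous_on_subinterval[OF S m(1) assms, of M]
  obtain s where s: "s \<in> {m..M}" "\<And>t. t \<in> {m..M} \<Longrightarrow> f s \<le> f t"
    using continuous_attains_inf[of "{m..M}" f] f m(2) by auto
  obtain s' where s': "s' \<in> {m..M}" "\<And>t. t \<in> {m..M} \<Longrightarrow> f t \<le> f s'"
    using continuous_attains_sup[of "{m..M}" f] f m(2) by auto
  show thesis
    by (rule that[OF m(3) f, of "f s" "f s'"]) (use s s' up_closed_Icc[OF S m(1), of M] in auto)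
qed

lemma fun_calc_above:
  assumes "continuous_on S f" "f ` S \<subseteq> S'"
  shows "fun_calc f A \<in> operators_above S'"
proof -
  obtain m M c d where "A \<in> operators_between m M" "continuous_on {m..M} f" "c \<in> f ` S" "f ` {m..M} \<subseteq> {c..d}"
    using above_fun_calc_image[OF assms(1)] .
  then show ?thesis
    using assms(2) by (intro operators_aboveI[OF fun_calc_between[of A m M f c d]])
      (auto simp: image_subset_iff)
qed

lemma above_fun_calc_compose:
  assumes "continuous_on S f" "f ` S \<subseteq> S'" "up_closed S'" "continuous_on S' g"
  shows "fun_calc g (fun_calc f A) = fun_calc (\<lambda>t. g (f t)) A"
proof -
  obtain m M c d where "A \<in> operators_between m M" "continuous_on {m..M} f"
    and c: "c \<in> f ` S" and "f ` {m..M} \<subseteq> {c..d}"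
    using above_fun_calc_image[OF assms(1)] .
  moreover have "continuous_on {c..d} g"
    using c assms(2-4) by (intro continuous_on_subinterval[of S']) auto
  ultimately show ?thesis by (intro fun_calc_compose)
qed

end

lemma above_self_adjoint: "A \<in> operators_above S \<Longrightarrow> self_adjoint A"
  by (meson operators_aboveE operators_betweenD(1))

lemma strictly_positive_inverse:
  assumes A: "A \<in> strictly_positive"
  shows "fun_calc (\<lambda>t. 1 / t) A \<in> strictly_positive"
    "A (fun_calc (\<lambda>t. 1 / t) A x) = x" "fun_calc (\<lambda>t. 1 / t) A (A x) = x"
proof -
  have c: "continuous_on {0<..} (\<lambda>t::real. 1 / t)" by (auto intro!: continuous_intros)
  show "fun_calc (\<lambda>t. 1 / t) A \<in> strictly_positive"
    by (rule fun_calc_above[OF A _ c]) auto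
  have "fun_calc (\<lambda>t. t * (1 / t)) A = id_blinfun" "fun_calc (\<lambda>t. 1 / t * t) A = id_blinfun"
    using above_fun_calc_cong[OF A _ continuous_on_const, of _ 1] above_fun_calc_const[OF A, of 1] by simp_all
  then have "A o\<^sub>L fun_calc (\<lambda>t. 1 / t) A = id_blinfun" "fun_calc (\<lambda>t. 1 / t) A o\<^sub>L A = id_blinfun"
    using above_fun_calc_mult[OF A _ continuous_on_id c] above_fun_calc_mult[OF A _ c continuous_on_id]
    by (simp_all add: above_fun_calc_ident[OF A])
  then show "A (fun_calc (\<lambda>t. 1 / t) A x) = x" "fun_calc (\<lambda>t. 1 / t) A (A x) = x"
    by (simp_all add: blinfun_eq_iff)
qed

text \<open>With \<open>u = L' x\<close> and \<open>v = K' x\<close>, nonnegativity of the form of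
  \<open>K\<close> at \<open>v - u\<close> reads
  \<open>0 \<le> ip x v - 2 * ip u x + ip (K u) u\<close>, and comparison with \<open>L\<close>
  bounds the last term by \<open>ip u x\<close>.\<close>

lemma inverse_antitone:
  fixes K L K' L' :: "'h::complex_hilbert_space \<Rightarrow>\<^sub>L 'h"
  assumes K: "self_adjoint K" "\<And>x. 0 \<le> ip (blinfun_apply K x) x" and le: "\<And>x. ip (blinfun_apply K x) x \<le> ip (L x) x"
    and K': "\<And>x. K (K' x) = x" and L': "\<And>x. blinfun_apply L (L' x) = x"
  shows "ip (L' x) x \<le> ip (K' x) x"
proof -
  define u where "u = L' x"
  define v where "v = K' x"
  have K'': "K v = x" and L'': "L u = x" by (simp_all add: u_def v_def K' L')
  have "ip (K u) v = ip u x" using self_adjoint_ip[OF K(1), of u v] K'' by simp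
  then have "ip (K (v - u)) (v - u) = ip x v - 2 * ip u x + ip (K u) u"
    by (simp add: blinfun.bilinear_simps ip_simps K'' ip_commute[of x u])
  moreover have "ip (K u) u \<le> ip u x" using le[of u] L'' by (simp add: ip_commute)
  ultimately show ?thesis using K(2)[of "v - u"] by (simp add: u_def v_def ip_commute)
qed

section \<open>Square roots and congruences of positive operators\<close>

abbreviation sqrt_op :: "('h::complex_hilbert_space \<Rightarrow>\<^sub>L 'h) \<Rightarrow> ('h \<Rightarrow>\<^sub>L 'h)" where
  "sqrt_op \<equiv> fun_calc sqrt"

abbreviation inv_sqrt_op :: "('h::complex_hilbert_space \<Rightarrow>\<^sub>L 'h) \<Rightarrow> ('h \<Rightarrow>\<^sub>L 'h)" where
  "inv_sqrt_op \<equiv> fun_calc (\<lambda>t. 1 / sqrt t)"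

lemma positive_sqrt_op:
  assumes A: "A \<in> operators_above {0..}"
  shows "sqrt_op A \<in> operators_above {0..}" "sqrt_op A (sqrt_op A x) = A x"
proof -
  have c: "continuous_on {0..} sqrt" by (auto intro!: continuous_intros)
  show "sqrt_op A \<in> operators_above {0..}" by (rule fun_calc_above[OF A _ c]) auto
  have "fun_calc (\<lambda>t. sqrt t * sqrt t) A = fun_calc (\<lambda>t. t) A"
    by (rule above_fun_calc_cong[OF A]) auto
  then show "sqrt_op A (sqrt_op A x) = A x"
    using above_fun_calc_mult[OF A _ c c] above_fun_calc_ident[OF A]
    by (metis blinfun_apply_blinfun_compose up_closed_Ici)
qed

context
  fixes A :: "'h::complex_hilbert_space \<Rightarrow>\<^sub>L 'h"
  assumes A: "A \<in> strictly_positive"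
begin

lemma sqrt_ops_above: "sqrt_op A \<in> strictly_positive" "inv_sqrt_op A \<in> strictly_positive"
  by (rule fun_calc_above[OF A]; auto intro!: continuous_intros)+

lemma sqrt_ops_self_adjoint: "self_adjoint (sqrt_op A)" "self_adjoint (inv_sqrt_op A)"
  using sqrt_ops_above above_self_adjoint by blast+

lemma sqrt_ops_apply:
  "sqrt_op A (sqrt_op A x) = A x" "sqrt_op A (inv_sqrt_op A x) = x" "inv_sqrt_op A (sqrt_op A x) = x"
  "A (inv_sqrt_op A x) = sqrt_op A x" "inv_sqrt_op A (A x) = sqrt_op A x"
proof -
  have c: "continuous_on {0<..} sqrt" "continuous_on {0<..} (\<lambda>t. 1 / sqrt t)"
    by (auto intro!: continuous_intros)
  have "fun_calc (\<lambda>t. sqrt t * sqrt t) A = fun_calc (\<lambda>t. t) A"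
    "fun_calc (\<lambda>t. sqrt t * (1 / sqrt t)) A = fun_calc (\<lambda>t. 1) A"
    "fun_calc (\<lambda>t. 1 / sqrt t * sqrt t) A = fun_calc (\<lambda>t. 1) A"
    by (rule above_fun_calc_cong[OF A]; simp)+
  then have "sqrt_op A o\<^sub>L sqrt_op A = A" "sqrt_op A o\<^sub>L inv_sqrt_op A = id_blinfun"
    "inv_sqrt_op A o\<^sub>L sqrt_op A = id_blinfun"
    using above_fun_calc_mult[OF A _ c(1) c(1)] above_fun_calc_mult[OF A _ c(1) c(2)]
      above_fun_calc_mult[OF A _ c(2) c(1)]
    by (simp_all add: above_fun_calc_ident[OF A] above_fun_calc_const[OF A])
  then show *: "sqrt_op A (sqrt_op A x) = A x" "sqrt_op A (inv_sqrt_op A x) = x" "inv_sqrt_op A (sqrt_op A x) = x" for x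
    by (simp_all add: blinfun_eq_iff)
  show "A (inv_sqrt_op A x) = sqrt_op A x" "inv_sqrt_op A (A x) = sqrt_op A x"
    by (simp_all add: *(2,3) flip: *(1))
qed

end

text \<open>A left inverse of \<open>S\<close> bounds \<open>norm x\<close> by a multiple of
  \<open>norm (S x)\<close>, which preserves a positive lower bound.\<close>

lemma sandwich_strictly_positive:
  fixes S S' Z :: "'h::complex_hilbert_space \<Rightarrow>\<^sub>L 'h"
  assumes S: "self_adjoint S" "\<And>x. blinfun_apply S' (blinfun_apply S x) = x" and Z: "Z \<in> strictly_positive"
  shows "S o\<^sub>L Z o\<^sub>L S \<in> strictly_positive"
proof -
  obtain m M where m: "0 < m" "m \<le> M" "Z \<in> operators_between m M" using Z by (auto elim!: operators_aboveE)
  define k where "k = norm S' + 1"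
  have k: "k > 0" by (simp add: k_def add_nonneg_pos)
  have ip: "ip ((S o\<^sub>L Z o\<^sub>L S) x) x = ip (Z (S x)) (S x)" for x by (simp add: self_adjoint_ip[OF S(1)])
  have "S o\<^sub>L Z o\<^sub>L S \<in> operators_between (m / k\<^sup>2) (M * (norm S)\<^sup>2)"
  proof (rule operators_betweenI)
    show "self_adjoint (S o\<^sub>L Z o\<^sub>L S)"
      by (rule self_adjoint_sandwich[OF S(1) operators_betweenD(1)[OF m(3)]])
    fix x
    have "norm x \<le> norm S' * norm (S x)" using norm_blinfun[of S' "S x"] by (simp add: S)
    also have "\<dots> \<le> k * norm (S x)" by (simp add: k_def mult_right_mono)
    finally have "(norm x)\<^sup>2 \<le> k\<^sup>2 * (norm (S x))\<^sup>2" by (metis power_mono norm_ge_zero power_mult_distrib)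
    then have "m / k\<^sup>2 * (norm x)\<^sup>2 \<le> m / k\<^sup>2 * (k\<^sup>2 * (norm (S x))\<^sup>2)"
      by (rule mult_left_mono) (use m in simp)
    also have "\<dots> = m * (norm (S x))\<^sup>2" using k by simp
    finally show "m / k\<^sup>2 * (norm x)\<^sup>2 \<le> ip ((S o\<^sub>L Z o\<^sub>L S) x) x"
      unfolding ip using operators_betweenD(2)[OF m(3), of "S x"] by linarith
    have "(norm (S x))\<^sup>2 \<le> (norm S)\<^sup>2 * (norm x)\<^sup>2"
      by (metis power_mono norm_ge_zero power_mult_distrib norm_blinfun)
    then have "M * (norm (S x))\<^sup>2 \<le> M * (norm S)\<^sup>2 * (norm x)\<^sup>2"
      using m by (simp add: mult_left_mono)
    then show "ip ((S o\<^sub>L Z o\<^sub>L S) x) x \<le> M * (norm S)\<^sup>2 * (norm x)\<^sup>2"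
      unfolding ip using operators_betweenD(3)[OF m(3), of "S x"] by linarith
  qed
  then show ?thesis by (rule operators_aboveI) (use m(1) k in simp)
qed

section \<open>Operator means on strictly positive operators\<close>

abbreviation mean_argument :: "('h::complex_hilbert_space \<Rightarrow>\<^sub>L 'h) \<Rightarrow> ('h \<Rightarrow>\<^sub>L 'h) \<Rightarrow> ('h \<Rightarrow>\<^sub>L 'h)" where
  "mean_argument A B \<equiv> inv_sqrt_op A o\<^sub>L B o\<^sub>L inv_sqrt_op A"

lemma mean_formula_apply:
  "blinfun_apply (mean_formula h A B) x = sqrt_op A (fun_calc h (mean_argument A B) (sqrt_op A x))"
  by (simp add: mean_formula_def Let_def)

context
  fixes A B :: "'h::complex_hilbert_space \<Rightarrow>\<^sub>L 'h"
  assumes A: "A \<in> strictly_positive" and B: "B \<in> strictly_positive"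
begin

lemma mean_argument_strictly_positive: "mean_argument A B \<in> strictly_positive"
  using sqrt_ops_self_adjoint(2)[OF A] sqrt_ops_apply(2)[OF A] B by (rule sandwich_strictly_positive)

lemma ip_mean_formula:
  "ip (mean_formula h A B x) x = ip (fun_calc h (mean_argument A B) (sqrt_op A x)) (sqrt_op A x)"
  by (simp add: mean_formula_apply self_adjoint_ip[OF sqrt_ops_self_adjoint(1)[OF A]])

lemma self_adjoint_mean_formula:
  assumes "continuous_on {0<..} h"
  shows "self_adjoint (mean_formula h A B)"
  unfolding mean_formula_def Let_def
  by (intro self_adjoint_sandwich sqrt_ops_self_adjoint(1)[OF A]
      fun_calc_self_adjoint_above[OF mean_argument_strictly_positive _ assms]) simp

lemma mean_formula_le:
  assumes "continuous_on {0<..} h" "continuous_on {0<..} k" "\<And>t. t > 0 \<Longrightarrow> h t \<le> k t"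
  shows "ip (mean_formula h A B x) x \<le> ip (mean_formula k A B x) x"
  unfolding ip_mean_formula
  by (rule above_fun_calc_le[OF mean_argument_strictly_positive _ assms(1,2)]) (use assms(3) in auto)

text \<open>Affine functions provide the comparison means: coefficients \<open>1 / 2\<close> give
  the arithmetic mean, coefficients 0 the lower bound 0.\<close>

lemma mean_formula_affine: "mean_formula (\<lambda>t. a + b * t) A B = a *\<^sub>R A + b *\<^sub>R B"
proof (rule blinfun_eqI)
  fix x
  note X = mean_argument_strictly_positive
  have "fun_calc (\<lambda>t. a + b * t) (mean_argument A B) = a *\<^sub>R id_blinfun + b *\<^sub>R mean_argument A B"
    using above_fun_calc_add[OF X, of "\<lambda>_. a" "\<lambda>t. b * t"] above_fun_calc_scaleR[OF X, of "\<lambda>t. t" b]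
    by (simp add: above_fun_calc_const[OF X] above_fun_calc_ident[OF X] continuous_on_mult_left continuous_on_id)
  then show "mean_formula (\<lambda>t. a + b * t) A B x = (a *\<^sub>R A + b *\<^sub>R B) x"
    by (simp add: mean_formula_apply blinfun.bilinear_simps sqrt_ops_apply[OF A])
qed

text \<open>\<open>V = (S A S)\<^sup>-\<^sup>1\<^sup>/\<^sup>2 S A\<^sup>1\<^sup>/\<^sup>2\<close> intertwines the arguments of \<open>h\<close> on the two sides.\<close>

lemma mean_formula_congruence:
  assumes h: "continuous_on {0<..} h"
    and S: "self_adjoint S" "\<And>x. blinfun_apply S' (S x) = x" "\<And>x. S (blinfun_apply S' x) = x"
  shows "mean_formula h (S o\<^sub>L A o\<^sub>L S) (S o\<^sub>L B o\<^sub>L S) = S o\<^sub>L mean_formula h A B o\<^sub>L S"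
proof (rule blinfun_eqI)
  fix x
  let ?A = "S o\<^sub>L A o\<^sub>L S" and ?B = "S o\<^sub>L B o\<^sub>L S"
  have A': "?A \<in> strictly_positive" and B': "?B \<in> strictly_positive"
    using sandwich_strictly_positive[OF S(1,2)] A B by auto
  let ?X = "mean_argument A B" and ?Y = "mean_argument ?A ?B"
  have X: "?X \<in> strictly_positive" by (rule mean_argument_strictly_positive)
  have Y: "?Y \<in> strictly_positive"
    using sqrt_ops_self_adjoint(2)[OF A'] sqrt_ops_apply(2)[OF A'] B' by (rule sandwich_strictly_positive)
  define V where "V = inv_sqrt_op ?A o\<^sub>L S o\<^sub>L sqrt_op A"
  \<comment> \<open>This is \<open>(S A S)^-1 S A = S^-1\<close>, which clears the two inverse
    square roots that meet in \<open>?Y o\<^sub>L V\<close>.\<close>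
  have inv: "inv_sqrt_op ?A (inv_sqrt_op ?A (S (A z))) = S' z" for z
  proof -
    have "S (A z) = sqrt_op ?A (sqrt_op ?A (S' z))"
      by (simp add: sqrt_ops_apply(1)[OF A'] S)
    then show ?thesis by (simp add: sqrt_ops_apply(3)[OF A'])
  qed
  have "V o\<^sub>L ?X = ?Y o\<^sub>L V"
  proof (rule blinfun_eqI)
    fix z
    have "sqrt_op A z = A (inv_sqrt_op A z)" by (simp add: sqrt_ops_apply[OF A])
    then have "(?Y o\<^sub>L V) z = inv_sqrt_op ?A (S (B (S (inv_sqrt_op ?A (inv_sqrt_op ?A (S (A (inv_sqrt_op A z))))))))"
      by (simp add: V_def)
    also have "\<dots> = inv_sqrt_op ?A (S (B (inv_sqrt_op A z)))" by (simp only: inv S)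
    also have "\<dots> = (V o\<^sub>L ?X) z" by (simp add: V_def sqrt_ops_apply[OF A])
    finally show "(V o\<^sub>L ?X) z = (?Y o\<^sub>L V) z" by simp
  qed
  moreover obtain m M where m: "m \<in> {0<..}" "?X \<in> operators_between m M" "?Y \<in> operators_between m M"
    using operators_above_common[OF X Y] by metis
  ultimately have "V o\<^sub>L fun_calc h ?X = fun_calc h ?Y o\<^sub>L V"
    using continuous_on_subinterval[OF up_closed_Ioi m(1) h] by (intro fun_calc_intertwine)
  then have Vh: "V (fun_calc h ?X z) = fun_calc h ?Y (V z)" for z by (simp add: blinfun_eq_iff)
  have V1: "sqrt_op ?A (V z) = S (sqrt_op A z)" for z by (simp add: V_def sqrt_ops_apply[OF A'])
  have V2: "V (sqrt_op A (S z)) = sqrt_op ?A z" for z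
  proof -
    have "V (sqrt_op A (S z)) = inv_sqrt_op ?A (?A z)" by (simp add: V_def sqrt_ops_apply[OF A])
    then show ?thesis by (simp only: sqrt_ops_apply(5)[OF A'])
  qed
  have "mean_formula h ?A ?B x = sqrt_op ?A (fun_calc h ?Y (V (sqrt_op A (S x))))"
    by (simp only: mean_formula_apply V2)
  also have "\<dots> = S (sqrt_op A (fun_calc h ?X (sqrt_op A (S x))))" by (simp only: Vh[symmetric] V1)
  finally show "mean_formula h ?A ?B x = (S o\<^sub>L mean_formula h A B o\<^sub>L S) x"
    by (simp add: mean_formula_apply)
qed

text \<open>Homogeneity is congruence by \<open>sqrt r\<close> times the identity.\<close>

lemma mean_formula_scaleR:
  assumes h: "continuous_on {0<..} h" and r: "r > 0"
  shows "mean_formula h (r *\<^sub>R A) (r *\<^sub>R B) = r *\<^sub>R mean_formula h A B"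
proof -
  have "mean_formula h ((sqrt r *\<^sub>R id_blinfun) o\<^sub>L A o\<^sub>L (sqrt r *\<^sub>R id_blinfun))
      ((sqrt r *\<^sub>R id_blinfun) o\<^sub>L B o\<^sub>L (sqrt r *\<^sub>R id_blinfun))
    = (sqrt r *\<^sub>R id_blinfun) o\<^sub>L mean_formula h A B o\<^sub>L (sqrt r *\<^sub>R id_blinfun)"
    by (rule mean_formula_congruence[OF h, where S' = "(1 / sqrt r) *\<^sub>R id_blinfun"])
      (use r in \<open>auto simp: blinfun.bilinear_simps\<close>)
  then show ?thesis using r by (simp add: blinfun_compose_simps)
qed

end

lemma mean_formula_scalars:
  assumes "a > 0"
  shows "mean_formula h (a *\<^sub>R id_blinfun) (b *\<^sub>R id_blinfun) = (a * h (b / a)) *\<^sub>R id_blinfun"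
  using assms
  by (simp add: mean_formula_def Let_def fun_calc_scaleR_id blinfun_compose_simps)

section \<open>Strong limits\<close>

lemma limitin_strong_operator_topology_iff:
  "limitin strong_operator_topology F L G \<longleftrightarrow>
    (\<forall>x. ((\<lambda>i. blinfun_apply (F i) x) \<longlongrightarrow> blinfun_apply L x) G)"
proof (intro iffI allI)
  fix x assume "limitin strong_operator_topology F L G"
  from continuous_map_limit[OF strong_operator_topology_continuous_evaluation this]
  show "((\<lambda>i. F i x) \<longlongrightarrow> L x) G" by (simp add: comp_def)
next
  assume lim: "\<forall>x. ((\<lambda>i. F i x) \<longlongrightarrow> L x) G"
  have "limitin (product_topology (\<lambda>_. euclidean) UNIV) (\<lambda>i. blinfun_apply (F i)) (blinfun_apply L) G"
    using lim by (simp add: limitin_componentwise)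
  then have "((\<lambda>i. blinfun_apply (F i)) \<longlongrightarrow> blinfun_apply L) G"
    by (simp add: euclidean_product_topology)
  then show "limitin strong_operator_topology F L G"
    unfolding limitin_def strong_operator_topology_topspace
    by (auto simp: strong_operator_topology_def openin_pullback_topology topological_tendstoD)
qed

lemma strong_limit_unique:
  assumes "\<forall>x. ((\<lambda>i. blinfun_apply (F i) x) \<longlongrightarrow> blinfun_apply L x) G" "G \<noteq> bot"
  shows "(THE L. limitin strong_operator_topology F L G) = L"
  unfolding limitin_strong_operator_topology_iff
  using assms by (intro the_equality blinfun_eqI) (auto intro: tendsto_unique)

text \<open>Vigier's theorem: by \<open>\<parallel>G x\<parallel>\<^sup>2 \<le> \<parallel>G\<parallel> \<langle>G x, x\<rangle>\<close> for \<open>G \<ge> 0\<close>, convergence of the quadratic forms is enough.\<close>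

lemma monotone_strong_limit:
  fixes F :: "real \<Rightarrow> ('h::complex_hilbert_space \<Rightarrow>\<^sub>L 'h)"
  assumes sa: "\<And>\<epsilon>. \<epsilon> > 0 \<Longrightarrow> self_adjoint (F \<epsilon>)"
    and pos: "\<And>\<epsilon> x. \<epsilon> > 0 \<Longrightarrow> 0 \<le> ip (F \<epsilon> x) x"
    and mono: "\<And>\<epsilon> \<delta> x. 0 < \<epsilon> \<Longrightarrow> \<epsilon> \<le> \<delta> \<Longrightarrow> ip (F \<epsilon> x) x \<le> ip (F \<delta> x) x"
  obtains L where "self_adjoint L" "\<forall>x. ((\<lambda>\<epsilon>. F \<epsilon> x) \<longlongrightarrow> L x) (at_right 0)"
proof -
  \<comment> \<open>The forms increase with the parameter, so the norm at parameter 1 controls all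
    of them on \<open>(0, 1]\<close>.\<close>
  define K where "K = norm (F 1)"
  have F1: "ip (F \<delta> x) x \<le> K * (norm x)\<^sup>2" if "0 < \<delta>" "\<delta> \<le> 1" for \<delta> x
    using mono[OF that, of x] ip_le_norm[of "F 1" x] by (simp add: K_def)
  have diff: "(norm (F \<delta> x - F \<epsilon> x))\<^sup>2 \<le> K * (ip (F \<delta> x) x - ip (F \<epsilon> x) x)"
    if "0 < \<epsilon>" "\<epsilon> \<le> \<delta>" "\<delta> \<le> 1" for \<epsilon> \<delta> x
  proof -
    have "(norm ((F \<delta> - F \<epsilon>) x))\<^sup>2 \<le> K * ip ((F \<delta> - F \<epsilon>) x) x"
    proof (rule positive_norm_le)
      show "self_adjoint (F \<delta> - F \<epsilon>)" using that sa by simp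
      show "0 \<le> ip ((F \<delta> - F \<epsilon>) x) x" for x
        using mono[OF that(1,2)] by (simp add: blinfun.bilinear_simps ip_simps)
      show "ip ((F \<delta> - F \<epsilon>) x) x \<le> K * (norm x)\<^sup>2" for x
        using F1[of \<delta> x] pos[of \<epsilon> x] that by (simp add: blinfun.bilinear_simps ip_simps)
    qed
    then show ?thesis by (simp add: blinfun.bilinear_simps ip_simps)
  qed
  have cauchy: "\<exists>d>0. \<forall>\<epsilon> \<delta>. 0 < \<epsilon> \<longrightarrow> \<epsilon> \<le> d \<longrightarrow> 0 < \<delta> \<longrightarrow> \<delta> \<le> d \<longrightarrow> norm (F \<delta> x - F \<epsilon> x) < e"
    if "e > 0" for e x
  proof -
    \<comment> \<open>By monotonicity the infimum is the limit of the forms, so they vary by at most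
      \<open>\<eta>\<close> near 0; \<open>\<eta>\<close> is chosen such that
      \<open>K * \<eta> < e\<^sup>2\<close>, with a 1 in the denominator to cover
      \<open>K = 0\<close>.\<close>
    define I where "I = Inf ((\<lambda>\<epsilon>. ip (F \<epsilon> x) x) ` {0<..})"
    have bdd: "bdd_below ((\<lambda>\<epsilon>. ip (F \<epsilon> x) x) ` {0<..})"
      using pos by (intro bdd_belowI[of _ 0]) auto
    define \<eta> where "\<eta> = e\<^sup>2 / (K + 1)"
    have K0: "K \<ge> 0" by (simp add: K_def)
    then have \<eta>: "\<eta> > 0" "K * \<eta> < e\<^sup>2" using that by (auto simp: \<eta>_def field_simps add_pos_nonneg)
    have "\<exists>d0>0. ip (F d0 x) x < I + \<eta>"
      using cInf_lessD[of "(\<lambda>\<epsilon>. ip (F \<epsilon> x) x) ` {0<..}" "I + \<eta>"] \<eta> by (auto simp: I_def)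
    then obtain d0 where d0: "d0 > 0" "ip (F d0 x) x < I + \<eta>" by blast
    define d where "d = min d0 1"
    have d: "0 < d" "d \<le> 1" "d \<le> d0" using d0(1) by (auto simp: d_def)
    have le: "norm (F \<delta> x - F \<epsilon> x) < e" if "0 < \<epsilon>" "\<epsilon> \<le> \<delta>" "\<delta> \<le> d" for \<epsilon> \<delta>
    proof -
      have "I \<le> ip (F \<epsilon> x) x" unfolding I_def by (rule cInf_lower[OF _ bdd]) (use that in auto)
      moreover have "ip (F \<delta> x) x \<le> ip (F d0 x) x" using that d by (intro mono) auto
      ultimately have "ip (F \<delta> x) x - ip (F \<epsilon> x) x \<le> \<eta>" using d0 by linarith
      then have "K * (ip (F \<delta> x) x - ip (F \<epsilon> x) x) \<le> K * \<eta>" using K0 by (rule mult_left_mono)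
      then have "(norm (F \<delta> x - F \<epsilon> x))\<^sup>2 < e\<^sup>2"
        using diff[OF that(1,2), of x] that d \<eta> by linarith
      then show ?thesis using \<open>e > 0\<close> by (simp add: power_less_imp_less_base)
    qed
    show ?thesis
    proof (intro exI conjI allI impI)
      show "d > 0" by (rule d)
      fix \<epsilon> \<delta> assume "0 < \<epsilon>" "\<epsilon> \<le> d" "0 < \<delta>" "\<delta> \<le> d"
      then show "norm (F \<delta> x - F \<epsilon> x) < e"
        using le[of \<epsilon> \<delta>] le[of \<delta> \<epsilon>] by (cases "\<epsilon> \<le> \<delta>") (auto simp: norm_minus_commute)
    qed
  qed
  have "\<exists>l. ((\<lambda>\<epsilon>. F \<epsilon> x) \<longlongrightarrow> l) (at_right 0)" for x
  proof -
    define u where "u = (\<lambda>n. F (1 / real (Suc n)) x)"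
    have small: "\<exists>N. \<forall>n\<ge>N. 1 / real (Suc n) \<le> d" if "d > 0" for d :: real
    proof -
      have "\<forall>\<^sub>F n in sequentially. 1 / real (Suc n) \<le> d" using that by real_asymp
      then show ?thesis by (simp add: eventually_sequentially)
    qed
    have "Cauchy u"
    proof (rule metric_CauchyI)
      fix e :: real assume "e > 0"
      from cauchy[OF this, of x] obtain d where "d > 0"
        and d: "\<And>\<epsilon> \<delta>. 0 < \<epsilon> \<Longrightarrow> \<epsilon> \<le> d \<Longrightarrow> 0 < \<delta> \<Longrightarrow> \<delta> \<le> d \<Longrightarrow> norm (F \<delta> x - F \<epsilon> x) < e" by blast
      from small[OF this(1)] show "\<exists>N. \<forall>m\<ge>N. \<forall>n\<ge>N. dist (u m) (u n) < e"
        unfolding u_def dist_norm by (meson d zero_less_divide_1_iff of_nat_0_less_iff zero_less_Suc)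
    qed
    then obtain l where l: "u \<longlonglongrightarrow> l" using Cauchy_convergent convergent_def by blast
    have "((\<lambda>\<epsilon>. F \<epsilon> x) \<longlongrightarrow> l) (at_right 0)"
    proof (rule tendstoI)
      fix e :: real assume "e > 0"
      then have "e / 2 > 0" by simp
      from cauchy[OF this, of x] obtain d where "d > 0"
        and d: "\<And>\<epsilon> \<delta>. 0 < \<epsilon> \<Longrightarrow> \<epsilon> \<le> d \<Longrightarrow> 0 < \<delta> \<Longrightarrow> \<delta> \<le> d \<Longrightarrow> norm (F \<delta> x - F \<epsilon> x) < e / 2" by blast
      have "norm (F \<epsilon> x - l) < e" if "0 < \<epsilon>" "\<epsilon> < d" for \<epsilon>
      proof -
        obtain N where N: "\<And>n. n \<ge> N \<Longrightarrow> 1 / real (Suc n) \<le> d" using small[OF \<open>d > 0\<close>] by blast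
        have "norm (F \<epsilon> x - u n) \<le> e / 2" if "n \<ge> N" for n
          unfolding u_def using d[of "1 / real (Suc n)" \<epsilon>] N[OF that] \<open>0 < \<epsilon>\<close> \<open>\<epsilon> < d\<close> by fastforce
        then have "norm (F \<epsilon> x - l) \<le> e / 2"
          by (intro LIMSEQ_le_const2[OF tendsto_norm[OF tendsto_diff[OF tendsto_const l]]]) blast
        then show ?thesis using \<open>e > 0\<close> by linarith
      qed
      then show "\<forall>\<^sub>F \<epsilon> in at_right 0. dist (F \<epsilon> x) l < e"
        unfolding eventually_at_right_field dist_norm using \<open>d > 0\<close> by blast
    qed
    then show ?thesis by blast
  qed
  then obtain l where l: "\<And>x. ((\<lambda>\<epsilon>. F \<epsilon> x) \<longlongrightarrow> l x) (at_right 0)" by metis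
  have ev: "\<forall>\<^sub>F \<epsilon> in at_right 0. 0 < \<epsilon> \<and> \<epsilon> \<le> (1::real)"
    unfolding eventually_at_right_field by (intro exI[of _ 1]) auto
  have bl: "bounded_linear l"
  proof (rule bounded_linear_intro[of _ K])
    show "l (x + y) = l x + l y" for x y
      using tendsto_unique[OF _ l[of "x + y"]] tendsto_add[OF l[of x] l[of y]]
      by (simp add: blinfun.add_right)
    show "l (r *\<^sub>R x) = r *\<^sub>R l x" for r x
      using tendsto_unique[OF _ l[of "r *\<^sub>R x"]] tendsto_scaleR[OF tendsto_const l[of x], of r]
      by (simp add: blinfun.scaleR_right)
    show "norm (l x) \<le> norm x * K" for x
    proof (rule tendsto_upperbound[OF tendsto_norm[OF l]])
      show "\<forall>\<^sub>F \<epsilon> in at_right 0. norm (F \<epsilon> x) \<le> norm x * K"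
        using ev
      proof eventually_elim
        case (elim \<epsilon>)
        have "(norm (F \<epsilon> x))\<^sup>2 \<le> K * ip (F \<epsilon> x) x"
          using elim by (intro positive_norm_le sa pos F1) auto
        also have "\<dots> \<le> K * (K * (norm x)\<^sup>2)"
          using elim by (intro mult_left_mono F1) (auto simp: K_def)
        also have "\<dots> = (norm x * K)\<^sup>2" by (simp add: power2_eq_square)
        finally show ?case by (rule power2_le_imp_le) (simp add: K_def)
      qed
    qed simp
  qed
  define L where "L = Blinfun l"
  have L: "blinfun_apply L = l" unfolding L_def by (rule bounded_linear_Blinfun_apply[OF bl])
  have "self_adjoint L"
    unfolding self_adjoint_def L
  proof (intro conjI allI bounded_operatorsI)
    fix c x y
    have "\<forall>\<^sub>F \<epsilon> in at_right 0. c *\<^sub>C F \<epsilon> x = F \<epsilon> (c *\<^sub>C x)"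
      using ev by eventually_elim (simp add: bounded_operatorsD[OF self_adjoint_bounded[OF sa]])
    from Lim_transform_eventually[OF bounded_linear.tendsto[OF bounded_linear_scaleC_right l] this]
    show "L (c *\<^sub>C x) = c *\<^sub>C L x"
      unfolding L by (intro tendsto_unique[OF _ l]) auto
    have "\<forall>\<^sub>F \<epsilon> in at_right 0. ip x (F \<epsilon> y) = ip (F \<epsilon> x) y"
      using ev by eventually_elim (simp add: self_adjoint_ip[OF sa])
    from Lim_transform_eventually[OF tendsto_ip_right[OF l] this]
    show "ip (l x) y = ip x (l y)"
      by (intro tendsto_unique[OF _ tendsto_ip_left[OF l]]) auto
  qed
  then show thesis using that[of L] l by (simp add: L)
qed

section \<open>Symmetric operator means\<close>

text \<open>The point 1 is the combination of \<open>1 / t\<close> and \<open>t\<close> with weights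
  \<open>t / (1 + t)\<close> and \<open>1 / (1 + t)\<close>. By symmetry both contribute equally, so
  concavity gives \<open>2 * k t / (1 + t) \<le> k 1\<close>.\<close>

lemma symmetric_concave_le_arithmetic:
  fixes k :: "real \<Rightarrow> real"
  assumes concave: "\<And>a b l. 0 < a \<Longrightarrow> 0 < b \<Longrightarrow> 0 \<le> l \<Longrightarrow> l \<le> 1 \<Longrightarrow>
      (1 - l) * k a + l * k b \<le> k ((1 - l) * a + l * b)"
    and "k 1 = 1" and sym: "\<And>t. t > 0 \<Longrightarrow> k t = t * k (1 / t)" and t: "t > 0"
  shows "k t \<le> (1 + t) / 2"
proof -
  define l where "l = 1 / (1 + t)"
  have l: "0 \<le> l" "l \<le> 1" "1 - l = t / (1 + t)" using t by (auto simp: l_def field_simps)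
  have "(1 - l) * (1 / t) + l * t = 1" unfolding l(3) using t by (simp add: l_def field_simps)
  then have "(1 - l) * k (1 / t) + l * k t \<le> 1"
    using concave[of "1 / t" t l] t l(1,2) \<open>k 1 = 1\<close> by simp
  moreover have "(1 - l) * k (1 / t) = l * k t"
    unfolding l(3) sym[OF t] by (simp add: l_def)
  ultimately have "2 * (l * k t) \<le> 1" by linarith
  then have "(1 + t) * (2 * (l * k t)) \<le> (1 + t) * 1" using t by (intro mult_left_mono) auto
  moreover have "(1 + t) * (2 * (l * k t)) = 2 * k t" using t by (simp add: l_def)
  ultimately show ?thesis by linarith
qed

lemma strictly_positive_subset: "strictly_positive \<subseteq> operators_above {0..}"
  by (rule operators_above_mono) auto

lemma add_id_strictly_positive:
  assumes "A \<in> operators_above {0..}" "\<epsilon> > 0"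
  shows "A + \<epsilon> *\<^sub>R id_blinfun \<in> strictly_positive"
proof -
  obtain m M where m: "0 \<le> m" "A \<in> operators_between m M" using assms(1) by (auto simp: operators_above_def)
  show ?thesis
    by (rule operators_aboveI[OF operators_between_add_id[OF m(2)]]) (use m assms in simp)
qed

lemma fun_calc_inverse_antitone:
  assumes "A \<in> strictly_positive" "B \<in> strictly_positive" "\<And>x. ip (blinfun_apply A x) x \<le> ip (blinfun_apply B x) x"
  shows "ip (fun_calc (\<lambda>t. 1 / t) B x) x \<le> ip (fun_calc (\<lambda>t. 1 / t) A x) x"
proof (rule inverse_antitone[of A B])
  have "A \<in> positive_operators" using assms(1) strictly_positive_subset positive_operators_eq by blast
  then show "self_adjoint A" "0 \<le> ip (A x) x" for x by (simp_all add: positive_operators_iff)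
qed (use assms strictly_positive_inverse in auto)

lemma mean_formula_cong:
  assumes "A \<in> strictly_positive" "B \<in> strictly_positive" "continuous_on {0<..} k"
    and "\<And>t. t > 0 \<Longrightarrow> h t = k t"
  shows "mean_formula h A B = mean_formula k A B"
  using above_fun_calc_cong[OF mean_argument_strictly_positive[OF assms(1,2)] _ assms(3), of h] assms(4)
  by (simp add: mean_formula_def)

text \<open>Used in contrapositive form: a mean that differs from \<open>\<triangledown>\<close>
  somewhere, possibly at singular operators, has \<open>h t \<noteq> (1 + t) / 2\<close> for some
  \<open>t > 0\<close>. Regularization adds exactly \<open>\<epsilon>\<close> times the identity to
  the arithmetic mean.\<close>

lemma mean_of_arithmetic:
  assumes h: "\<And>t. t > 0 \<Longrightarrow> h t = (1 + t) / 2"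
    and A: "A \<in> operators_above {0..}" and B: "B \<in> operators_above {0..}"
  shows "mean_of h A B = A \<triangledown> B"
proof -
  have formula: "mean_formula h C E = C \<triangledown> E" if "C \<in> strictly_positive" "E \<in> strictly_positive" for C E :: "'a \<Rightarrow>\<^sub>L 'a"
  proof -
    have "mean_formula h C E = mean_formula (\<lambda>t. 1 / 2 + 1 / 2 * t) C E"
      by (rule mean_formula_cong[OF that]) (auto intro!: continuous_intros simp: h)
    then show ?thesis
      using mean_formula_affine[OF that, of "1 / 2" "1 / 2"] by (simp add: arithmetic_mean_def scaleR_add_right)
  qed
  have lim: "((\<lambda>\<epsilon>. mean_formula h (A + \<epsilon> *\<^sub>R id_blinfun) (B + \<epsilon> *\<^sub>R id_blinfun) x) \<longlongrightarrow> (A \<triangledown> B) x) (at_right 0)" for x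
  proof (rule Lim_transform_eventually)
    have "((\<lambda>\<epsilon>::real. (A \<triangledown> B) x + \<epsilon> *\<^sub>R x) \<longlongrightarrow> (A \<triangledown> B) x + 0 *\<^sub>R x) (at_right 0)"
      by (intro tendsto_intros)
    then show "((\<lambda>\<epsilon>::real. (A \<triangledown> B) x + \<epsilon> *\<^sub>R x) \<longlongrightarrow> (A \<triangledown> B) x) (at_right 0)" by simp
    have "(A \<triangledown> B) x + \<epsilon> *\<^sub>R x = mean_formula h (A + \<epsilon> *\<^sub>R id_blinfun) (B + \<epsilon> *\<^sub>R id_blinfun) x"
      if "\<epsilon> > 0" for \<epsilon>
    proof -
      have "(1 / 2) *\<^sub>R (\<epsilon> *\<^sub>R x) + (1 / 2) *\<^sub>R (\<epsilon> *\<^sub>R x) = \<epsilon> *\<^sub>R x"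
        by (simp flip: scaleR_add_left)
      then show ?thesis
        using formula[OF add_id_strictly_positive[OF A that] add_id_strictly_positive[OF B that]]
        by (simp add: arithmetic_mean_def blinfun.bilinear_simps scaleR_add_right)
    qed
    then show "\<forall>\<^sub>F \<epsilon> in at_right 0. (A \<triangledown> B) x + \<epsilon> *\<^sub>R x
        = mean_formula h (A + \<epsilon> *\<^sub>R id_blinfun) (B + \<epsilon> *\<^sub>R id_blinfun) x"
      unfolding eventually_at_right_field by (intro exI[of _ 1]) auto
  qed
  show ?thesis
  proof (cases "A \<in> strictly_positive \<and> B \<in> strictly_positive")
    case True
    then show ?thesis by (simp add: mean_of_def positive_invertible_operators_eq formula)
  next
    case False
    show ?thesis
      unfolding mean_of_def positive_invertible_operators_eq if_not_P[OF False]
      by (rule strong_limit_unique) (use lim in auto)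
  qed
qed

section \<open>The function of a symmetric mean and comparison of means\<close>

context
  fixes h :: "real \<Rightarrow> real" and V1 V2 W1 W2 :: "'h::complex_hilbert_space \<Rightarrow>\<^sub>L 'h" and w :: 'h
  assumes D: "doubling V1 V2 W1 W2" and nontrivial: "w \<noteq> 0"
    and h_cont: "continuous_on {0..} h" and h_nonneg: "\<forall>t\<ge>0. 0 \<le> h t" and h_1: "h 1 = 1"
    and h_op_mono: "operator_monotone_on (positive_operators :: ('h \<Rightarrow>\<^sub>L 'h) set) h"
    and h_commute: "\<forall>A\<in>positive_invertible_operators. \<forall>B\<in>positive_invertible_operators.
      mean_formula h A B = mean_formula h B (A :: 'h \<Rightarrow>\<^sub>L 'h)"
begin

lemma mean_cont: "continuous_on {0<..} h"
  using h_cont by (rule continuous_on_subset) auto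

text \<open>Commutativity is tested on the identity and \<open>t\<close> times the identity; the
  nonzero vector \<open>w\<close> turns the operator equation into a numerical one.\<close>

lemma mean_sym: "t > 0 \<Longrightarrow> h t = t * h (1 / t)"
proof -
  assume t: "t > 0"
  have "(1::real) *\<^sub>R id_blinfun \<in> (strictly_positive :: ('h \<Rightarrow>\<^sub>L 'h) set)"
    "t *\<^sub>R id_blinfun \<in> (strictly_positive :: ('h \<Rightarrow>\<^sub>L 'h) set)"
    by (rule operators_aboveI[OF scaleR_id_between]; use t in simp)+
  then have "mean_formula h (1 *\<^sub>R id_blinfun) (t *\<^sub>R id_blinfun) =
      mean_formula h (t *\<^sub>R id_blinfun) (1 *\<^sub>R id_blinfun :: 'h \<Rightarrow>\<^sub>L 'h)"
    using h_commute unfolding positive_invertible_operators_eq by blast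
  then have "(1 * h (t / 1)) *\<^sub>R id_blinfun = (t * h (1 / t)) *\<^sub>R (id_blinfun :: 'h \<Rightarrow>\<^sub>L 'h)"
    unfolding mean_formula_scalars[OF zero_less_one] mean_formula_scalars[OF t] .
  from arg_cong[where f = "\<lambda>T. blinfun_apply T w", OF this]
  show ?thesis using nontrivial by (simp add: blinfun.bilinear_simps)
qed

lemma mean_op_mono: "operator_monotone_on (operators_above {0..} :: ('h \<Rightarrow>\<^sub>L 'h) set) h"
  using h_op_mono by (simp add: positive_operators_eq)

lemma mean_concave:
  "0 \<le> a \<Longrightarrow> 0 \<le> b \<Longrightarrow> 0 \<le> l \<Longrightarrow> l \<le> 1 \<Longrightarrow> (1 - l) * h a + l * h b \<le> h ((1 - l) * a + l * b)"
  using operator_monotone_imp_concave_real[OF D mean_op_mono _ h_cont nontrivial] by simp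

text \<open>On \<open>(0, 1]\<close> concavity between 0 and 1 gives \<open>t \<le> h t\<close>;
  symmetry carries positivity over to \<open>t > 1\<close>.\<close>

lemma mean_pos: "t > 0 \<Longrightarrow> h t > 0"
proof -
  have small: "h t > 0" if t: "0 < t" "t \<le> 1" for t
  proof -
    have "(1 - t) * h 0 + t * h 1 \<le> h ((1 - t) * 0 + t * 1)" by (rule mean_concave) (use t in auto)
    moreover have "(1 - t) * h 0 \<ge> 0" using t h_nonneg by simp
    ultimately show ?thesis using t h_1 by simp
  qed
  assume "t > 0"
  then show "h t > 0" using small[of t] small[of "1 / t"] mean_sym[of t] by (cases "t \<le> 1") auto
qed

lemma mean_le: "t > 0 \<Longrightarrow> h t \<le> (1 + t) / 2"
  by (rule symmetric_concave_le_arithmetic[OF mean_concave h_1 mean_sym]) auto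

text \<open>The adjoint \<open>1 / h(1/t)\<close> is again operator monotone and symmetric, hence also below the
  arithmetic mean.\<close>

lemma mean_ge: "t > 0 \<Longrightarrow> 2 * t / (1 + t) \<le> h t"
proof -
  define g where "g = (\<lambda>t. h (1 / t))"
  define k where "k = (\<lambda>t. 1 / g t)"
  have inv: "continuous_on {0<..} (\<lambda>t::real. 1 / t)" "(\<lambda>t::real. 1 / t) ` {0<..} \<subseteq> {0<..}"
    by (auto intro!: continuous_intros)
  have g: "continuous_on {0<..} g" "g ` {0<..} \<subseteq> {0<..}"
    unfolding g_def using mean_pos
    by (auto intro!: continuous_on_compose2[OF mean_cont inv(1)])
  have k: "continuous_on {0<..} k" unfolding k_def
    by (rule continuous_on_compose2[OF inv(1) g(1,2)])
  \<comment> \<open>Each of the two reciprocals reverses the order, so \<open>k\<close> inherits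
    monotonicity from \<open>h\<close>.\<close>
  have "operator_monotone_on (strictly_positive :: ('h \<Rightarrow>\<^sub>L 'h) set) k"
    unfolding operator_monotone_on_def
  proof (intro ballI impI)
    fix A B :: "'h \<Rightarrow>\<^sub>L 'h"
    assume A: "A \<in> strictly_positive" and B: "B \<in> strictly_positive" and "B \<le>\<^sub>L A"
    then have le: "ip (B x) x \<le> ip (A x) x" for x by (intro loewner_le_ip)
    note inverse_above = strictly_positive_inverse(1)[THEN subsetD[OF strictly_positive_subset]]
    have gk: "fun_calc g C = fun_calc h (fun_calc (\<lambda>t. 1 / t) C)"
      "fun_calc k C = fun_calc (\<lambda>t. 1 / t) (fun_calc g C)" "fun_calc g C \<in> strictly_positive"
      if "C \<in> strictly_positive" for C :: "'h \<Rightarrow>\<^sub>L 'h"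
      using above_fun_calc_compose[OF that _ inv _ mean_cont] above_fun_calc_compose[OF that _ g _ inv(1)]
        fun_calc_above[OF that _ g] by (simp_all add: g_def k_def)
    have "ip (fun_calc g A x) x \<le> ip (fun_calc g B x) x" for x
      unfolding gk(1)[OF A] gk(1)[OF B]
      by (intro operator_monotoneD[OF mean_op_mono] inverse_above A B fun_calc_inverse_antitone le)
    then have "ip (fun_calc k B x) x \<le> ip (fun_calc k A x) x" for x
      unfolding gk(2)[OF A] gk(2)[OF B] by (intro fun_calc_inverse_antitone gk(3) A B)
    then show "fun_calc k B \<le>\<^sub>L fun_calc k A"
      using fun_calc_self_adjoint_above[OF A up_closed_Ioi k] fun_calc_self_adjoint_above[OF B up_closed_Ioi k]
      by (simp add: loewner_le_iff)
  qed
  from operator_monotone_imp_concave_real[OF D this _ k nontrivial]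
  have concave: "(1 - l) * k a + l * k b \<le> k ((1 - l) * a + l * b)"
    if "0 < a" "0 < b" "0 \<le> l" "l \<le> 1" for a b l using that by simp
  have sym: "k t = t * k (1 / t)" if "t > 0" for t
    using mean_sym[OF that] that by (simp add: k_def g_def)
  assume t: "t > 0"
  have "k (1 / t) \<le> (1 + 1 / t) / 2"
    by (rule symmetric_concave_le_arithmetic[OF concave _ sym]) (use t h_1 in \<open>auto simp: k_def g_def\<close>)
  then have "1 / h t \<le> (1 + t) / (2 * t)" using t by (simp add: k_def g_def field_simps)
  then show ?thesis using mean_pos[OF t] t by (simp add: field_simps)
qed

lemma mean_formula_mono_right:
  fixes A B B' :: "'h \<Rightarrow>\<^sub>L 'h"
  assumes A: "A \<in> strictly_positive" and B: "B \<in> strictly_positive" and B': "B' \<in> strictly_positive"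
    and le: "\<And>x. ip (B x) x \<le> ip (B' x) x"
  shows "ip (mean_formula h A B x) x \<le> ip (mean_formula h A B' x) x"
  unfolding ip_mean_formula[OF A B] ip_mean_formula[OF A B']
proof (rule operator_monotoneD[OF mean_op_mono])
  show "mean_argument A B \<in> operators_above {0..}" "mean_argument A B' \<in> operators_above {0..}"
    using mean_argument_strictly_positive[OF A] B B' strictly_positive_subset by blast+
  show "ip (mean_argument A B x) x \<le> ip (mean_argument A B' x) x" for x
    by (simp add: self_adjoint_ip[OF sqrt_ops_self_adjoint(2)[OF A]] le)
qed

text \<open>The formula is visibly monotone only in its second argument; commutativity gives the
  first.\<close>

lemma mean_formula_mono:
  fixes A A' B B' :: "'h \<Rightarrow>\<^sub>L 'h"
  assumes A: "A \<in> strictly_positive" "A' \<in> strictly_positive" and B: "B \<in> strictly_positive" "B' \<in> strictly_positive"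
    and le: "\<And>x. ip (A x) x \<le> ip (A' x) x" "\<And>x. ip (B x) x \<le> ip (B' x) x"
  shows "ip (mean_formula h A B x) x \<le> ip (mean_formula h A' B' x) x"
proof -
  have "ip (mean_formula h A B x) x \<le> ip (mean_formula h A B' x) x"
    by (rule mean_formula_mono_right[OF A(1) B le(2)])
  also have "\<dots> = ip (mean_formula h B' A x) x"
    using h_commute A(1) B(2) by (simp add: positive_invertible_operators_eq)
  also have "\<dots> \<le> ip (mean_formula h B' A' x) x"
    by (rule mean_formula_mono_right[OF B(2) A le(1)])
  also have "\<dots> = ip (mean_formula h A' B' x) x"
    using h_commute A(2) B(2) by (simp add: positive_invertible_operators_eq)
  finally show ?thesis .
qed

lemma mean_formula_nonneg:
  fixes A B :: "'h \<Rightarrow>\<^sub>L 'h"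
  assumes A: "A \<in> strictly_positive" and B: "B \<in> strictly_positive"
  shows "0 \<le> ip (mean_formula h A B x) x"
proof -
  have "ip (mean_formula (\<lambda>t. 0 + 0 * t) A B x) x \<le> ip (mean_formula h A B x) x"
    by (rule mean_formula_le[OF A B _ mean_cont]) (use h_nonneg in \<open>auto intro!: continuous_intros\<close>)
  then show ?thesis by (simp only: mean_formula_affine[OF A B]) (simp add: blinfun.bilinear_simps)
qed

lemma mean_formula_le_arithmetic:
  fixes A B :: "'h \<Rightarrow>\<^sub>L 'h"
  assumes A: "A \<in> strictly_positive" and B: "B \<in> strictly_positive"
  shows "ip (mean_formula h A B x) x \<le> (ip (A x) x + ip (B x) x) / 2"
proof -
  have "ip (mean_formula h A B x) x \<le> ip (mean_formula (\<lambda>t. 1 / 2 + 1 / 2 * t) A B x) x"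
    by (rule mean_formula_le[OF A B mean_cont])
      (use mean_le in \<open>auto intro!: continuous_intros simp: add_divide_distrib\<close>)
  then show ?thesis
    by (simp only: mean_formula_affine[OF A B]) (simp add: blinfun.bilinear_simps ip_simps)
qed

text \<open>The harmonic mean is \<open>R \<phi>(X) R\<close> with \<open>\<phi>(t) = 2 t / (1 + t)\<close>, which inverts
  \<open>(A\<^sup>-\<^sup>1 + B\<^sup>-\<^sup>1) / 2\<close>.\<close>

lemma harmonic_le_mean_formula:
  fixes A B E :: "'h \<Rightarrow>\<^sub>L 'h"
  assumes A: "A \<in> strictly_positive" and B: "B \<in> strictly_positive" and E: "E \<in> strictly_positive"
    and le: "\<And>x. (ip (fun_calc (\<lambda>t. 1 / t) A x) x + ip (fun_calc (\<lambda>t. 1 / t) B x) x) / 2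
      \<le> ip (fun_calc (\<lambda>t. 1 / t) E x) x"
  shows "ip (E x) x \<le> ip (mean_formula h A B x) x"
proof -
  define \<phi> :: "real \<Rightarrow> real" where "\<phi> = (\<lambda>t. 2 * t / (1 + t))"
  have \<phi>: "continuous_on {0<..} \<phi>" unfolding \<phi>_def by (auto intro!: continuous_intros)
  have inv: "continuous_on {0<..} (\<lambda>t::real. 1 / t)" by (auto intro!: continuous_intros)
  let ?X = "mean_argument A B" and ?H = "mean_formula \<phi> A B"
  define K where "K = (1 / 2) *\<^sub>R (fun_calc (\<lambda>t. 1 / t) A + fun_calc (\<lambda>t. 1 / t) B)"
  note X = mean_argument_strictly_positive[OF A B]
  note IA = strictly_positive_inverse[OF A] and IB = strictly_positive_inverse[OF B]
    and IE = strictly_positive_inverse[OF E] and IX = strictly_positive_inverse[OF X]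
  have IA_eq: "fun_calc (\<lambda>t. 1 / t) A z = inv_sqrt_op A (inv_sqrt_op A z)" for z
  proof -
    have "A (inv_sqrt_op A (inv_sqrt_op A z)) = z" by (simp add: sqrt_ops_apply[OF A])
    then show ?thesis using IA(3) by metis
  qed
  \<comment> \<open>This is \<open>B^-1 = A^(-1/2) X^-1 A^(-1/2)\<close>, which turns
    \<open>K\<close> into a function of \<open>X\<close> between two inverse square roots.\<close>
  have IB_eq: "fun_calc (\<lambda>t. 1 / t) B z = inv_sqrt_op A (fun_calc (\<lambda>t. 1 / t) ?X (inv_sqrt_op A z))" for z
  proof -
    have "inv_sqrt_op A (B (inv_sqrt_op A (fun_calc (\<lambda>t. 1 / t) ?X (inv_sqrt_op A z)))) = inv_sqrt_op A z"
      using IX(2)[of "inv_sqrt_op A z"] by simp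
    then have "B (inv_sqrt_op A (fun_calc (\<lambda>t. 1 / t) ?X (inv_sqrt_op A z))) = z"
      by (metis sqrt_ops_apply(2)[OF A])
    then show ?thesis using IB(3) by metis
  qed
  have c: "continuous_on {0<..} (\<lambda>t::real. 1 / 2 * (1 / t))" by (rule continuous_on_mult_left[OF inv])
  have half: "fun_calc (\<lambda>t. 1 / 2 + 1 / 2 * (1 / t)) ?X = (1 / 2) *\<^sub>R id_blinfun + (1 / 2) *\<^sub>R fun_calc (\<lambda>t. 1 / t) ?X"
    by (simp only: above_fun_calc_add[OF X up_closed_Ioi continuous_on_const c]
        above_fun_calc_scaleR[OF X up_closed_Ioi inv] above_fun_calc_const[OF X up_closed_Ioi])
  have "fun_calc (\<lambda>t. (1 / 2 + 1 / 2 * (1 / t)) * \<phi> t) ?X = fun_calc (\<lambda>_. 1) ?X"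
    by (rule above_fun_calc_cong[OF X]) (auto simp: \<phi>_def divide_simps)
  then have "fun_calc (\<lambda>t. 1 / 2 + 1 / 2 * (1 / t)) ?X o\<^sub>L fun_calc \<phi> ?X = id_blinfun"
    by (simp only: above_fun_calc_mult[OF X up_closed_Ioi continuous_on_add[OF continuous_on_const c] \<phi>]
        above_fun_calc_const[OF X up_closed_Ioi] scaleR_one)
  then have cancel: "(1 / 2) *\<^sub>R (fun_calc \<phi> ?X z + fun_calc (\<lambda>t. 1 / t) ?X (fun_calc \<phi> ?X z)) = z" for z
    unfolding half by (simp add: blinfun_eq_iff blinfun.bilinear_simps scaleR_add_right)
  have KH: "K (?H z) = z" for z
  proof -
    have "K (?H z) = inv_sqrt_op A ((1 / 2) *\<^sub>R (fun_calc \<phi> ?X (sqrt_op A z) +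
        fun_calc (\<lambda>t. 1 / t) ?X (fun_calc \<phi> ?X (sqrt_op A z))))"
      by (simp add: K_def mean_formula_apply blinfun.bilinear_simps IA_eq IB_eq sqrt_ops_apply[OF A])
    then show ?thesis by (simp only: cancel sqrt_ops_apply(3)[OF A])
  qed
  have "K \<in> positive_operators"
  proof -
    have "fun_calc (\<lambda>t. 1 / t) A \<in> positive_operators" "fun_calc (\<lambda>t. 1 / t) B \<in> positive_operators"
      using IA(1) IB(1) strictly_positive_subset positive_operators_eq by blast+
    then show ?thesis
      by (auto simp: K_def positive_operators_iff blinfun.bilinear_simps ip_simps)
  qed
  then have K: "self_adjoint K" "0 \<le> ip (K x) x" for x by (simp_all add: positive_operators_iff)
  have "ip (K x) x \<le> ip (fun_calc (\<lambda>t. 1 / t) E x) x" for x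
    using le[of x] by (simp add: K_def blinfun.bilinear_simps ip_simps)
  from inverse_antitone[OF K this KH IE(3)] have "ip (E x) x \<le> ip (?H x) x" .
  also have "\<dots> \<le> ip (mean_formula h A B x) x"
    by (rule mean_formula_le[OF A B \<phi> mean_cont]) (use mean_ge in \<open>simp add: \<phi>_def\<close>)
  finally show ?thesis .
qed

section \<open>Means of possibly singular operators\<close>

context
  fixes A B :: "'h \<Rightarrow>\<^sub>L 'h"
  assumes A: "A \<in> operators_above {0..}" and B: "B \<in> operators_above {0..}"
begin

abbreviation regularized_mean :: "real \<Rightarrow> ('h \<Rightarrow>\<^sub>L 'h)" where
  "regularized_mean \<epsilon> \<equiv> mean_formula h (A + \<epsilon> *\<^sub>R id_blinfun) (B + \<epsilon> *\<^sub>R id_blinfun)"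

lemma regularized_mean_mono:
  assumes "0 < \<epsilon>" "\<epsilon> \<le> \<delta>"
  shows "ip (regularized_mean \<epsilon> x) x \<le> ip (regularized_mean \<delta> x) x"
proof -
  have le: "ip ((C + \<epsilon> *\<^sub>R id_blinfun) x) x \<le> ip ((C + \<delta> *\<^sub>R id_blinfun) x) x" for C :: "'h \<Rightarrow>\<^sub>L 'h" and x
    using assms by (simp add: blinfun.bilinear_simps ip_simps ip_self mult_right_mono)
  show ?thesis
    using assms by (intro mean_formula_mono add_id_strictly_positive A B le) auto
qed

text \<open>Regularized means are positive and decrease together with \<open>\<epsilon>\<close>, so
  Vigier's theorem supplies the limit that the description in \<open>mean_of\<close>
  denotes.\<close>

lemma mean_of_singular:
  assumes "\<not> (A \<in> strictly_positive \<and> B \<in> strictly_positive)"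
  shows "self_adjoint (mean_of h A B)"
    "((\<lambda>\<epsilon>. regularized_mean \<epsilon> x) \<longlongrightarrow> mean_of h A B x) (at_right 0)"
proof -
  have "self_adjoint (regularized_mean \<epsilon>)" if "\<epsilon> > 0" for \<epsilon>
    using that by (intro self_adjoint_mean_formula add_id_strictly_positive A B mean_cont)
  moreover have "0 \<le> ip (regularized_mean \<epsilon> x) x" if "\<epsilon> > 0" for \<epsilon> x
    using that by (intro mean_formula_nonneg add_id_strictly_positive A B)
  ultimately obtain L where L: "self_adjoint L" "\<forall>x. ((\<lambda>\<epsilon>. regularized_mean \<epsilon> x) \<longlongrightarrow> L x) (at_right 0)"
    using monotone_strong_limit[of regularized_mean] regularized_mean_mono by blast
  have "mean_of h A B = L"
    unfolding mean_of_def positive_invertible_operators_eq if_not_P[OF assms]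
    by (rule strong_limit_unique[OF L(2)]) simp
  then show "self_adjoint (mean_of h A B)"
    "((\<lambda>\<epsilon>. regularized_mean \<epsilon> x) \<longlongrightarrow> mean_of h A B x) (at_right 0)"
    using L by auto
qed

lemma mean_of_regular:
  assumes "A \<in> strictly_positive" "B \<in> strictly_positive"
  shows "mean_of h A B = mean_formula h A B"
  using assms by (simp add: mean_of_def positive_invertible_operators_eq)

lemma self_adjoint_mean_of: "self_adjoint (mean_of h A B)"
proof (cases "A \<in> strictly_positive \<and> B \<in> strictly_positive")
  case True
  then show ?thesis by (simp add: mean_of_regular self_adjoint_mean_formula mean_cont)
qed (rule mean_of_singular(1))

lemma mean_of_le_regularized:
  assumes \<epsilon>: "\<epsilon> > 0"
  shows "ip (mean_of h A B x) x \<le> ip (regularized_mean \<epsilon> x) x"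
proof (cases "A \<in> strictly_positive \<and> B \<in> strictly_positive")
  case True
  have le: "ip (C x) x \<le> ip ((C + \<epsilon> *\<^sub>R id_blinfun) x) x" for C :: "'h \<Rightarrow>\<^sub>L 'h" and x
    using \<epsilon> by (simp add: blinfun.bilinear_simps ip_simps ip_self)
  from True have AB: "A \<in> strictly_positive" "B \<in> strictly_positive" by auto
  show ?thesis unfolding mean_of_regular[OF AB]
    by (intro mean_formula_mono add_id_strictly_positive A B AB \<epsilon> le)
next
  case False
  have "\<forall>\<^sub>F \<delta> in at_right 0. ip (regularized_mean \<delta> x) x \<le> ip (regularized_mean \<epsilon> x) x"
    unfolding eventually_at_right_field
    using \<epsilon> by (intro exI[of _ \<epsilon>]) (auto intro: regularized_mean_mono)
  then show ?thesis
    by (rule tendsto_upperbound[OF tendsto_ip_left[OF mean_of_singular(2)[OF False]]]) simp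
qed

text \<open>For singular arguments this is passage to the limit. For invertible ones
  \<open>mean_of\<close> is the formula itself, and
  \<open>A + \<epsilon> \<le> (1 + \<epsilon> / m) A\<close> together with homogeneity takes the
  place of its continuity.\<close>

lemma le_mean_of:
  assumes le: "\<And>\<epsilon>. \<epsilon> > 0 \<Longrightarrow> c \<le> ip (regularized_mean \<epsilon> x) x"
  shows "c \<le> ip (mean_of h A B x) x"
proof (cases "A \<in> strictly_positive \<and> B \<in> strictly_positive")
  case True
  then have AB: "A \<in> strictly_positive" "B \<in> strictly_positive" by auto
  then obtain m M where m: "0 < m" "A \<in> operators_between m M" "B \<in> operators_between m M"
    by (auto elim: operators_above_common)
  have scale: "c \<le> (1 + \<epsilon> / m) * ip (mean_of h A B x) x" if "\<epsilon> > 0" for \<epsilon>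
  proof -
    define r where "r = 1 + \<epsilon> / m"
    have r: "r > 0" using m that by (simp add: r_def add_pos_nonneg)
    have le_r: "ip ((C + \<epsilon> *\<^sub>R id_blinfun) y) y \<le> ip ((r *\<^sub>R C) y) y"
      if "C \<in> operators_between m M" for C :: "'h \<Rightarrow>\<^sub>L 'h" and y
    proof -
      have "\<epsilon> / m * (m * (norm y)\<^sup>2) \<le> \<epsilon> / m * ip (C y) y"
        using m \<open>\<epsilon> > 0\<close> by (intro mult_left_mono operators_betweenD(2)[OF that]) auto
      then show ?thesis using m by (simp add: r_def blinfun.bilinear_simps ip_simps ip_self algebra_simps)
    qed
    have above: "r *\<^sub>R C \<in> strictly_positive" if "C \<in> operators_between m M" for C :: "'h \<Rightarrow>\<^sub>L 'h"
      using operators_between_combine[OF that scaleR_id_between[of 0], of r 0] r m(1)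
      by (intro operators_aboveI[of _ "r * m" "r * M"]) auto
    have "c \<le> ip (regularized_mean \<epsilon> x) x" by (rule le[OF that])
    also have "\<dots> \<le> ip (mean_formula h (r *\<^sub>R A) (r *\<^sub>R B) x) x"
      using that by (intro mean_formula_mono add_id_strictly_positive A B above le_r m)
    finally show ?thesis
      unfolding mean_formula_scaleR[OF AB mean_cont r] mean_of_regular[OF AB]
      by (simp add: r_def blinfun.bilinear_simps ip_simps)
  qed
  have "((\<lambda>\<epsilon>. (1 + \<epsilon> / m) * ip (mean_of h A B x) x) \<longlongrightarrow> (1 + 0 / m) * ip (mean_of h A B x) x) (at_right 0)"
    using m by (intro tendsto_intros) auto
  moreover have "\<forall>\<^sub>F \<epsilon> in at_right 0. c \<le> (1 + \<epsilon> / m) * ip (mean_of h A B x) x"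
    unfolding eventually_at_right_field using scale by (intro exI[of _ 1]) auto
  ultimately have "c \<le> (1 + 0 / m) * ip (mean_of h A B x) x"
    by (rule tendsto_lowerbound) simp
  then show ?thesis by simp
next
  case False
  have "\<forall>\<^sub>F \<epsilon> in at_right 0. c \<le> ip (regularized_mean \<epsilon> x) x"
    unfolding eventually_at_right_field using le by (intro exI[of _ 1]) auto
  then show ?thesis
    by (rule tendsto_lowerbound[OF tendsto_ip_left[OF mean_of_singular(2)[OF False]]]) simp
qed

lemma mean_of_le_arithmetic: "ip (mean_of h A B x) x \<le> ip ((A \<triangledown> B) x) x"
proof (rule field_le_epsilon)
  fix e :: real assume e: "e > 0"
  define \<epsilon> where "\<epsilon> = e / (1 + (norm x)\<^sup>2)"
  have \<epsilon>: "\<epsilon> > 0" "\<epsilon> * (norm x)\<^sup>2 \<le> e" using e by (auto simp: \<epsilon>_def field_simps add_pos_nonneg)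
  have "ip (mean_of h A B x) x \<le> ip (regularized_mean \<epsilon> x) x"
    by (rule mean_of_le_regularized[OF \<epsilon>(1)])
  also have "\<dots> \<le> (ip ((A + \<epsilon> *\<^sub>R id_blinfun) x) x + ip ((B + \<epsilon> *\<^sub>R id_blinfun) x) x) / 2"
    by (intro mean_formula_le_arithmetic add_id_strictly_positive A B \<epsilon>)
  also have "\<dots> = ip ((A \<triangledown> B) x) x + \<epsilon> * (norm x)\<^sup>2"
    by (simp add: arithmetic_mean_def blinfun.bilinear_simps ip_simps ip_self field_simps)
  finally show "ip (mean_of h A B x) x \<le> ip ((A \<triangledown> B) x) x + e" using \<epsilon>(2) by linarith
qed

end

end

section \<open>The geometric mean\<close>

text \<open>If \<open>-\<mu>\<close> is the infimum of the quadratic form of \<open>\<surd>B - \<surd>A\<close> and \<open>\<mu> > 0\<close>, an approximate eigenvector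
  \<open>x\<close> for \<open>-\<mu>\<close> satisfies \<open>\<parallel>\<surd>A x\<parallel> \<approx> \<parallel>\<surd>B x + \<mu> x\<parallel> > \<parallel>\<surd>B x\<parallel>\<close>.\<close>

lemma sqrt_op_mono:
  fixes A B :: "'h::complex_hilbert_space \<Rightarrow>\<^sub>L 'h"
  assumes A: "A \<in> operators_above {0..}" and B: "B \<in> operators_above {0..}"
    and le: "\<And>x. ip (A x) x \<le> ip (B x) x"
  shows "ip (sqrt_op A x) x \<le> ip (sqrt_op B x) x"
proof (rule ccontr)
  define C where "C = sqrt_op A"
  define E where "E = sqrt_op B"
  have C: "C \<in> positive_operators" and E: "E \<in> positive_operators"
    unfolding C_def E_def positive_operators_eq using positive_sqrt_op(1) A B by auto
  then have sa: "self_adjoint C" "self_adjoint E" by (auto simp: positive_operators_iff)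
  have "ip (A z) z = (norm (C z))\<^sup>2" "ip (B z) z = (norm (E z))\<^sup>2" for z
    using positive_sqrt_op(2)[OF A, of z] positive_sqrt_op(2)[OF B, of z]
      self_adjoint_ip[OF sa(1), of "C z" z] self_adjoint_ip[OF sa(2), of "E z" z]
    by (simp_all add: C_def E_def ip_self)
  then have CE: "norm (C z) \<le> norm (E z)" for z
    using le[of z] by (intro power2_le_imp_le[of "norm (C z)"]) auto
  define G where "G = (\<lambda>x. ip ((E - C) x) x) ` {x. norm x = 1}"
  define \<mu> where "\<mu> = - Inf G"
  assume "\<not> ip (sqrt_op A x) x \<le> ip (sqrt_op B x) x"
  then have neg: "ip ((E - C) x) x < 0" by (simp add: C_def E_def blinfun.bilinear_simps ip_simps)
  then have "x \<noteq> 0" by auto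
  define u where "u = (1 / norm x) *\<^sub>R x"
  have "norm u = 1" using \<open>x \<noteq> 0\<close> by (simp add: u_def)
  have "ip ((E - C) u) u = (1 / norm x)\<^sup>2 * ip ((E - C) x) x"
    by (simp add: u_def blinfun.scaleR_right ip_simps power2_eq_square del: minus_blinfun.rep_eq)
  then have u_neg: "ip ((E - C) u) u < 0"
    using neg \<open>x \<noteq> 0\<close> by (simp add: mult_pos_neg)
  have bdd: "bdd_below G"
    unfolding G_def
  proof (rule bdd_belowI[of _ "- norm (E - C)"], clarify)
    fix z :: 'h assume "norm z = 1"
    then show "- norm (E - C) \<le> ip ((E - C) z) z" using ip_le_norm[of "E - C" z] by simp
  qed
  have "Inf G \<le> ip ((E - C) u) u"
    unfolding G_def[symmetric] using \<open>norm u = 1\<close> by (intro cInf_lower bdd) (auto simp: G_def)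
  then have \<mu>: "\<mu> > 0" using u_neg by (simp add: \<mu>_def)
  define T where "T = (E - C) + \<mu> *\<^sub>R id_blinfun"
  have T: "self_adjoint T" using sa by (simp add: T_def)
  have T_pos: "0 \<le> ip (T z) z" for z
  proof (cases "z = 0")
    case False
    define v where "v = (1 / norm z) *\<^sub>R z"
    have v: "norm v = 1" using False by (simp add: v_def)
    then have "- \<mu> \<le> ip ((E - C) v) v"
      unfolding \<mu>_def by (simp, intro cInf_lower bdd) (auto simp: G_def)
    then have "0 \<le> ip (T v) v"
      using v by (simp add: T_def plus_blinfun.rep_eq ip_add_left scaleR_blinfun.rep_eq ip_scaleR_left ip_self
          del: minus_blinfun.rep_eq)
    moreover have "ip (T z) z = (norm z)\<^sup>2 * ip (T v) v"
      using False by (simp add: v_def blinfun.scaleR_right ip_simps power2_eq_square)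
    ultimately show ?thesis by simp
  qed simp
  \<comment> \<open>The argument will end in
    \<open>\<mu>\<^sup>2 \<le> (2 * norm (E z) + \<tau>) * \<tau>\<close> for a unit vector
    \<open>z\<close>. Here \<open>k\<close> bounds the first factor, and \<open>\<tau>\<close> is
    small enough to contradict this.\<close>
  define k where "k = 2 * norm E + 1"
  define \<tau> where "\<tau> = min 1 (\<mu>\<^sup>2 / (2 * k))"
  have nE: "k > 0" by (simp add: k_def add_nonneg_pos)
  then have \<tau>: "0 < \<tau>" "\<tau> \<le> 1" "k * \<tau> < \<mu>\<^sup>2"
  proof -
    show "0 < \<tau>" "\<tau> \<le> 1" using nE \<mu> by (auto simp: \<tau>_def)
    have "k * \<tau> \<le> k * (\<mu>\<^sup>2 / (2 * k))"
      using nE by (intro mult_left_mono) (auto simp: \<tau>_def)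
    also have "\<dots> = \<mu>\<^sup>2 / 2" using nE by simp
    also have "\<dots> < \<mu>\<^sup>2" using \<mu> by simp
    finally show "k * \<tau> < \<mu>\<^sup>2" .
  qed
  \<comment> \<open>A unit vector that is minimal up to this \<open>\<eta>\<close> satisfies
    \<open>norm (T z) \<le> \<tau>\<close>, by \<open>positive_norm_le\<close>.\<close>
  define \<eta> where "\<eta> = \<tau>\<^sup>2 / (norm T + 1)"
  have nT: "norm T + 1 > 0" by (simp add: add_nonneg_pos)
  have "\<eta> > 0" using \<tau> nT by (simp add: \<eta>_def)
  then have "\<exists>y\<in>G. y < Inf G + \<eta>"
    using \<open>norm u = 1\<close> by (intro cInf_lessD) (auto simp: G_def)
  then obtain z where z: "norm z = 1" "ip ((E - C) z) z < Inf G + \<eta>" by (auto simp: G_def)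
  then have "ip (T z) z < \<eta>"
    by (simp add: T_def \<mu>_def blinfun.bilinear_simps ip_simps ip_self)
  have "(norm (T z))\<^sup>2 \<le> norm T * ip (T z) z"
    using ip_le_norm[of T] by (intro positive_norm_le T T_pos) (auto simp: abs_le_iff)
  also have "\<dots> \<le> (norm T + 1) * \<eta>"
    using \<open>ip (T z) z < \<eta>\<close> T_pos[of z] by (intro mult_mono) auto
  also have "\<dots> = \<tau>\<^sup>2" using nT by (simp add: \<eta>_def)
  finally have Tz: "norm (T z) \<le> \<tau>" by (rule power2_le_imp_le) (use \<tau> in simp)
  have "E z + \<mu> *\<^sub>R z = C z + T z" by (simp add: T_def blinfun.bilinear_simps)
  then have "norm (E z + \<mu> *\<^sub>R z) \<le> norm (E z) + \<tau>"
    using norm_triangle_ineq[of "C z" "T z"] CE[of z] Tz by simp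
  then have "(norm (E z + \<mu> *\<^sub>R z))\<^sup>2 \<le> (norm (E z) + \<tau>)\<^sup>2" by (intro power_mono) auto
  moreover have "(norm (E z + \<mu> *\<^sub>R z))\<^sup>2 = (norm (E z))\<^sup>2 + 2 * \<mu> * ip (E z) z + \<mu>\<^sup>2"
  proof -
    have "ip (E z + \<mu> *\<^sub>R z) (E z + \<mu> *\<^sub>R z) = ip (E z) (E z) + 2 * \<mu> * ip (E z) z + \<mu> * (\<mu> * ip z z)"
      by (simp add: ip_simps ip_commute[of z "E z"] algebra_simps)
    then show ?thesis using z(1) unfolding ip_self by (simp add: power2_eq_square)
  qed
  moreover have "0 \<le> \<mu> * ip (E z) z" using \<mu> E by (simp add: positive_operators_iff)
  ultimately have "\<mu>\<^sup>2 \<le> (2 * norm (E z) + \<tau>) * \<tau>"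
    by (simp add: power2_eq_square algebra_simps)
  also have "\<dots> \<le> k * \<tau>"
    using norm_blinfun[of E z] z(1) \<tau> by (intro mult_right_mono) (auto simp: k_def)
  finally show False using \<tau>(3) by simp
qed

lemma sqrt_operator_monotone:
  "operator_monotone_on (positive_operators :: ('h::complex_hilbert_space \<Rightarrow>\<^sub>L 'h) set) sqrt"
  unfolding operator_monotone_on_def positive_operators_eq
proof (intro ballI impI)
  fix A B :: "'h \<Rightarrow>\<^sub>L 'h"
  assume AB: "A \<in> operators_above {0..}" "B \<in> operators_above {0..}" "B \<le>\<^sub>L A"
  have "ip (sqrt_op B x) x \<le> ip (sqrt_op A x) x" for x
    by (rule sqrt_op_mono[OF AB(2,1) loewner_le_ip[OF AB(3)]])
  then show "sqrt_op B \<le>\<^sub>L sqrt_op A"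
    using above_self_adjoint[OF positive_sqrt_op(1)[OF AB(1)]]
      above_self_adjoint[OF positive_sqrt_op(1)[OF AB(2)]]
    by (simp add: loewner_le_iff)
qed

text \<open>Applying first \<open>t * t\<close> and then \<open>sqrt\<close> to \<open>Z\<close> in
  the functional calculus returns \<open>Z\<close>, because \<open>Z\<close> is positive.\<close>

lemma sqrt_op_unique:
  assumes Z: "Z \<in> operators_above {0..}" and X: "\<And>x. blinfun_apply Z (Z x) = blinfun_apply X x"
  shows "sqrt_op X = Z"
proof -
  have c: "continuous_on {0..} (\<lambda>t::real. t * t)" "(\<lambda>t::real. t * t) ` {0..} \<subseteq> {0..}"
    "continuous_on {0..} sqrt"
    by (auto intro!: continuous_intros)
  have "fun_calc (\<lambda>t. t * t) Z = X"
    using above_fun_calc_mult[OF Z up_closed_Ici continuous_on_id continuous_on_id] X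
    by (intro blinfun_eqI) (simp add: above_fun_calc_ident[OF Z up_closed_Ici])
  then have "sqrt_op X = fun_calc (\<lambda>t. sqrt (t * t)) Z"
    using above_fun_calc_compose[OF Z up_closed_Ici c(1,2) up_closed_Ici c(3)] by simp
  also have "\<dots> = fun_calc (\<lambda>t. t) Z"
    by (rule above_fun_calc_cong[OF Z up_closed_Ici continuous_on_id]) simp
  finally show ?thesis by (simp add: above_fun_calc_ident[OF Z up_closed_Ici])
qed

text \<open>\<open>G = A # B\<close> satisfies \<open>G B\<^sup>-\<^sup>1 G = A\<close>, so that \<open>B\<^sup>-\<^sup>1\<^sup>/\<^sup>2 G B\<^sup>-\<^sup>1\<^sup>/\<^sup>2\<close> is the square root of
  \<open>B\<^sup>-\<^sup>1\<^sup>/\<^sup>2 A B\<^sup>-\<^sup>1\<^sup>/\<^sup>2\<close>.\<close>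

lemma mean_formula_sqrt_commute:
  fixes A B :: "'h::complex_hilbert_space \<Rightarrow>\<^sub>L 'h"
  assumes A: "A \<in> strictly_positive" and B: "B \<in> strictly_positive"
  shows "mean_formula sqrt A B = mean_formula sqrt B A"
proof -
  define G where "G = mean_formula sqrt A B"
  define Y where "Y = sqrt_op (mean_argument A B)"
  note X = mean_argument_strictly_positive[OF A B]
  have Y: "Y \<in> strictly_positive" unfolding Y_def by (rule sqrt_ops_above(1)[OF X])
  have YY: "Y (Y z) = mean_argument A B z" for z unfolding Y_def by (rule sqrt_ops_apply(1)[OF X])
  obtain Y' where Y': "\<And>z. Y (blinfun_apply Y' z) = z" using strictly_positive_inverse(2)[OF Y] by blast
  have G_apply: "G z = sqrt_op A (Y (sqrt_op A z))" for z by (simp add: G_def Y_def mean_formula_apply)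
  have G: "G \<in> strictly_positive"
  proof -
    have "G = sqrt_op A o\<^sub>L Y o\<^sub>L sqrt_op A" by (rule blinfun_eqI) (simp add: G_apply)
    then show ?thesis
      using sandwich_strictly_positive[OF sqrt_ops_self_adjoint(1)[OF A] sqrt_ops_apply(3)[OF A] Y] by simp
  qed
  define Z where "Z = inv_sqrt_op B o\<^sub>L G o\<^sub>L inv_sqrt_op B"
  have Z: "Z \<in> strictly_positive"
    unfolding Z_def
    by (rule sandwich_strictly_positive[OF sqrt_ops_self_adjoint(2)[OF B] sqrt_ops_apply(2)[OF B] G])
  have GBG: "G (inv_sqrt_op B (inv_sqrt_op B (G z))) = A z" for z
  proof -
    let ?s = "inv_sqrt_op A (Y' (sqrt_op A z))"
    have "mean_argument A B (Y' (sqrt_op A z)) = Y (sqrt_op A z)" by (simp only: YY[symmetric] Y')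
    then have "sqrt_op A (inv_sqrt_op A (B ?s)) = G z" by (simp add: G_apply)
    then have "B ?s = G z" by (simp add: sqrt_ops_apply[OF A])
    then have "inv_sqrt_op B (inv_sqrt_op B (G z)) = ?s"
      by (metis sqrt_ops_apply(3,5)[OF B])
    then show ?thesis by (simp add: G_apply sqrt_ops_apply[OF A] Y')
  qed
  have "sqrt_op (mean_argument B A) = Z"
    by (rule sqrt_op_unique) (use Z strictly_positive_subset in \<open>auto simp: Z_def GBG\<close>)
  then have "mean_formula sqrt B A z = G z" for z
    by (simp add: mean_formula_apply Z_def sqrt_ops_apply[OF B])
  then show ?thesis by (intro blinfun_eqI) (simp add: G_def)
qed

lemma symmetric_geometric_mean:
  "symmetric_operator_mean (geometric_mean :: ('h::complex_hilbert_space \<Rightarrow>\<^sub>L 'h) \<Rightarrow> _)"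
proof -
  have "geometric_mean A B = geometric_mean B (A :: 'h \<Rightarrow>\<^sub>L 'h)"
    if "A \<in> positive_invertible_operators" "B \<in> positive_invertible_operators" for A B
    using that mean_formula_sqrt_commute[of A B]
    by (simp add: geometric_mean_def mean_of_def positive_invertible_operators_eq)
  moreover have "operator_mean (geometric_mean :: ('h \<Rightarrow>\<^sub>L 'h) \<Rightarrow> _)"
    unfolding operator_mean_def
    by (intro exI[of _ sqrt] conjI sqrt_operator_monotone)
      (auto simp: geometric_mean_def intro!: continuous_intros)
  ultimately show ?thesis by (simp add: symmetric_operator_mean_def)
qed

text \<open>On the identity and four times the identity the two means are 2 and 5/2 times the
  identity.\<close>

lemma geometric_mean_neq_arithmetic:
  assumes "(w::'h::complex_hilbert_space) \<noteq> 0"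
  obtains A B :: "'h::complex_hilbert_space \<Rightarrow>\<^sub>L 'h"
  where "A \<in> positive_operators" "B \<in> positive_operators" "geometric_mean A B \<noteq> A \<triangledown> B"
proof -
  let ?A = "1 *\<^sub>R id_blinfun :: 'h \<Rightarrow>\<^sub>L 'h" and ?B = "4 *\<^sub>R id_blinfun :: 'h \<Rightarrow>\<^sub>L 'h"
  have pos: "?A \<in> strictly_positive" "?B \<in> strictly_positive"
    by (rule operators_aboveI[OF scaleR_id_between]; simp)+
  have "geometric_mean ?A ?B = (1 * sqrt (4 / 1)) *\<^sub>R id_blinfun"
    using pos unfolding geometric_mean_def mean_of_def positive_invertible_operators_eq
    by (simp only: mean_formula_scalars[OF zero_less_one] if_True conj_absorb simp_thms)
  then have "geometric_mean ?A ?B w = (1 * sqrt (4 / 1)) *\<^sub>R w" by (simp add: blinfun.bilinear_simps)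
  moreover have "sqrt 4 = 2" by (rule real_sqrt_unique) auto
  moreover have "(?A \<triangledown> ?B) w = (5 / 2) *\<^sub>R w"
    by (simp add: arithmetic_mean_def blinfun.bilinear_simps flip: scaleR_add_left)
      (simp add: scaleR_add_left[of 1 4 w, simplified, symmetric])
  ultimately have "geometric_mean ?A ?B \<noteq> ?A \<triangledown> ?B" using assms by auto
  then show thesis
    using that[of ?A ?B] pos strictly_positive_subset unfolding positive_operators_eq by blast
qed

lemma arithmetic_mean_strictly_positive:
  fixes A B :: "'h::complex_hilbert_space \<Rightarrow>\<^sub>L 'h"
  assumes A: "A \<in> strictly_positive" and B: "B \<in> strictly_positive"
  shows "A \<triangledown> B \<in> strictly_positive"
proof -
  obtain m M where "m \<in> {0<..}" "A \<in> operators_between m M" "B \<in> operators_between m M"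
    using operators_above_common[OF A B] .
  then show ?thesis
    using operators_between_combine[of A m M B m M "1 / 2" "1 / 2"]
    by (intro operators_aboveI[of _ m M]) (auto simp: arithmetic_mean_def scaleR_add_right)
qed

section \<open>Operator monotone decreasing functions\<close>

context
  fixes f :: "real \<Rightarrow> real"
  assumes f_cont: "continuous_on {0<..} f" and f_nonneg: "\<forall>t>0. 0 \<le> f t"
begin

lemma fun_calc_nonneg_above:
  assumes "A \<in> strictly_positive"
  shows "fun_calc f A \<in> operators_above {0..}"
  by (rule fun_calc_above[OF assms up_closed_Ioi f_cont]) (use f_nonneg in auto)

lemma fun_calc_uminus:
  assumes "A \<in> strictly_positive"
  shows "fun_calc (\<lambda>t. - f t) A = - fun_calc f A"
  using above_fun_calc_scaleR[OF assms up_closed_Ioi f_cont, of "-1"] by simp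

lemma operator_antitone_iff:
  "operator_monotone_on (strictly_positive :: ('h::complex_hilbert_space \<Rightarrow>\<^sub>L 'h) set) (\<lambda>t. - f t) \<longleftrightarrow>
    (\<forall>A\<in>strictly_positive. \<forall>B\<in>strictly_positive. B \<le>\<^sub>L A \<longrightarrow> fun_calc f A \<le>\<^sub>L fun_calc f (B :: 'h \<Rightarrow>\<^sub>L 'h))"
  by (auto simp: operator_monotone_on_def fun_calc_uminus loewner_le_def)

text \<open>\<open>1 / (f + \<epsilon>)\<close> is operator monotone, hence operator concave, so \<open>f + \<epsilon>\<close> at the midpoint is below
  the harmonic mean of its values.\<close>

lemma antitone_imp_mean_ineq:
  fixes A B :: "'h::complex_hilbert_space \<Rightarrow>\<^sub>L 'h"
  assumes D: "doubling V1 V2 W1 (W2 :: 'h \<Rightarrow>\<^sub>L 'h)" and nontrivial: "(w::'h) \<noteq> 0"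
    and anti: "operator_monotone_on (strictly_positive :: ('h \<Rightarrow>\<^sub>L 'h) set) (\<lambda>t. - f t)"
    and h: "continuous_on {0..} h" "\<forall>t\<ge>0. 0 \<le> h t" "h 1 = 1"
      "operator_monotone_on (positive_operators :: ('h \<Rightarrow>\<^sub>L 'h) set) h"
      "\<forall>A\<in>positive_invertible_operators. \<forall>B\<in>positive_invertible_operators.
        mean_formula h A B = mean_formula h B (A :: 'h \<Rightarrow>\<^sub>L 'h)"
    and A: "A \<in> strictly_positive" and B: "B \<in> strictly_positive"
  shows "ip (fun_calc f (A \<triangledown> B) x) x \<le> ip (mean_of h (fun_calc f A) (fun_calc f B) x) x"
proof (rule le_mean_of[OF D nontrivial h fun_calc_nonneg_above[OF A] fun_calc_nonneg_above[OF B]])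
  fix \<epsilon> :: real assume \<epsilon>: "\<epsilon> > 0"
  \<comment> \<open>As \<open>f\<close> may vanish, the reciprocal is taken after adding
    \<open>\<epsilon>\<close>; the same \<open>\<epsilon>\<close> regularizes the mean.\<close>
  define f' where "f' = (\<lambda>t. f t + \<epsilon>)"
  define g where "g = (\<lambda>t. 1 / f' t)"
  have f': "continuous_on {0<..} f'" "f' ` {0<..} \<subseteq> {0<..}"
    unfolding f'_def using f_cont f_nonneg \<epsilon> by (auto intro!: continuous_intros add_nonneg_pos)
  have inv: "continuous_on {0<..} (\<lambda>t::real. 1 / t)" by (auto intro!: continuous_intros)
  have g: "continuous_on {0<..} g"
    unfolding g_def by (rule continuous_on_compose2[OF inv f'])
  have f'_calc: "fun_calc f' C = fun_calc f C + \<epsilon> *\<^sub>R id_blinfun" "fun_calc f' C \<in> strictly_positive"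
    "fun_calc g C = fun_calc (\<lambda>t. 1 / t) (fun_calc f' C)"
    if "C \<in> strictly_positive" for C :: "'h \<Rightarrow>\<^sub>L 'h"
    using above_fun_calc_add[OF that up_closed_Ioi f_cont continuous_on_const]
      above_fun_calc_const[OF that up_closed_Ioi] fun_calc_above[OF that up_closed_Ioi f']
      above_fun_calc_compose[OF that up_closed_Ioi f' up_closed_Ioi inv]
    by (simp_all add: f'_def g_def)
  have "operator_monotone_on (strictly_positive :: ('h \<Rightarrow>\<^sub>L 'h) set) g"
    unfolding operator_monotone_on_def
  proof (intro ballI impI)
    fix P Q :: "'h \<Rightarrow>\<^sub>L 'h"
    assume P: "P \<in> strictly_positive" and Q: "Q \<in> strictly_positive" and "Q \<le>\<^sub>L P"
    then have "fun_calc f P \<le>\<^sub>L fun_calc f Q" using anti by (simp add: operator_antitone_iff)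
    then have "ip (fun_calc f' P x) x \<le> ip (fun_calc f' Q x) x" for x
      using loewner_le_ip[of "fun_calc f P" "fun_calc f Q" x]
      by (simp add: f'_calc(1)[OF P] f'_calc(1)[OF Q] blinfun.bilinear_simps ip_simps)
    then have "ip (fun_calc g Q x) x \<le> ip (fun_calc g P x) x" for x
      unfolding f'_calc(3)[OF P] f'_calc(3)[OF Q]
      by (intro fun_calc_inverse_antitone f'_calc(2) P Q)
    then show "fun_calc g Q \<le>\<^sub>L fun_calc g P"
      using fun_calc_self_adjoint_above[OF P up_closed_Ioi g] fun_calc_self_adjoint_above[OF Q up_closed_Ioi g]
      by (simp add: loewner_le_iff)
  qed
  from operator_monotone_imp_concave[OF D this up_closed_Ioi g A B, of "sqrt (1 / 2)" "sqrt (1 / 2)"]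
  have concave: "(ip (fun_calc g A x) x + ip (fun_calc g B x) x) / 2 \<le> ip (fun_calc g (A \<triangledown> B) x) x" for x
    by (simp add: arithmetic_mean_def scaleR_add_right add_divide_distrib)
  note M = arithmetic_mean_strictly_positive[OF A B]
  have "ip (fun_calc f (A \<triangledown> B) x) x \<le> ip (fun_calc f' (A \<triangledown> B) x) x"
    using \<epsilon> by (simp add: f'_calc(1)[OF M] blinfun.bilinear_simps ip_simps ip_self)
  also have "\<dots> \<le> ip (mean_formula h (fun_calc f' A) (fun_calc f' B) x) x"
    by (rule harmonic_le_mean_formula[OF D nontrivial h f'_calc(2)[OF A] f'_calc(2)[OF B] f'_calc(2)[OF M]])
      (use concave in \<open>simp add: f'_calc(3)[OF A] f'_calc(3)[OF B] f'_calc(3)[OF M]\<close>)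
  finally show "ip (fun_calc f (A \<triangledown> B) x) x \<le> ip (mean_formula h (fun_calc f A + \<epsilon> *\<^sub>R id_blinfun)
      (fun_calc f B + \<epsilon> *\<^sub>R id_blinfun) x) x"
    by (simp add: f'_calc(1)[OF A] f'_calc(1)[OF B])
qed

end

section \<open>Operators acting on a plane\<close>

lemma scaleC_0_1: "(0::complex) *\<^sub>C x = (0::'h::complex_hilbert_space)" "(1::complex) *\<^sub>C x = (x::'h::complex_hilbert_space)"
  using scaleC_of_real[of 0 x] scaleC_of_real[of 1 x] by simp_all

lemma above_fun_calc_eigenvector:
  assumes "A \<in> operators_above S" "up_closed S" "continuous_on S f" "blinfun_apply A u = r *\<^sub>R u"
  shows "blinfun_apply (fun_calc f A) u = f r *\<^sub>R u"
  using assms by (meson operators_aboveE fun_calc_eigenvector continuous_on_subinterval)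

lemma self_adjoint_cinner:
  assumes "self_adjoint T"
  shows "cinner (blinfun_apply T x) y = cinner x (T y)"
  using self_adjoint_ip[OF assms, of x y] self_adjoint_ip[OF assms, of x "\<i> *\<^sub>C y"]
  by (simp add: complex_eq_iff Im_cinner_eq bounded_operatorsD[OF self_adjoint_bounded[OF assms]] flip: ip_def)

lemma rank_one_perturbation_between:
  assumes p: "cinner p p = 1"
  shows "y *\<^sub>R id_blinfun + r *\<^sub>R rank_one p p \<in> operators_between (min y (y + r)) (max y (y + r))"
proof (rule operators_betweenI)
  fix x
  define a where "a = (cmod (cinner x p))\<^sup>2"
  have "(norm p)\<^sup>2 = 1" using p by (simp add: ip_def flip: ip_self)
  then have "norm p = 1" using power2_eq_iff_nonneg[of "norm p" 1] by simp
  then have a: "0 \<le> a" "a \<le> (norm x)\<^sup>2"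
    using power_mono[OF cmod_cinner_le[of x p], of 2] by (simp_all add: a_def)
  have ip: "ip ((y *\<^sub>R id_blinfun + r *\<^sub>R rank_one p p) x) x = y * ((norm x)\<^sup>2 - a) + (y + r) * a"
    by (simp add: blinfun.bilinear_simps ip_simps ip_self a_def flip: ip_rank_one_self)
      (simp add: algebra_simps)
  have "min y (y + r) * ((norm x)\<^sup>2 - a) + min y (y + r) * a \<le> y * ((norm x)\<^sup>2 - a) + (y + r) * a"
    using a by (intro add_mono mult_right_mono) auto
  then show "min y (y + r) * (norm x)\<^sup>2 \<le> ip ((y *\<^sub>R id_blinfun + r *\<^sub>R rank_one p p) x) x"
    unfolding ip by (simp add: algebra_simps)
  have "y * ((norm x)\<^sup>2 - a) + (y + r) * a \<le> max y (y + r) * ((norm x)\<^sup>2 - a) + max y (y + r) * a"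
    using a by (intro add_mono mult_right_mono) auto
  then show "ip ((y *\<^sub>R id_blinfun + r *\<^sub>R rank_one p p) x) x \<le> max y (y + r) * (norm x)\<^sup>2"
    unfolding ip by (simp add: algebra_simps)
qed simp

lemma rank_one_perturbation_strictly_positive:
  assumes "cinner p p = 1" "0 < y" "0 < y + r"
  shows "y *\<^sub>R id_blinfun + r *\<^sub>R rank_one p p \<in> strictly_positive"
  by (rule operators_aboveI[OF rank_one_perturbation_between[OF assms(1)]]) (use assms in simp)

text \<open>The components of \<open>z\<close> along \<open>p\<close> and orthogonal to
  \<open>p\<close> are eigenvectors for \<open>y + r\<close> and \<open>y\<close>.\<close>

lemma fun_calc_rank_one_perturbation:
  assumes p: "cinner p p = 1" and "0 < y" "0 < y + r" and f: "continuous_on {0<..} f"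
  shows "fun_calc f (y *\<^sub>R id_blinfun + r *\<^sub>R rank_one p p)
    = f y *\<^sub>R id_blinfun + (f (y + r) - f y) *\<^sub>R rank_one p p"
proof (rule blinfun_eqI)
  fix z
  let ?A = "y *\<^sub>R id_blinfun + r *\<^sub>R rank_one p p"
  note A = rank_one_perturbation_strictly_positive[OF assms(1-3)]
  define z1 where "z1 = cinner z p *\<^sub>C p"
  have zp: "cinner (z - z1) p = 0" by (simp add: z1_def cinner_simps p)
  have z1p: "cinner z1 p = cinner z p" by (simp add: z1_def cinner_simps p)
  have zero: "(0::complex) *\<^sub>C p = 0" using scaleC_of_real[of 0 p] by simp
  have "?A (z - z1) = y *\<^sub>R (z - z1)"
    by (simp add: plus_blinfun.rep_eq scaleR_blinfun.rep_eq zp zero)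
  from above_fun_calc_eigenvector[OF A up_closed_Ioi f this]
  have 1: "fun_calc f ?A (z - z1) = f y *\<^sub>R (z - z1)" .
  have "?A z1 = (y + r) *\<^sub>R z1"
    by (simp add: plus_blinfun.rep_eq scaleR_blinfun.rep_eq z1p scaleR_add_left) (simp add: z1_def)
  from above_fun_calc_eigenvector[OF A up_closed_Ioi f this]
  have 2: "fun_calc f ?A z1 = f (y + r) *\<^sub>R z1" .
  have "fun_calc f ?A z = fun_calc f ?A (z - z1) + fun_calc f ?A z1" by (simp flip: blinfun.add_right)
  also have "\<dots> = f y *\<^sub>R z + (f (y + r) - f y) *\<^sub>R z1" by (simp add: 1 2 algebra_simps)
  finally show "fun_calc f ?A z = (f y *\<^sub>R id_blinfun + (f (y + r) - f y) *\<^sub>R rank_one p p) z"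
    by (simp add: z1_def plus_blinfun.rep_eq scaleR_blinfun.rep_eq)
qed

lemma mean_formula_common_eigenvector:
  assumes A: "A \<in> strictly_positive" and B: "B \<in> strictly_positive" and h: "continuous_on {0<..} h"
    and Au: "blinfun_apply A u = a *\<^sub>R u" and Bu: "blinfun_apply B u = b *\<^sub>R u" and a: "a > 0"
  shows "blinfun_apply (mean_formula h A B) u = (a * h (b / a)) *\<^sub>R u"
proof -
  have R: "sqrt_op A u = sqrt a *\<^sub>R u" "inv_sqrt_op A u = (1 / sqrt a) *\<^sub>R u"
    by (rule above_fun_calc_eigenvector[OF A up_closed_Ioi _ Au]; auto intro!: continuous_intros)+
  have "mean_argument A B u = (b / a) *\<^sub>R u"
    using a by (simp add: R blinfun.scaleR_right Bu)
  from above_fun_calc_eigenvector[OF mean_argument_strictly_positive[OF A B] up_closed_Ioi h this]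
  show ?thesis using a by (simp add: mean_formula_apply R blinfun.scaleR_right)
qed

text \<open>The identity off the plane of \<open>e1\<close> and \<open>e2\<close>, so that nonzero
  \<open>a\<close> and \<open>b\<close> make it invertible on the whole space.\<close>

definition diagonal where
  "diagonal e1 e2 a b = id_blinfun + (a - 1) *\<^sub>R rank_one e1 e1 + (b - 1) *\<^sub>R rank_one e2 e2"

lemma self_adjoint_diagonal: "self_adjoint (diagonal e1 e2 a b)"
  by (simp add: diagonal_def)

context
  fixes e1 e2 :: "'h::complex_hilbert_space"
  assumes e: "cinner e1 e1 = 1" "cinner e2 e2 = 1" "cinner e1 e2 = 0" "cinner e2 e1 = 0"
begin

lemma diagonal_apply:
  "blinfun_apply (diagonal e1 e2 a b) x = x + (a - 1) *\<^sub>R (cinner x e1 *\<^sub>C e1) + (b - 1) *\<^sub>R (cinner x e2 *\<^sub>C e2)"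
  by (simp add: diagonal_def plus_blinfun.rep_eq scaleR_blinfun.rep_eq)

lemma unit_vectors: "norm e1 = 1" "ip e1 e1 = 1" "ip e2 e2 = 1" "ip e1 e2 = 0" "ip e2 e1 = 0" "e1 \<noteq> 0"
proof -
  show ip: "ip e1 e1 = 1" "ip e2 e2 = 1" "ip e1 e2 = 0" "ip e2 e1 = 0"
    using e by (simp_all add: ip_def)
  show "norm e1 = 1" using ip(1) power2_eq_iff_nonneg[of "norm e1" 1] by (simp add: ip_self)
  then show "e1 \<noteq> 0" by auto
qed

lemma diagonal_e: "blinfun_apply (diagonal e1 e2 a b) e1 = a *\<^sub>R e1" "blinfun_apply (diagonal e1 e2 a b) e2 = b *\<^sub>R e2"
  by (simp_all add: diagonal_apply e scaleC_0_1 scaleR_diff_left)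

lemma diagonal_compose:
  "blinfun_apply (diagonal e1 e2 a b) (diagonal e1 e2 a' b' x) = diagonal e1 e2 (a * a') (b * b') x"
proof -
  have "cinner (diagonal e1 e2 a' b' x) e1 = of_real a' * cinner x e1"
    "cinner (diagonal e1 e2 a' b' x) e2 = of_real b' * cinner x e2"
    by (simp_all add: diagonal_apply cinner_simps e algebra_simps)
  then have "diagonal e1 e2 a b (diagonal e1 e2 a' b' x) = diagonal e1 e2 a' b' x
      + (a - 1) *\<^sub>R a' *\<^sub>R (cinner x e1 *\<^sub>C e1) + (b - 1) *\<^sub>R b' *\<^sub>R (cinner x e2 *\<^sub>C e2)"
    by (simp only: diagonal_apply[of a b] scaleC_scaleC[symmetric] scaleC_of_real)
  then show ?thesis by (simp add: diagonal_apply algebra_simps)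
qed

lemma diagonal_inverse:
  assumes "a \<noteq> 0" "b \<noteq> 0"
  shows "blinfun_apply (diagonal e1 e2 a b) (diagonal e1 e2 (1 / a) (1 / b) x) = x"
  using assms by (simp add: diagonal_compose) (simp add: diagonal_apply)

section \<open>Two unit vectors symmetric about \<open>e1\<close>\<close>

definition vec_p :: "real \<Rightarrow> 'h" where "vec_p s = sqrt s *\<^sub>R e1 + sqrt (1 - s) *\<^sub>R e2"
definition vec_q :: "real \<Rightarrow> 'h" where "vec_q s = sqrt s *\<^sub>R e1 - sqrt (1 - s) *\<^sub>R e2"

text \<open>By reflection symmetry the \<open>e2\<close> components cancel, so \<open>e1\<close> is
  an eigenvector of the sum of the two projections. Its eigenvalue \<open>2 * s\<close> produces the
  weight \<open>s\<close> in midpoints.\<close>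

lemma vec_pq:
  assumes "0 \<le> s" "s \<le> 1"
  shows "cinner (vec_p s) (vec_p s) = 1" "cinner (vec_q s) (vec_q s) = 1"
    "cinner e1 (vec_p s) = sqrt s" "cinner e1 (vec_q s) = sqrt s"
    "blinfun_apply (rank_one (vec_p s) (vec_p s)) e1 + blinfun_apply (rank_one (vec_q s) (vec_q s)) e1 = (2 * s) *\<^sub>R e1"
proof -
  have r: "complex_of_real (sqrt s) * complex_of_real (sqrt s) = of_real s"
    "complex_of_real (sqrt (1 - s)) * complex_of_real (sqrt (1 - s)) = 1 - of_real s"
    using assms by (simp_all flip: of_real_mult)
  then show "cinner (vec_p s) (vec_p s) = 1" "cinner (vec_q s) (vec_q s) = 1"
    by (simp_all add: vec_p_def vec_q_def cinner_simps e)
  show c: "cinner e1 (vec_p s) = sqrt s" "cinner e1 (vec_q s) = sqrt s"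
    by (simp_all add: vec_p_def vec_q_def cinner_simps e)
  have "sqrt s *\<^sub>R vec_p s + sqrt s *\<^sub>R vec_q s = (sqrt s * sqrt s) *\<^sub>R e1 + (sqrt s * sqrt s) *\<^sub>R e1"
    by (simp add: vec_p_def vec_q_def algebra_simps)
  also have "\<dots> = (2 * s) *\<^sub>R e1" using assms by (simp flip: scaleR_add_left)
  finally show "rank_one (vec_p s) (vec_p s) e1 + rank_one (vec_q s) (vec_q s) e1 = (2 * s) *\<^sub>R e1"
    by (simp only: rank_one_apply c scaleC_of_real)
qed

end

section \<open>From the mean inequality to monotonicity\<close>

context
  fixes f h :: "real \<Rightarrow> real" and V1 V2 W1 W2 :: "'h::complex_hilbert_space \<Rightarrow>\<^sub>L 'h" and e1 e2 :: 'h
  assumes f_cont: "continuous_on {0<..} f" and f_nonneg: "\<forall>t>0. 0 \<le> f t"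
    and e: "cinner e1 e1 = 1" "cinner e2 e2 = 1" "cinner e1 e2 = 0" "cinner e2 e1 = 0"
    and D: "doubling V1 V2 W1 W2"
    and h: "continuous_on {0..} h" "\<forall>t\<ge>0. 0 \<le> h t" "h 1 = 1"
      "operator_monotone_on (positive_operators :: ('h \<Rightarrow>\<^sub>L 'h) set) h"
      "\<forall>A\<in>positive_invertible_operators. \<forall>B\<in>positive_invertible_operators.
        mean_formula h A B = mean_formula h B (A :: 'h \<Rightarrow>\<^sub>L 'h)"
    and mean_ineq: "\<And>(A :: 'h \<Rightarrow>\<^sub>L 'h) B x. A \<in> strictly_positive \<Longrightarrow> B \<in> strictly_positive \<Longrightarrow>
      ip (fun_calc f (A \<triangledown> B) x) x \<le> ip (mean_of h (fun_calc f A) (fun_calc f B) x) x"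
begin

lemmas e_simps = unit_vectors[OF e]
lemmas h_facts = D e_simps(6) h
lemmas f_positive = fun_calc_nonneg_above[OF f_cont f_nonneg]

lemma h_cont_Ioi: "continuous_on {0<..} h"
  using h(1) by (rule continuous_on_subset) auto

lemma midpoint_convex:
  fixes A B :: "'h \<Rightarrow>\<^sub>L 'h"
  assumes "A \<in> strictly_positive" "B \<in> strictly_positive"
  shows "ip (fun_calc f (A \<triangledown> B) x) x \<le> (ip (fun_calc f A x) x + ip (fun_calc f B x) x) / 2"
proof -
  have "ip (fun_calc f (A \<triangledown> B) x) x \<le> ip (mean_of h (fun_calc f A) (fun_calc f B) x) x"
    by (rule mean_ineq[OF assms])
  also have "\<dots> \<le> ip ((fun_calc f A \<triangledown> fun_calc f B) x) x"
    by (rule mean_of_le_arithmetic[OF h_facts f_positive[OF assms(1)] f_positive[OF assms(2)]])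
  finally show ?thesis by (simp add: arithmetic_mean_def blinfun.bilinear_simps ip_simps)
qed

text \<open>With \<open>A\<close>, \<open>B\<close> having eigenvalue \<open>x\<close> on \<open>p\<close>, \<open>q\<close> respectively and \<open>y\<close> on the complement,
  \<open>e1\<close> is an eigenvector of the midpoint.\<close>

lemma fun_calc_midpoint_pq:
  assumes s: "0 \<le> s" "s \<le> 1" and "x > 0" "y > 0"
    and A: "A = y *\<^sub>R id_blinfun + (x - y) *\<^sub>R rank_one (vec_p e1 e2 s) (vec_p e1 e2 s)"
    and B: "B = y *\<^sub>R id_blinfun + (x - y) *\<^sub>R rank_one (vec_q e1 e2 s) (vec_q e1 e2 s)"
  shows "A \<in> strictly_positive" "B \<in> strictly_positive"
    "ip (fun_calc f (A \<triangledown> B) e1) e1 = f (s * x + (1 - s) * y)"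
proof -
  note pq = vec_pq[OF e s]
  show AB: "A \<in> strictly_positive" "B \<in> strictly_positive"
    unfolding A B using assms pq by (auto intro!: rank_one_perturbation_strictly_positive)
  have "(A \<triangledown> B) e1 = y *\<^sub>R e1 + ((x - y) / 2) *\<^sub>R (rank_one (vec_p e1 e2 s) (vec_p e1 e2 s) e1
      + rank_one (vec_q e1 e2 s) (vec_q e1 e2 s) e1)"
    unfolding A B arithmetic_mean_def
    by (simp add: plus_blinfun.rep_eq scaleR_blinfun.rep_eq scaleR_add_right del: rank_one_apply)
      (simp flip: scaleR_add_left)
  also have "\<dots> = (s * x + (1 - s) * y) *\<^sub>R e1"
  proof -
    have "y + (x - y) / 2 * (2 * s) = s * x + (1 - s) * y" by (simp add: field_simps)
    then show ?thesis unfolding pq(5) by (simp only: scaleR_scaleR scaleR_add_left[symmetric])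
  qed
  finally have "(A \<triangledown> B) e1 = (s * x + (1 - s) * y) *\<^sub>R e1" .
  from above_fun_calc_eigenvector[OF arithmetic_mean_strictly_positive[OF AB] up_closed_Ioi f_cont this]
  show "ip (fun_calc f (A \<triangledown> B) e1) e1 = f (s * x + (1 - s) * y)"
    by (simp add: ip_simps e_simps)
qed

text \<open>Midpoint convexity for operators yields every weight at once: \<open>e1\<close> has
  squared overlap \<open>s\<close> with both \<open>p\<close> and \<open>q\<close>, so f(A) and f(B)
  have the convex combination as their form at \<open>e1\<close>, while \<open>e1\<close> is an
  eigenvector of the midpoint.\<close>

lemma f_convex:
  assumes s: "0 \<le> s" "s \<le> 1" and xy: "x > 0" "y > 0"
  shows "f (s * x + (1 - s) * y) \<le> s * f x + (1 - s) * f y"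
proof -
  note pq = vec_pq[OF e s]
  define A where "A = y *\<^sub>R id_blinfun + (x - y) *\<^sub>R rank_one (vec_p e1 e2 s) (vec_p e1 e2 s)"
  define B where "B = y *\<^sub>R id_blinfun + (x - y) *\<^sub>R rank_one (vec_q e1 e2 s) (vec_q e1 e2 s)"
  note AB = fun_calc_midpoint_pq[OF s xy A_def B_def]
  have fAB: "ip (fun_calc f A e1) e1 = f y + (f x - f y) * s" "ip (fun_calc f B e1) e1 = f y + (f x - f y) * s"
    unfolding A_def B_def using fun_calc_rank_one_perturbation[OF pq(1), of y "x - y" f]
      fun_calc_rank_one_perturbation[OF pq(2), of y "x - y" f] f_cont xy s
    by (simp_all add: plus_blinfun.rep_eq scaleR_blinfun.rep_eq ip_simps ip_rank_one_self pq e_simps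
        del: rank_one_apply)
  then show ?thesis
    using midpoint_convex[OF AB(1,2), of e1] unfolding AB(3) by (simp add: algebra_simps)
qed

text \<open>After the congruence by the diagonal \<open>S\<close> mapping \<open>p\<close>, \<open>q\<close> to orthonormal vectors, the mean can be
  computed on common eigenvectors.\<close>

lemma key_estimate:
  assumes s: "0 < s" "s < 1"
  obtains l where "l > 0"
    "\<forall>x>0. f (s * x + (1 - s)) \<le> 2 * s * ((f x + l) * h (l / (f x + l)))"
proof -
  have s': "0 \<le> s" "s \<le> 1" using s by auto
  let ?p = "vec_p e1 e2 s" and ?q = "vec_q e1 e2 s"
  note pq = vec_pq[OF e s']
  \<comment> \<open>The factors make \<open>S\<close> map \<open>p\<close> and \<open>q\<close> to
    the orthonormal vectors \<open>u\<close> and \<open>v\<close> below;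
    \<open>a\<^sup>2 = 2 * s\<close> becomes the constant of the estimate.\<close>
  define a where "a = sqrt 2 * sqrt s"
  define b where "b = sqrt 2 * sqrt (1 - s)"
  have ab: "a > 0" "b > 0" using s by (auto simp: a_def b_def)
  define S where "S = diagonal e1 e2 (1 / a) (1 / b)"
  define S' where "S' = diagonal e1 e2 a b"
  have S: "self_adjoint S" unfolding S_def by (rule self_adjoint_diagonal)
  have S': "S' (S x) = x" "S (S' x) = x" for x
    unfolding S_def S'_def
    using diagonal_inverse[OF e, of a b x] diagonal_inverse[OF e, of "1 / a" "1 / b" x] ab by simp_all
  define u where "u = (1 / sqrt 2) *\<^sub>R (e1 + e2)"
  define v where "v = (1 / sqrt 2) *\<^sub>R (e1 - e2)"
  have sqrt2: "complex_of_real (sqrt 2) * complex_of_real (sqrt 2) = 2" by (simp flip: of_real_mult)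
  have uv: "cinner u u = 1" "cinner v v = 1" "cinner u v = 0" "cinner v u = 0"
    by (simp_all add: u_def v_def cinner_simps e sqrt2)
  have Sp: "S ?p = u" and Sq: "S ?q = v"
    using s by (simp_all add: vec_p_def[OF e] vec_q_def[OF e] u_def v_def blinfun.bilinear_simps S_def
        diagonal_e[OF e] a_def b_def scaleR_add_right scaleR_diff_right)
  \<comment> \<open>f(A) plus the identity is \<open>f 1 + 1\<close> times the identity plus
    \<open>f x - f 1\<close> times the projection onto \<open>p\<close>. Dropping the term with
    \<open>- f 1\<close> leaves an upper bound with constant part \<open>\<kappa>\<close>.\<close>
  define \<kappa> where "\<kappa> = f 1 + 1"
  have f1: "f 1 \<ge> 0" using f_nonneg by simp
  have \<kappa>: "\<kappa> > 0" using f1 by (simp add: \<kappa>_def)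
  define L where "L = (norm S)\<^sup>2"
  have "S \<noteq> 0"
  proof
    assume "S = 0"
    then have "e1 = 0" using S'(1)[of e1] by simp
    then show False using e_simps(6) by simp
  qed
  then have L: "L > 0" by (simp add: L_def)
  \<comment> \<open>The congruence turns the constant part into \<open>\<kappa> S^2\<close>, which
    is at most \<open>l\<close>. This is independent of \<open>x\<close>, hence negligible once
    \<open>f x\<close> is large.\<close>
  define l where "l = \<kappa> * L"
  have l: "l > 0" using \<kappa> L by (simp add: l_def)
  have "f (s * x + (1 - s)) \<le> 2 * s * ((f x + l) * h (l / (f x + l)))" if x: "x > 0" for x
  proof -
    define F where "F = f x"
    have F: "F \<ge> 0" using f_nonneg x by (simp add: F_def)
    define A where "A = 1 *\<^sub>R id_blinfun + (x - 1) *\<^sub>R rank_one ?p ?p"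
    define B where "B = 1 *\<^sub>R id_blinfun + (x - 1) *\<^sub>R rank_one ?q ?q"
    note AB = fun_calc_midpoint_pq[OF s' x zero_less_one A_def B_def]
    define P where "P = (\<lambda>k r. k *\<^sub>R id_blinfun + F *\<^sub>R rank_one r (r::'h))"
    have P_pos: "P k r \<in> strictly_positive" if "k > 0" "cinner r r = 1" for k r
      unfolding P_def using that F by (intro rank_one_perturbation_strictly_positive) auto
    have P_ip: "ip (P k r z) z = k * (norm z)\<^sup>2 + F * (cmod (cinner z r))\<^sup>2" for k r z
      by (simp add: P_def plus_blinfun.rep_eq scaleR_blinfun.rep_eq ip_simps ip_rank_one_self ip_self
          del: rank_one_apply)
    have le_P: "ip ((fun_calc f (1 *\<^sub>R id_blinfun + (x - 1) *\<^sub>R rank_one r r) + 1 *\<^sub>R id_blinfun) z) z \<le> ip (P \<kappa> r z) z"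
      if r: "cinner r r = 1" for r z
    proof -
      have px: "0 < 1 + (x - 1)" using x by simp
      have "0 \<le> f 1 * (cmod (cinner z r))\<^sup>2" using f1 by simp
      then show ?thesis
        unfolding P_ip fun_calc_rank_one_perturbation[OF r zero_less_one px f_cont]
        by (simp add: blinfun.bilinear_simps ip_simps ip_rank_one_self ip_self
            F_def \<kappa>_def algebra_simps del: rank_one_apply)
    qed
    have SP_le: "ip ((S o\<^sub>L P \<kappa> r o\<^sub>L S) z) z \<le> ip (P l (S r) z) z" for r z
    proof -
      have "(norm (S z))\<^sup>2 \<le> L * (norm z)\<^sup>2"
        unfolding L_def by (metis power_mono norm_ge_zero power_mult_distrib norm_blinfun)
      then have "\<kappa> * (norm (S z))\<^sup>2 \<le> l * (norm z)\<^sup>2"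
        using \<kappa> mult_left_mono[of _ _ \<kappa>] by (simp add: l_def mult.assoc)
      moreover have "ip ((S o\<^sub>L P \<kappa> r o\<^sub>L S) z) z = ip (P \<kappa> r (S z)) (S z)"
        by (simp add: self_adjoint_ip[OF S])
      ultimately show ?thesis unfolding P_ip by (simp add: P_ip self_adjoint_cinner[OF S])
    qed
    have \<kappa>_pos: "P \<kappa> ?p \<in> strictly_positive" "P \<kappa> ?q \<in> strictly_positive"
      using P_pos[OF \<kappa>] pq by auto
    have l_pos: "P l u \<in> strictly_positive" "P l v \<in> strictly_positive"
      using P_pos[OF l] uv by auto
    have S_pos: "S o\<^sub>L P \<kappa> ?p o\<^sub>L S \<in> strictly_positive" "S o\<^sub>L P \<kappa> ?q o\<^sub>L S \<in> strictly_positive"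
      using sandwich_strictly_positive[OF S S'(1)] \<kappa>_pos by auto
    define G where "G = (F + l) * h (l / (F + l))"
    have Fl: "F + l > 0" using F l by simp
    have P_eig: "P l u u = (F + l) *\<^sub>R u" "P l v v = (F + l) *\<^sub>R v" "P l u v = l *\<^sub>R v" "P l v u = l *\<^sub>R u"
      by (simp_all add: scaleC_0_1 P_def plus_blinfun.rep_eq scaleR_blinfun.rep_eq uv scaleR_add_left)
    have "mean_formula h (P l u) (P l v) u = G *\<^sub>R u"
      using mean_formula_common_eigenvector[OF l_pos h_cont_Ioi P_eig(1,4) Fl] by (simp add: G_def)
    moreover have "mean_formula h (P l u) (P l v) v = G *\<^sub>R v"
    proof -
      \<comment> \<open>Along \<open>v\<close> the two eigenvalues are interchanged. Symmetry of
        \<open>h\<close> yields the same value \<open>G\<close>, so the mean acts as the scalar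
        \<open>G\<close> on the whole plane, in particular on \<open>e1\<close>.\<close>
      have "l * h ((F + l) / l) = G"
        using mean_sym[OF h_facts, of "(F + l) / l"] Fl l by (simp add: G_def)
      then show ?thesis
        using mean_formula_common_eigenvector[OF l_pos h_cont_Ioi P_eig(3,2) l] by simp
    qed
    moreover have e1: "e1 = (1 / sqrt 2) *\<^sub>R (u + v)"
      by (simp add: u_def v_def algebra_simps) (simp flip: scaleR_add_left)
    ultimately have mean_e1: "mean_formula h (P l u) (P l v) e1 = G *\<^sub>R e1"
      by (simp only: e1 blinfun.scaleR_right blinfun.add_right) (simp add: scaleR_add_right mult.commute)
    have e1_S: "e1 = S (a *\<^sub>R e1)" using ab by (simp add: S_def diagonal_e[OF e] blinfun.scaleR_right)
    have "f (s * x + (1 - s)) = ip (fun_calc f (A \<triangledown> B) e1) e1" using AB(3) by simp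
    also have "\<dots> \<le> ip (mean_of h (fun_calc f A) (fun_calc f B) e1) e1" by (rule mean_ineq[OF AB(1,2)])
    \<comment> \<open>The regularization parameter stays fixed at 1; its cost is contained in
      \<open>\<kappa>\<close>.\<close>
    also have "\<dots> \<le> ip (mean_formula h (fun_calc f A + 1 *\<^sub>R id_blinfun) (fun_calc f B + 1 *\<^sub>R id_blinfun) e1) e1"
      by (rule mean_of_le_regularized[OF h_facts f_positive[OF AB(1)] f_positive[OF AB(2)]]) simp
    also have "\<dots> \<le> ip (mean_formula h (P \<kappa> ?p) (P \<kappa> ?q) e1) e1"
      unfolding A_def B_def
      by (intro mean_formula_mono[OF h_facts] add_id_strictly_positive \<kappa>_pos le_P pq
          f_positive[OF AB(1), unfolded A_def] f_positive[OF AB(2), unfolded B_def] zero_less_one)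
    also have "\<dots> = ip ((S o\<^sub>L mean_formula h (P \<kappa> ?p) (P \<kappa> ?q) o\<^sub>L S) (a *\<^sub>R e1)) (a *\<^sub>R e1)"
      by (subst (1 2) e1_S) (simp add: self_adjoint_ip[OF S])
    also have "\<dots> = ip (mean_formula h (S o\<^sub>L P \<kappa> ?p o\<^sub>L S) (S o\<^sub>L P \<kappa> ?q o\<^sub>L S) (a *\<^sub>R e1)) (a *\<^sub>R e1)"
      by (simp only: mean_formula_congruence[OF \<kappa>_pos h_cont_Ioi S S'])
    also have "\<dots> \<le> ip (mean_formula h (P l u) (P l v) (a *\<^sub>R e1)) (a *\<^sub>R e1)"
      using SP_le[of ?p] SP_le[of ?q] unfolding Sp Sq
      by (intro mean_formula_mono[OF h_facts] S_pos l_pos)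
    also have "\<dots> = a\<^sup>2 * G"
      by (simp add: blinfun.scaleR_right mean_e1 ip_simps e_simps power2_eq_square)
    also have "a\<^sup>2 = 2 * s" using s by (simp add: a_def power_mult_distrib)
    finally show ?thesis by (simp add: G_def F_def)
  qed
  then show thesis using that l by blast
qed

text \<open>The midpoint of \<open>diag(1, \<alpha>)\<close> and a fixed matrix has a large eigenvalue \<open>r\<close> whose eigenvector is not
  orthogonal to \<open>e1\<close>; this forces at most quadratic growth.\<close>

lemma quadratic_growth:
  obtains K where "K \<ge> 0" "\<forall>r\<ge>2. f r \<le> K * r\<^sup>2"
proof -
  define v where "v = (1 / sqrt 2) *\<^sub>R (e1 + e2)"
  have sqrt2: "complex_of_real (sqrt 2) * complex_of_real (sqrt 2) = 2" by (simp flip: of_real_mult)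
  have v: "cinner v v = 1" by (simp add: v_def cinner_simps e sqrt2)
  \<comment> \<open>On the plane, \<open>B\<close> is the matrix with diagonal entries 2 and
    off-diagonal entries 1.\<close>
  define B where "B = 1 *\<^sub>R id_blinfun + 2 *\<^sub>R rank_one v v"
  have B: "B \<in> strictly_positive"
    unfolding B_def by (rule rank_one_perturbation_strictly_positive[OF v]) auto
  have B_apply: "B (x *\<^sub>R e1 + y *\<^sub>R e2) = (x *\<^sub>R e1 + y *\<^sub>R e2) + (x + y) *\<^sub>R (e1 + e2)" for x y
  proof -
    have c: "cinner (x *\<^sub>R e1 + y *\<^sub>R e2) v = of_real ((x + y) / sqrt 2)"
      by (simp add: v_def cinner_simps e add_divide_distrib)
    have "2 *\<^sub>R rank_one v v (x *\<^sub>R e1 + y *\<^sub>R e2) = 2 *\<^sub>R ((x + y) / sqrt 2) *\<^sub>R v"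
      by (simp only: rank_one_apply c scaleC_of_real)
    also have "\<dots> = (x + y) *\<^sub>R (e1 + e2)" by (simp add: v_def add_divide_distrib)
    finally show ?thesis by (simp add: B_def plus_blinfun.rep_eq scaleR_blinfun.rep_eq del: rank_one_apply)
  qed
  define K where "K = (f 1 + ip (fun_calc f B e1) e1) / 2"
  have fB: "ip (fun_calc f B e1) e1 \<ge> 0"
    using f_positive[OF B] by (simp add: positive_operators_iff flip: positive_operators_eq)
  have K: "K \<ge> 0" using fB f_nonneg by (simp add: K_def)
  have "f r \<le> 4 * K * r\<^sup>2" if r: "r \<ge> 2" for r
  proof -
    \<comment> \<open>These values make \<open>e1 + t e2\<close> an eigenvector of
      \<open>A + B\<close> for \<open>3 + t = 2 * r\<close>: the second coordinate of that equation
      determines \<open>\<alpha>\<close>. From \<open>r \<ge> 2\<close> follow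
      \<open>t \<ge> 1\<close> and \<open>\<alpha> > 0\<close>.\<close>
    define t where "t = 2 * r - 3"
    have t: "t \<ge> 1" using r by (simp add: t_def)
    define \<alpha> where "\<alpha> = 1 + t - 1 / t"
    have "1 / t \<le> 1" using t by simp
    then have \<alpha>: "\<alpha> > 0" using t unfolding \<alpha>_def by linarith
    define A where "A = 1 *\<^sub>R id_blinfun + (\<alpha> - 1) *\<^sub>R rank_one e2 e2"
    have A: "A \<in> strictly_positive"
      unfolding A_def using \<alpha> by (intro rank_one_perturbation_strictly_positive[OF e(2)]) auto
    have A_e: "A e1 = 1 *\<^sub>R e1" "A e2 = \<alpha> *\<^sub>R e2"
      by (simp_all add: A_def blinfun.bilinear_simps e scaleC_0_1 scaleR_diff_left)
    define u where "u = 1 *\<^sub>R e1 + t *\<^sub>R e2"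
    have "A u + B u = (3 + t) *\<^sub>R u"
    proof -
      have t\<alpha>: "t * \<alpha> = t + t * t - 1" using t by (simp add: \<alpha>_def field_simps)
      have "A u = 1 *\<^sub>R e1 + (t * \<alpha>) *\<^sub>R e2" by (simp add: u_def blinfun.bilinear_simps A_e)
      moreover have "B u = (2 + t) *\<^sub>R e1 + (2 * t + 1) *\<^sub>R e2"
      proof -
        have "2 + t = 1 + (1 + t)" "2 * t + 1 = t + (1 + t)" by simp_all
        then show ?thesis
          unfolding u_def B_apply scaleR_add_right by (simp only: scaleR_add_left) (simp add: add_ac)
      qed
      ultimately have "A u + B u = (1 + (2 + t)) *\<^sub>R e1 + (t * \<alpha> + (2 * t + 1)) *\<^sub>R e2"
        by (simp only: scaleR_add_left add_ac)
      also have "1 + (2 + t) = 3 + t" by simp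
      also have "t * \<alpha> + (2 * t + 1) = (3 + t) * t" unfolding t\<alpha> by (simp add: algebra_simps)
      also have "(3 + t) *\<^sub>R e1 + ((3 + t) * t) *\<^sub>R e2 = (3 + t) *\<^sub>R u" by (simp add: u_def scaleR_add_right)
      finally show ?thesis .
    qed
    then have "(A \<triangledown> B) u = r *\<^sub>R u"
      by (simp add: arithmetic_mean_def blinfun.bilinear_simps t_def)
    let ?M = "fun_calc f (A \<triangledown> B)"
    from above_fun_calc_eigenvector[OF arithmetic_mean_strictly_positive[OF A B] up_closed_Ioi f_cont \<open>(A \<triangledown> B) u = r *\<^sub>R u\<close>]
    have Mu: "?M u = f r *\<^sub>R u" .
    have M: "self_adjoint ?M" "0 \<le> ip (?M x) x" for x
      using f_positive[OF arithmetic_mean_strictly_positive[OF A B]]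
      by (simp_all add: positive_operators_iff flip: positive_operators_eq)
    have "fun_calc f A e1 = f 1 *\<^sub>R e1"
      by (rule above_fun_calc_eigenvector[OF A up_closed_Ioi f_cont A_e(1)])
    then have "ip (?M e1) e1 \<le> K"
      using midpoint_convex[OF A B, of e1] by (simp add: K_def ip_simps e_simps)
    \<comment> \<open>As \<open>u\<close> is an eigenvector of \<open>?M\<close> for
      \<open>f r\<close>, Cauchy-Schwarz for the form of \<open>?M\<close> at \<open>u\<close> and
      \<open>e1\<close> bounds \<open>f r\<close> by the squared norm of \<open>u\<close> times the
      fixed number \<open>K\<close>.\<close>
    moreover have "ip u e1 = 1" "ip u u = 1 + t\<^sup>2"
      by (simp_all add: u_def ip_simps e_simps power2_eq_square)
    then have "(f r)\<^sup>2 \<le> (f r * (1 + t\<^sup>2)) * ip (?M e1) e1"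
      using positive_Cauchy_Schwarz[OF M, of u e1] by (simp add: Mu ip_simps)
    ultimately have "f r * f r \<le> f r * ((1 + t\<^sup>2) * K)"
      using f_nonneg r mult_left_mono[of "ip (?M e1) e1" K "f r * (1 + t\<^sup>2)"]
      by (simp add: power2_eq_square mult.assoc)
    then have "f r \<le> (1 + t\<^sup>2) * K"
    proof (cases "f r = 0")
      case True
      then show ?thesis using K by simp
    next
      case False
      then have "f r > 0" using f_nonneg[rule_format, of r] r by simp
      then show ?thesis using \<open>f r * f r \<le> f r * ((1 + t\<^sup>2) * K)\<close> by simp
    qed
    also have "\<dots> \<le> (4 * r\<^sup>2) * K"
      using r K by (intro mult_right_mono) (simp_all add: t_def power2_eq_square algebra_simps)
    finally show ?thesis by (simp add: mult_ac)
  qed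
  then show thesis using that[of "4 * K"] K by simp
qed

text \<open>If \<open>1 / 2 \<le> h 0\<close>, concavity between 0 and 1 lifts \<open>h\<close> to
  its upper bound, the arithmetic function, on \<open>(0, 1]\<close>; symmetry extends the equality
  to all \<open>t > 0\<close>.\<close>

lemma h_0_less:
  assumes "\<exists>t>0. h t \<noteq> (1 + t) / 2"
  shows "h 0 < 1 / 2"
proof (rule ccontr)
  assume h0: "\<not> h 0 < 1 / 2"
  have small: "h t = (1 + t) / 2" if t: "0 < t" "t \<le> 1" for t
  proof -
    have "(1 - t) * h 0 + t * h 1 \<le> h ((1 - t) * 0 + t * 1)"
      by (rule mean_concave[OF h_facts]) (use t in auto)
    moreover have "(1 - t) * (1 / 2) \<le> (1 - t) * h 0" using t h0 by (intro mult_left_mono) auto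
    ultimately have "(1 + t) / 2 \<le> h t" using h(3) by (simp add: field_simps)
    then show ?thesis using mean_le[OF h_facts t(1)] by simp
  qed
  have "h t = (1 + t) / 2" if t: "0 < t" for t
  proof (cases "t \<le> 1")
    case False
    then have "h (1 / t) = (1 + 1 / t) / 2" using t by (intro small) auto
    then show ?thesis using mean_sym[OF h_facts t] t by (simp add: field_simps)
  qed (rule small[OF t])
  then show False using assms by blast
qed

text \<open>Convexity turns a single increase into linear growth. This supplies the unboundedness
  needed to replace \<open>h (l / (f x + l))\<close> by \<open>h 0\<close> in the limit.\<close>

lemma f_antimono:
  assumes strict: "\<exists>t>0. h t \<noteq> (1 + t) / 2" and ab: "0 < a" "a \<le> b"
  shows "f b \<le> f a"
proof (rule ccontr)
  assume "\<not> f b \<le> f a"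
  then have fab: "f a < f b" "a < b" using ab by (auto simp: less_eq_real_def)
  define d where "d = (f b - f a) / (b - a)"
  have d: "d > 0" using fab by (simp add: d_def)
  have linear: "f a + d * (x - a) \<le> f x" if "x > b" for x
  proof -
    define s where "s = (b - a) / (x - a)"
    have s: "0 < s" "s \<le> 1" using that fab by (auto simp: s_def)
    have sx: "s * (x - a) = b - a" using that fab by (simp add: s_def)
    have "s * x + (1 - s) * a = b" using sx by (simp add: algebra_simps)
    then have "f b \<le> s * f x + (1 - s) * f a"
      using f_convex[of s x a] s ab that by simp
    moreover have "d * (b - a) = f b - f a" using fab by (simp add: d_def)
    ultimately have "d * (b - a) \<le> s * (f x - f a)" by (simp add: algebra_simps)
    then have "s * (d * (x - a)) \<le> s * (f x - f a)" by (simp add: sx[symmetric] mult_ac)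
    then show ?thesis using s by simp
  qed
  have f_top: "filterlim f at_top at_top"
  proof (rule filterlim_at_top_mono)
    show "filterlim (\<lambda>x. f a + d * (x - a)) at_top at_top" using d by real_asymp
    show "\<forall>\<^sub>F x in at_top. f a + d * (x - a) \<le> f x"
      using eventually_gt_at_top[of b] by eventually_elim (rule linear)
  qed
  \<comment> \<open>A number strictly between \<open>2 * h 0\<close> and 1; its distance from
    \<open>2 * h 0\<close> absorbs the error terms of the limit.\<close>
  define k where "k = (1 + 2 * h 0) / 2"
  have h0: "0 \<le> h 0" "h 0 < 1 / 2" using h(2) h_0_less[OF strict] by auto
  then have k: "2 * h 0 < k" "0 < k" "k < 1" by (auto simp: k_def)
  \<comment> \<open>Strictly between \<open>k\<close> and 1, so that \<open>k / s < 1\<close> at the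
    end.\<close>
  define s where "s = (1 + k) / 2"
  have s: "k < s" "0 < s" "s < 1" using k by (auto simp: s_def)
  obtain l where l: "l > 0"
    and key: "\<forall>x>0. f (s * x + (1 - s)) \<le> 2 * s * ((f x + l) * h (l / (f x + l)))"
    using key_estimate[OF s(2,3)] .
  \<comment> \<open>Adding \<open>l\<close> on both sides leaves an inequality that iterates without
    additive constants; its cost is the summand \<open>(l / b) / s\<close> below.\<close>
  have contract: "\<forall>\<^sub>F x in at_top. f (s * x + (1 - s)) + l \<le> s * k * (f x + l)"
  proof -
    have b_top: "filterlim (\<lambda>x. f x + l) at_top at_top"
      by (rule filterlim_at_top_mono[OF f_top]) (use l in auto)
    have lim0: "((\<lambda>x. l / (f x + l)) \<longlongrightarrow> 0) at_top"
      by (rule tendsto_divide_0[OF tendsto_const filterlim_at_top_imp_at_infinity[OF b_top]])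
    have nonneg: "\<forall>\<^sub>F x in at_top. l / (f x + l) \<in> {0..}"
      using eventually_gt_at_top[of "0::real"] by eventually_elim (use f_nonneg l in \<open>simp add: add_nonneg_pos less_imp_le\<close>)
    have "((\<lambda>x. h (l / (f x + l))) \<longlongrightarrow> h 0) at_top"
      by (rule continuous_on_tendsto_compose[OF h(1) lim0 _ nonneg]) simp
    then have "((\<lambda>x. 2 * h (l / (f x + l)) + (l / (f x + l)) / s) \<longlongrightarrow> 2 * h 0 + 0 / s) at_top"
      by (intro tendsto_intros lim0) (use s in auto)
    then have "\<forall>\<^sub>F x in at_top. 2 * h (l / (f x + l)) + (l / (f x + l)) / s < k"
      using order_tendstoD(2)[of _ _ _ k] k(1) by fastforce
    then show ?thesis
      using eventually_gt_at_top[of "0::real"]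
    proof eventually_elim
      case (elim x)
      define b where "b = f x + l"
      have b: "b > 0" using f_nonneg elim(2) l by (simp add: b_def add_nonneg_pos)
      have "f (s * x + (1 - s)) + l \<le> s * b * (2 * h (l / b) + (l / b) / s)"
        using key[rule_format, OF elim(2)] b s by (simp add: b_def[symmetric] distrib_left mult_ac)
      also have "\<dots> \<le> s * b * k"
        using elim(1) b s by (intro mult_left_mono) (auto simp: b_def)
      finally show ?case by (simp add: b_def mult_ac)
    qed
  qed
  then obtain X where X: "\<And>x. x \<ge> X \<Longrightarrow> f (s * x + (1 - s)) + l \<le> s * k * (f x + l)"
    by (auto simp: eventually_at_top_linorder)
  obtain K where K: "K \<ge> 0" "\<forall>r\<ge>2. f r \<le> K * r\<^sup>2" using quadratic_growth .
  define Z where "Z = max X 2"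
  \<comment> \<open>The solution of \<open>s * x (Suc n) + (1 - s) = x n\<close> with
    \<open>x 0 = Z\<close>; the affine map has fixed point 1.\<close>
  define x where "x = (\<lambda>n. 1 + (Z - 1) / s ^ n)"
  have x_ge: "x n \<ge> Z" for n
  proof -
    have "(Z - 1) * s ^ n \<le> (Z - 1) * 1"
      using s by (intro mult_left_mono power_le_one) (auto simp: Z_def)
    then show ?thesis using s by (simp add: x_def field_simps)
  qed
  have x_le: "x n \<le> Z / s ^ n" for n
  proof -
    have "s ^ n \<le> 1" using s by (intro power_le_one) auto
    then show ?thesis using s by (simp add: x_def field_simps)
  qed
  have x_step: "s * x (Suc n) + (1 - s) = x n" for n using s by (simp add: x_def field_simps)
  have iterate: "f (x 0) + l \<le> (s * k) ^ n * (f (x n) + l)" for n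
  proof (induction n)
    case (Suc n)
    have "f (x n) + l \<le> s * k * (f (x (Suc n)) + l)"
      using X[of "x (Suc n)"] x_ge[of "Suc n"] by (simp add: x_step Z_def)
    then have "(s * k) ^ n * (f (x n) + l) \<le> (s * k) ^ n * (s * k * (f (x (Suc n)) + l))"
      using s k by (intro mult_left_mono) auto
    then show ?case using Suc.IH by (simp add: mult_ac)
  qed simp
  \<comment> \<open>Iteration contributes \<open>(s * k) ^ n\<close>, quadratic growth contributes
    \<open>1 / (s ^ n)\<^sup>2\<close>, and the product is \<open>(k / s) ^ n\<close>.\<close>
  have bound: "f (x 0) + l \<le> (k / s) ^ n * (K * Z\<^sup>2 + l)" for n
  proof -
    have "f (x n) \<le> K * (x n)\<^sup>2" using x_ge[of n] by (intro K(2)[rule_format]) (simp add: Z_def)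
    also have "\<dots> \<le> K * (Z / s ^ n)\<^sup>2"
      using x_le[of n] x_ge[of n] K by (intro mult_left_mono power_mono) (auto simp: Z_def)
    finally have "f (x n) \<le> K * Z\<^sup>2 / (s ^ n)\<^sup>2" by (simp add: power_divide)
    moreover have "l \<le> l / (s ^ n)\<^sup>2"
      using l s by (simp add: field_simps power_le_one flip: power_mult)
    ultimately have "f (x n) + l \<le> (K * Z\<^sup>2 + l) / (s ^ n)\<^sup>2" by (simp add: add_divide_distrib)
    then have "(s * k) ^ n * (f (x n) + l) \<le> (s * k) ^ n * ((K * Z\<^sup>2 + l) / (s ^ n)\<^sup>2)"
      using s k by (intro mult_left_mono) auto
    also have "\<dots> = (k / s) ^ n * (K * Z\<^sup>2 + l)"
      using s by (simp add: power_mult_distrib power_divide power2_eq_square)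
    finally show ?thesis using iterate[of n] by linarith
  qed
  have "(\<lambda>n. (k / s) ^ n * (K * Z\<^sup>2 + l)) \<longlonglongrightarrow> 0 * (K * Z\<^sup>2 + l)"
    using s k by (intro tendsto_mult LIMSEQ_realpow_zero tendsto_const) auto
  then have "f (x 0) + l \<le> 0"
    using bound LIMSEQ_le_const[of _ 0 "f (x 0) + l"] by auto
  moreover have "f (x 0) \<ge> 0" using f_nonneg x_ge[of 0] by (simp add: Z_def)
  ultimately show False using l by simp
qed

text \<open>\<open>B + D\<close> is the dyadic combination \<open>(1 - 2\<^sup>-\<^sup>n) B + 2\<^sup>-\<^sup>n (B + 2\<^sup>n D)\<close>, and \<open>f\<close> is bounded on the second
  operator uniformly in \<open>n\<close>.\<close>

lemma mean_ineq_imp_antitone: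
  assumes strict: "\<exists>t>0. h t \<noteq> (1 + t) / 2"
  shows "operator_monotone_on (strictly_positive :: ('h \<Rightarrow>\<^sub>L 'h) set) (\<lambda>t. - f t)"
  unfolding operator_antitone_iff[OF f_cont f_nonneg]
proof (intro ballI impI)
  fix A B :: "'h \<Rightarrow>\<^sub>L 'h"
  assume A: "A \<in> strictly_positive" and B: "B \<in> strictly_positive" and le: "B \<le>\<^sub>L A"
  obtain m M where m: "0 < m" "B \<in> operators_between m M" using B by (auto simp: operators_above_def)
  have T: "self_adjoint (A - B)" "0 \<le> ip ((A - B) x) x" for x
    using le by (auto simp: loewner_le_def positive_operators_iff)
  define C where "C = (\<lambda>n. B + 2 ^ n *\<^sub>R (A - B))"
  have C: "C n \<in> operators_between m (M + 2 ^ n * norm (A - B))" for n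
  proof (rule operators_betweenI)
    show "self_adjoint (C n)" using T above_self_adjoint[OF B] by (simp add: C_def)
    fix x
    have ip: "ip (C n x) x = ip (B x) x + 2 ^ n * ip ((A - B) x) x"
      by (simp add: C_def plus_blinfun.rep_eq scaleR_blinfun.rep_eq ip_simps del: minus_blinfun.rep_eq)
    show "m * (norm x)\<^sup>2 \<le> ip (C n x) x"
      unfolding ip using operators_betweenD(2)[OF m(2), of x] T(2)[of x] by (simp add: add_increasing2)
    have "2 ^ n * ip ((A - B) x) x \<le> 2 ^ n * (norm (A - B) * (norm x)\<^sup>2)"
      using ip_le_norm[of "A - B" x] by (intro mult_left_mono) auto
    then show "ip (C n x) x \<le> (M + 2 ^ n * norm (A - B)) * (norm x)\<^sup>2"
      unfolding ip distrib_right mult.assoc by (intro add_mono operators_betweenD(3)[OF m(2)])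
  qed
  have C_pos: "C n \<in> strictly_positive" for n using C m(1) by (intro operators_aboveI) auto
  have mid: "B \<triangledown> C (Suc n) = C n" for n
    by (rule blinfun_eqI) (simp add: C_def arithmetic_mean_def blinfun.bilinear_simps scaleR_add_right
        scaleR_diff_right algebra_simps flip: scaleR_add_left)
  \<comment> \<open>All \<open>C n\<close> share the lower bound \<open>m\<close>, and
    \<open>f\<close> is already known to decrease as a scalar function.\<close>
  have C_bound: "ip (fun_calc f (C n) x) x \<le> f m * (norm x)\<^sup>2" for n x
  proof -
    have "ip (fun_calc f (C n) x) x \<le> ip (fun_calc (\<lambda>_. f m) (C n) x) x"
      by (rule fun_calc_le[OF C continuous_on_subinterval[OF up_closed_Ioi _ f_cont] continuous_on_const])
        (use m f_antimono[OF strict] in auto)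
    then show ?thesis by (simp add: fun_calc_const[OF C] blinfun.bilinear_simps ip_simps ip_self)
  qed
  have "ip (fun_calc f A x) x \<le> ip (fun_calc f B x) x" for x
  proof -
    \<comment> \<open>Each step replaces \<open>C n\<close> by the midpoint of \<open>B\<close> and
      \<open>C (Suc n)\<close>, halving the weight of the remote operator; \<open>C 0\<close> is
      \<open>A\<close>.\<close>
    have dyadic: "ip (fun_calc f A x) x \<le> (1 - (1 / 2) ^ n) * ip (fun_calc f B x) x
      + (1 / 2) ^ n * ip (fun_calc f (C n) x) x" for n
    proof (induction n)
      case 0
      then show ?case by (simp add: C_def)
    next
      case (Suc n)
      have "(1 / 2) ^ n * ip (fun_calc f (C n) x) x
          \<le> (1 / 2) ^ n * ((ip (fun_calc f B x) x + ip (fun_calc f (C (Suc n)) x) x) / 2)"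
        using midpoint_convex[OF B C_pos[of "Suc n"], of x] unfolding mid by (intro mult_left_mono) auto
      then show ?case using Suc.IH by (simp add: algebra_simps)
    qed
    have "ip (fun_calc f A x) x \<le> (1 - (1 / 2) ^ n) * ip (fun_calc f B x) x + (1 / 2) ^ n * (f m * (norm x)\<^sup>2)" for n
      by (rule order_trans[OF dyadic add_left_mono[OF mult_left_mono[OF C_bound]]]) simp
    moreover have "(\<lambda>n. (1 - (1 / 2) ^ n) * ip (fun_calc f B x) x + (1 / 2) ^ n * (f m * (norm x)\<^sup>2))
        \<longlonglongrightarrow> (1 - 0) * ip (fun_calc f B x) x + 0 * (f m * (norm x)\<^sup>2)"
      by (intro tendsto_intros LIMSEQ_realpow_zero) auto
    ultimately have "ip (fun_calc f A x) x \<le> (1 - 0) * ip (fun_calc f B x) x + 0 * (f m * (norm x)\<^sup>2)"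
      by (intro LIMSEQ_le_const) auto
    then show ?thesis by simp
  qed
  then show "fun_calc f A \<le>\<^sub>L fun_calc f B"
    using fun_calc_self_adjoint_above[OF A up_closed_Ioi f_cont] fun_calc_self_adjoint_above[OF B up_closed_Ioi f_cont]
    by (simp add: loewner_le_iff)
qed

end

text \<open>Commutativity of \<open>\<sigma>\<close> passes to \<open>mean_formula\<close>, which
  agrees with it on invertible operators; symmetry is used in this form only.\<close>

lemma symmetric_operator_meanE:
  assumes "symmetric_operator_mean (\<sigma> :: ('h::complex_hilbert_space \<Rightarrow>\<^sub>L 'h) \<Rightarrow> _)"
  obtains h where "continuous_on {0..} h" "\<forall>t\<ge>0. 0 \<le> h t" "h 1 = 1"
    "operator_monotone_on (positive_operators :: ('h \<Rightarrow>\<^sub>L 'h) set) h"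
    "\<forall>A\<in>positive_invertible_operators. \<forall>B\<in>positive_invertible_operators.
      mean_formula h A B = mean_formula h B (A :: 'h \<Rightarrow>\<^sub>L 'h)"
    "\<forall>A\<in>positive_operators. \<forall>B\<in>positive_operators. \<sigma> A B = mean_of h A B"
proof -
  obtain h where h: "continuous_on {0..} h" "\<forall>t\<ge>0. 0 \<le> h t" "h 1 = 1"
    "operator_monotone_on (positive_operators :: ('h \<Rightarrow>\<^sub>L 'h) set) h"
    "\<forall>A\<in>positive_operators. \<forall>B\<in>positive_operators. \<sigma> A B = mean_of h A B"
    using assms by (auto simp: symmetric_operator_mean_def operator_mean_def)
  have "mean_formula h A B = mean_formula h B (A :: 'h \<Rightarrow>\<^sub>L 'h)"
    if AB: "A \<in> positive_invertible_operators" "B \<in> positive_invertible_operators" for A B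
  proof -
    have "A \<in> positive_operators" "B \<in> positive_operators"
      using AB by (auto simp: positive_invertible_operators_def)
    moreover have "\<sigma> A B = \<sigma> B A" using assms AB by (simp add: symmetric_operator_mean_def)
    ultimately show ?thesis using h(5) AB by (simp add: mean_of_def)
  qed
  then show thesis using that h by blast
qed

theorem theorem2p1:
  fixes f :: "real \<Rightarrow> real"
  assumes separable: "separable_space (euclidean :: 'h::complex_hilbert_space topology)"
    and infinite_dim: "\<not> (\<exists>S :: 'h set. finite S \<and> module.span scaleC S = UNIV)"
    and cont: "continuous_on {0<..} f"
    and nonneg: "\<forall>t>0. 0 \<le> f t"
  shows
    "(operator_monotone_on (positive_invertible_operators :: ('h \<Rightarrow>\<^sub>L 'h) set) (\<lambda>t. - f t)
      \<longleftrightarrow>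
      (\<forall>\<sigma> :: ('h \<Rightarrow>\<^sub>L 'h) \<Rightarrow> ('h \<Rightarrow>\<^sub>L 'h) \<Rightarrow> ('h \<Rightarrow>\<^sub>L 'h).
         symmetric_operator_mean \<sigma> \<longrightarrow>
         (\<forall>A\<in>positive_invertible_operators. \<forall>B\<in>positive_invertible_operators.
            fun_calc f (A \<triangledown> B) \<le>\<^sub>L \<sigma> (fun_calc f A) (fun_calc f B))))
     \<and>
     (operator_monotone_on (positive_invertible_operators :: ('h \<Rightarrow>\<^sub>L 'h) set) (\<lambda>t. - f t)
      \<longleftrightarrow>
      (\<forall>A\<in>(positive_invertible_operators :: ('h \<Rightarrow>\<^sub>L 'h) set).
         \<forall>B\<in>positive_invertible_operators.
            fun_calc f (A \<triangledown> B) \<le>\<^sub>L geometric_mean (fun_calc f A) (fun_calc f B)))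
     \<and>
     (operator_monotone_on (positive_invertible_operators :: ('h \<Rightarrow>\<^sub>L 'h) set) (\<lambda>t. - f t)
      \<longleftrightarrow>
      (\<exists>\<sigma> :: ('h \<Rightarrow>\<^sub>L 'h) \<Rightarrow> ('h \<Rightarrow>\<^sub>L 'h) \<Rightarrow> ('h \<Rightarrow>\<^sub>L 'h).
         symmetric_operator_mean \<sigma> \<and>
         (\<exists>A\<in>positive_operators. \<exists>B\<in>positive_operators. \<sigma> A B \<noteq> A \<triangledown> B) \<and>
         (\<forall>A\<in>positive_invertible_operators. \<forall>B\<in>positive_invertible_operators.
            fun_calc f (A \<triangledown> B) \<le>\<^sub>L \<sigma> (fun_calc f A) (fun_calc f B))))"
    (is "(?a1 \<longleftrightarrow> ?a2) \<and> (?a1 \<longleftrightarrow> ?a3) \<and> (?a1 \<longleftrightarrow> ?a4)")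
proof -
  obtain V1 V2 W1 W2 :: "'h \<Rightarrow>\<^sub>L 'h" where D: "doubling V1 V2 W1 W2"
    using ex_doubling[OF separable infinite_dim] .
  obtain e1 e2 :: 'h
    where e: "cinner e1 e1 = 1" "cinner e2 e2 = 1" "cinner e1 e2 = 0" "cinner e2 e1 = 0"
    using ex_orthonormal_pair[OF separable infinite_dim] .
  note nontrivial = unit_vectors(6)[OF e]
  have 12: ?a2 if ?a1
  proof (intro allI impI ballI)
    fix \<sigma> :: "('h \<Rightarrow>\<^sub>L 'h) \<Rightarrow> ('h \<Rightarrow>\<^sub>L 'h) \<Rightarrow> ('h \<Rightarrow>\<^sub>L 'h)" and A B :: "'h \<Rightarrow>\<^sub>L 'h"
    assume "symmetric_operator_mean \<sigma>"
      and AB: "A \<in> positive_invertible_operators" "B \<in> positive_invertible_operators"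
    then obtain h where h: "continuous_on {0..} h" "\<forall>t\<ge>0. 0 \<le> h t" "h 1 = 1"
      "operator_monotone_on (positive_operators :: ('h \<Rightarrow>\<^sub>L 'h) set) h"
      "\<forall>A\<in>positive_invertible_operators. \<forall>B\<in>positive_invertible_operators.
        mean_formula h A B = mean_formula h B (A :: 'h \<Rightarrow>\<^sub>L 'h)"
      and \<sigma>: "\<forall>A\<in>positive_operators. \<forall>B\<in>positive_operators. \<sigma> A B = mean_of h A B"
      by (elim symmetric_operator_meanE)
    note AB = AB[unfolded positive_invertible_operators_eq]
    note fAB = fun_calc_nonneg_above[OF cont nonneg AB(1)] fun_calc_nonneg_above[OF cont nonneg AB(2)]
    have "self_adjoint (fun_calc f (A \<triangledown> B))"
      by (rule fun_calc_self_adjoint_above[OF arithmetic_mean_strictly_positive[OF AB] up_closed_Ioi cont])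
    moreover have "self_adjoint (mean_of h (fun_calc f A) (fun_calc f B))"
      by (rule self_adjoint_mean_of[OF D nontrivial h fAB])
    moreover have "ip (fun_calc f (A \<triangledown> B) x) x \<le> ip (mean_of h (fun_calc f A) (fun_calc f B) x) x" for x
      by (rule antitone_imp_mean_ineq[OF cont nonneg D nontrivial
            that[unfolded positive_invertible_operators_eq] h AB])
    ultimately show "fun_calc f (A \<triangledown> B) \<le>\<^sub>L \<sigma> (fun_calc f A) (fun_calc f B)"
      using \<sigma> fAB by (simp add: loewner_le_iff positive_operators_eq)
  qed
  have 23: ?a3 if ?a2
    using that symmetric_geometric_mean by blast
  have 34: ?a4 if ?a3
  proof -
    obtain A B :: "'h \<Rightarrow>\<^sub>L 'h"
      where "A \<in> positive_operators" "B \<in> positive_operators" "geometric_mean A B \<noteq> A \<triangledown> B"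
      using geometric_mean_neq_arithmetic[OF nontrivial] .
    then show ?thesis
      using that symmetric_geometric_mean by (intro exI[of _ geometric_mean]) blast
  qed
  have 41: ?a1 if a4: ?a4
  proof -
    obtain \<sigma> :: "('h \<Rightarrow>\<^sub>L 'h) \<Rightarrow> ('h \<Rightarrow>\<^sub>L 'h) \<Rightarrow> ('h \<Rightarrow>\<^sub>L 'h)"
      where sym: "symmetric_operator_mean \<sigma>"
        and neq: "\<exists>A\<in>positive_operators. \<exists>B\<in>positive_operators. \<sigma> A B \<noteq> A \<triangledown> B"
        and ineq: "\<forall>A\<in>positive_invertible_operators. \<forall>B\<in>positive_invertible_operators.
            fun_calc f (A \<triangledown> B) \<le>\<^sub>L \<sigma> (fun_calc f A) (fun_calc f B)"
      using a4 by blast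
    obtain h where h: "continuous_on {0..} h" "\<forall>t\<ge>0. 0 \<le> h t" "h 1 = 1"
      "operator_monotone_on (positive_operators :: ('h \<Rightarrow>\<^sub>L 'h) set) h"
      "\<forall>A\<in>positive_invertible_operators. \<forall>B\<in>positive_invertible_operators.
        mean_formula h A B = mean_formula h B (A :: 'h \<Rightarrow>\<^sub>L 'h)"
      and \<sigma>: "\<forall>A\<in>positive_operators. \<forall>B\<in>positive_operators. \<sigma> A B = mean_of h A B"
      using sym by (elim symmetric_operator_meanE)
    \<comment> \<open>Otherwise \<open>\<sigma>\<close> would coincide with
      \<open>\<triangledown>\<close> on all positive operators, singular ones included.\<close>
    have strict: "\<exists>t>0. h t \<noteq> (1 + t) / 2"
    proof (rule ccontr)
      assume "\<not> ?thesis"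
      then have "\<And>t. t > 0 \<Longrightarrow> h t = (1 + t) / 2" by blast
      from mean_of_arithmetic[OF this] show False
        using neq \<sigma> unfolding positive_operators_eq by metis
    qed
    have "ip (fun_calc f (A \<triangledown> B) x) x \<le> ip (mean_of h (fun_calc f A) (fun_calc f B) x) x"
      if "A \<in> strictly_positive" "B \<in> strictly_positive" for A B :: "'h \<Rightarrow>\<^sub>L 'h" and x
    proof -
      have "fun_calc f (A \<triangledown> B) \<le>\<^sub>L \<sigma> (fun_calc f A) (fun_calc f B)"
        using ineq that by (simp add: positive_invertible_operators_eq)
      moreover have "\<sigma> (fun_calc f A) (fun_calc f B) = mean_of h (fun_calc f A) (fun_calc f B)"
        using \<sigma> fun_calc_nonneg_above[OF cont nonneg that(1)] fun_calc_nonneg_above[OF cont nonneg that(2)]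
        by (simp add: positive_operators_eq)
      ultimately show ?thesis by (simp add: loewner_le_ip)
    qed
    from mean_ineq_imp_antitone[OF cont nonneg e D h this strict]
    show ?thesis by (simp add: positive_invertible_operators_eq)
  qed
  show ?thesis using 12 23 34 41 by blast
qed

end
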